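(* Let $x\ge 2$, let $p_0$ be a prime, $v\in\mathbb{Z}_{\ge 0}$, $\alpha_1>0$, and $\alpha_2\in(0,p_0)$. Let $f\in\mathscr{M}(A_1,A_2)$ with some $A_1>0$ and $A_2\colon\mathbb{R}_{>0}\to\mathbb{R}_{>0}$. For every prime $p$ let $\mathcal{E}_p\subseteq(\mathbb{Z}/p\mathbb{Z})^{\times}$ be a set with $\#\mathcal{E}_p=\nu(p)\le v$, and let $\mathcal{S}$ be the set of positive integers $n\le x$ such that $n \bmod p\notin\mathcal{E}_p$ for every prime $p$. Let $E\subseteq\mathbb{P}$ with $\min E\ge p_0$, let $g\in\{\omega,\Omega\}$, and put $\beta=\alpha_1$ if $g=\omega$ and $\beta=\alpha_2$ if $g=\Omega$. Then \[\sum_{\substack{n\in\mathcal{S}\\ g(n,E)=k}}f(n)\ll\frac{x\,(M_f(x,E)+O(1))^{k}}{k!\,\log x}\,e^{M_f(x,E^c)-M_\nu(x)}\] for all integers $0\le k\le\beta M_f(x,E)$. Furthermore, in the case $E=\mathbb{P}$, \[\sum_{\substack{n\in\mathcal{S}\\ g(n)=k}}f(n)\ll\frac{x\,(M_f(x)+O(1))^{k-1}}{(k-1)!\,\log x}\,e^{-M_\nu(x)}\] for all integers $1\le k\le\beta M_f(x)$. In both estimates the implied constant in $\ll$ depends at most on $A_1,A_2,v,\beta$ and, when $g=\Omega$, also on $p_0$; each term $O(1)$ stands for a nonnegative constant depending at most on $A_1,A_2,v$.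
   Context: $\mathbb{N}$ is the set of positive integers, $\mathbb{P}$ the set of primes, and $p$ always denotes a prime. $\Omega(n)$ is the number of prime factors of $n$ counted with multiplicity. For a constant $A_1>0$ and a function $A_2\colon\mathbb{R}_{>0}\to\mathbb{R}_{>0}$, $\mathscr{M}(A_1,A_2)$ is the class of functions $f\colon\mathbb{N}\to\mathbb{R}_{\ge0}$ that are multiplicative ($f(1)=1$ and $f(mn)=f(m)f(n)$ whenever $\gcd(m,n)=1$) and satisfy (i) $f(n)\le A_1^{\Omega(n)}$ for all $n\in\mathbb{N}$; (ii) for every $\epsilon>0$, $f(n)\le A_2(\epsilon)n^{\epsilon}$ for all $n\in\mathbb{N}$. For $E\subseteq\mathbb{P}$ put $E^c=\mathbb{P}\setminus E$, $\omega(n,E)=\#\{p\in E: p\mid n\}$, $\Omega(n,E)=\#\{(p,\ell)\in E\times\mathbb{N}: p^\ell\mid n\}$, and $\omega(n)=\omega(n,\mathbb{P})$, $\Omega(n)=\Omega(n,\mathbb{P})$. For $h\colon\mathbb{P}\to\mathbb{R}_{\ge0}$ put $M_h(x,E)=\sum_{p\le x,\,p\in E}h(p)/p$ and $M_h(x)=M_h(x,\mathbb{P})$; in particular $M_\nu(x)=\sum_{p\le x}\nu(p)/p$. $X\ll Y$ means $|X|\le C Y$ for a constant $C>0$ (the implied constant) with the stated dependence only. *)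

theory Defs
  imports Complex_Main "HOL-Number_Theory.Number_Theory"
begin

abbreviation Primes :: "nat set" where
  "Primes \<equiv> {p. prime p}"

text \<open>In the next three definitions \<open>E\<close> is meant to be a set of primes. For \<open>n > 0\<close> the
  sets whose cardinality is taken are then finite.\<close>

definition omega :: "nat \<Rightarrow> nat set \<Rightarrow> nat" where
  "omega n E = card {p \<in> E. p dvd n}"

definition Omega :: "nat \<Rightarrow> nat set \<Rightarrow> nat" where
  "Omega n E = card {(p, l). p \<in> E \<and> l \<ge> 1 \<and> p ^ l dvd n}"

definition msum :: "(nat \<Rightarrow> real) \<Rightarrow> real \<Rightarrow> nat set \<Rightarrow> real" where
  "msum h x E = (\<Sum>p | p \<in> E \<and> real p \<le> x. h p / real p)"

text \<open>Functions on the positive integers are total functions on \<^typ>\<open>nat\<close> whose value at \<open>0\<close>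
  is unconstrained.\<close>

definition mult_class :: "real \<Rightarrow> (real \<Rightarrow> real) \<Rightarrow> (nat \<Rightarrow> real) set" where
  "mult_class A1 A2 = {f.
     (\<forall>n\<ge>1. f n \<ge> 0) \<and>
     f 1 = 1 \<and>
     (\<forall>m\<ge>1. \<forall>n\<ge>1. coprime m n \<longrightarrow> f (m * n) = f m * f n) \<and>
     (\<forall>n\<ge>1. f n \<le> A1 ^ Omega n Primes) \<and>
     (\<forall>\<epsilon>>0. \<forall>n\<ge>1. f n \<le> A2 \<epsilon> * real n powr \<epsilon>)}"

text \<open>Residue classes modulo \<open>p\<close> are represented by elements of the carrier \<open>{0..p - 1}\<close> of
  \<^term>\<open>residue_ring (int p)\<close>. The condition ranges over all primes, also those exceeding \<open>x\<close>.\<close>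

definition sifted :: "real \<Rightarrow> (nat \<Rightarrow> int set) \<Rightarrow> nat set" where
  "sifted x R = {n. n \<ge> 1 \<and> real n \<le> x \<and> (\<forall>p. prime p \<longrightarrow> int n mod int p \<notin> R p)}"

text \<open>The definition of \<^const>\<open>Omega\<close> agrees with counting prime factors with multiplicity.\<close>

lemma Omega_Primes_eq_size:
  assumes "n > 0"
  shows "Omega n Primes = size (prime_factorization n)"
proof -
  have "{(p, l). p \<in> Primes \<and> l \<ge> 1 \<and> p ^ l dvd n}
      = (SIGMA p:prime_factors n. {1..multiplicity p n})"
  proof -
    have "p ^ l dvd n \<longleftrightarrow> l \<le> multiplicity p n" if "prime p" for p l
      using that assms by (intro power_dvd_iff_le_multiplicity) (auto simp: prime_gt_1_nat)
    then show ?thesis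
      by (auto simp: prime_factors_multiplicity)
  qed
  then have "Omega n Primes = (\<Sum>p\<in>prime_factors n. multiplicity p n)"
    by (simp add: Omega_def)
  also have "\<dots> = size (prime_factorization n)"
    by (auto simp: size_multiset_overloaded_eq count_prime_factorization_prime
        in_prime_factors_imp_prime intro!: sum.cong)
  finally show ?thesis .
qed

end

theory Submission
  imports Defs "HOL-Computational_Algebra.Formal_Power_Series" "HOL-Analysis.Analysis"
begin

text \<open>
  Write \<open>n = m p\<close> with \<open>p\<close> the largest prime factor of \<open>n\<close>. For fixed \<open>m\<close> the admissible primes
  \<open>p \<le> X = x / m\<close> avoid \<open>\<nu>(q) + 1\<close> residue classes modulo each prime \<open>q\<close> not dividing \<open>m\<close>, so an
  upper bound sieve shows that there are \<open>O(X / log X \<cdot> exp (- M\<^sub>\<nu>(X)))\<close> of them, up to a factor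
  \<open>\<Prod>\<^bsub>q | m\<^esub> exp (v / q)\<close>. It remains to sum \<open>f(m) / m\<close> over the \<open>m\<close> with \<open>k - 1\<close> or \<open>k\<close> prime factors
  in \<open>E\<close>, which the generating function \<open>exp (M t)\<close> bounds by \<open>M^k / k!\<close>. When \<open>log X\<close> is much
  smaller than \<open>log x\<close>, the number \<open>m\<close> is large but free of large prime factors, and Rankin's trick
  more than compensates for the loss of powers of \<open>log x / log X\<close>. The remaining \<open>n\<close> (small,
  without a large prime factor, or divisible by a large proper prime power) contribute
  \<open>x exp (- c \<surd>log x)\<close> times the trivial bound, which absorbs every power of \<open>log x\<close>.
\<close>

section \<open>Sums over primes\<close>

text \<open>The obstacle is uniformity in \<open>k\<close>: as \<open>k\<close> may be as large as
  \<open>\<beta>\<close> times \<open>M = M_f(x, E)\<close>, lowering the number of prime factors by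
  \<open>w\<close> costs a factor \<open>\<beta>^w\<close>. A prime power \<open>p^l\<close> with
  \<open>p\<close> in \<open>E\<close> thus enters as \<open>\<beta>^(w l) f(p^l) / p^l\<close>, and
  for \<Omega> this is summable at small primes only if \<open>\<beta> < p\<close>; hence
  \<open>\<beta> < p_0\<close>. With \<open>max \<beta> 1 = p_0^\<theta>\<close> there remains a
  margin \<open>1 - \<theta> > 0\<close>, cut into 16 parts \<open>\<delta>\<close>: one pays for
  \<open>f(p^l)\<close>, two for Rankin's weight, the rest ensures convergence. Rankin exponents
  must then stay below \<open>2 \<delta>\<close>. Demanding a prime factor above
  \<open>exp (sqrt (log x))\<close> achieves this for large \<open>x\<close>, since all exponents
  are then at most \<open>1 / sqrt (log x)\<close>. About the primes only two one-sided estimates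
  are used: the sum of \<open>1 / p\<close> over \<open>y < p \<le> y^2\<close> is at most 4, and
  \<open>log x\<close> is at most a constant times the exponential of the sum of
  \<open>1 / p\<close> over \<open>p \<le> x\<close>. Scales are therefore compared by counting
  squarings, and losses of a constant factor per squaring are beaten by Rankin's exponential
  gain.\<close>

lemma finite_nat_real_le [simp]: "finite {n::nat. P n \<and> real n \<le> x}"
proof (rule finite_subset)
  show "{n. P n \<and> real n \<le> x} \<subseteq> {..nat \<lfloor>x\<rfloor>}" by (auto simp: le_nat_floor)
qed simp

abbreviation primes_le :: "real \<Rightarrow> nat set" where
  "primes_le x \<equiv> {p. prime p \<and> real p \<le> x}"

abbreviation primes_between :: "real \<Rightarrow> real \<Rightarrow> nat set" where
  "primes_between y x \<equiv> {p. (prime p \<and> y < real p) \<and> real p \<le> x}"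

text \<open>The radical of \<open>k\<close> divides \<open>k\<close>.\<close>

lemma sum_ln_prime_factors_le:
  assumes "k > 0"
  shows "(\<Sum>p\<in>prime_factors k. ln (real p)) \<le> ln (real k)"
proof -
  have "(\<Prod>p\<in>prime_factors k. p) dvd (\<Prod>p\<in>prime_factors k. p ^ multiplicity p k)"
    by (intro prod_dvd_prod) (auto simp: prime_factors_multiplicity intro!: dvd_power)
  also have "\<dots> = k" using assms by (simp add: prime_factorization_nat[symmetric])
  finally have "(\<Prod>p\<in>prime_factors k. p) \<le> k" using assms by (intro dvd_imp_le)
  then have le: "real (\<Prod>p\<in>prime_factors k. p) \<le> real k" by linarith
  have pos: "real (\<Prod>p\<in>prime_factors k. p) > 0"
    by (auto intro!: prod_pos simp: in_prime_factors_imp_prime prime_gt_0_nat simp flip: of_nat_prod)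
  have "(\<Sum>p\<in>prime_factors k. ln (real p)) = ln (\<Prod>p\<in>prime_factors k. real p)"
    by (rule ln_prod[symmetric]) (auto dest: in_prime_factors_imp_prime prime_gt_0_nat)
  also have "\<dots> \<le> ln (real k)" using le pos by (simp add: ln_mono)
  finally show ?thesis .
qed

lemma card_multiples_upto:
  assumes "p > 0" shows "card {k\<in>{1..n}. p dvd k} = n div (p::nat)"
proof -
  have "{k\<in>{1..n}. p dvd k} = (*) p ` {1..n div p}"
    using assms by (auto simp: dvd_def less_eq_div_iff_mult_less_eq mult.commute Suc_le_eq)
  moreover have "inj_on ((*) p) {1..n div p}" using assms by (auto simp: inj_on_def)
  ultimately show ?thesis by (simp add: card_image)
qed

text \<open>The crude bound \<open>\<lfloor>t\<rfloor> \<ge> t / 2\<close> for \<open>t \<ge> 1\<close> in the factorisation of \<open>n!\<close> makes an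
  appeal to Chebyshev's estimate unnecessary.\<close>

lemma sum_ln_over_primes_le:
  fixes y :: real assumes "y \<ge> 1"
  shows "(\<Sum>p\<in>primes_le y. ln (real p) / real p) \<le> 2 * ln y"
proof -
  define n where "n = nat \<lfloor>y\<rfloor>"
  define Q where "Q = {p. prime p \<and> p \<le> n}"
  have n1: "n \<ge> 1" using assms by (simp add: n_def le_nat_floor)
  have ny: "real n \<le> y" using assms by (simp add: n_def)
  have Q: "primes_le y = Q" using assms by (auto simp: Q_def n_def le_nat_floor le_nat_iff le_floor_iff)
  have finQ: "finite Q" by (rule finite_subset[of _ "{..n}"]) (auto simp: Q_def)
  have "(\<Sum>p\<in>Q. real n / (2 * real p) * ln (real p)) \<le> (\<Sum>p\<in>Q. \<Sum>k\<in>{k\<in>{1..n}. p dvd k}. ln (real p))"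
  proof (rule sum_mono)
    fix p assume "p \<in> Q"
    then have p: "prime p" "p \<le> n" by (auto simp: Q_def)
    then have p0: "p > 0" by (simp add: prime_gt_0_nat)
    have "n < p * (n div p) + p"
      by (metis add_strict_left_mono mod_less_divisor mult_div_mod_eq p0)
    moreover have "p \<le> p * (n div p)"
      using p p0 by (metis div_greater_zero_iff less_eq_Suc_le mult.right_neutral mult_le_mono2 One_nat_def)
    ultimately have "n \<le> 2 * (p * (n div p))" by linarith
    then have "n \<le> 2 * p * (n div p)" by (simp only: mult.assoc)
    then have "real n \<le> 2 * real p * real (n div p)"
      by (metis (mono_tags, opaque_lifting) of_nat_le_iff of_nat_mult of_nat_numeral)
    then have "real n / (2 * real p) \<le> real (n div p)" using p0 by (simp add: field_simps)
    moreover have "ln (real p) \<ge> 0" using p0 by simp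
    moreover have "(\<Sum>k\<in>{k\<in>{1..n}. p dvd k}. ln (real p)) = real (n div p) * ln (real p)"
      using card_multiples_upto[OF p0, of n] by simp
    ultimately show "real n / (2 * real p) * ln (real p) \<le> (\<Sum>k\<in>{k\<in>{1..n}. p dvd k}. ln (real p))"
      using mult_right_mono[of "real n / (2 * real p)" "real (n div p)" "ln (real p)"] by linarith
  qed
  \<comment> \<open>Double counting of the pairs with \<open>p dvd k\<close>: the weights gathered
    at one \<open>k\<close> form the logarithm of its radical, hence at most
    \<open>ln n\<close>.\<close>
  also have "\<dots> = (\<Sum>k\<in>{1..n}. \<Sum>p\<in>{p\<in>Q. p dvd k}. ln (real p))"
    using sum.swap_restrict[of Q "{1..n}" "\<lambda>p k. ln (real p)" "\<lambda>p k. p dvd k"] finQ by simp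
  also have "\<dots> \<le> (\<Sum>k\<in>{1..n}. ln (real n))"
  proof (rule sum_mono)
    fix k assume k: "k \<in> {1..n}"
    have "{p\<in>Q. p dvd k} = prime_factors k"
      using k by (auto simp: Q_def prime_factors_dvd dest: dvd_imp_le)
    moreover have "(\<Sum>p\<in>prime_factors k. ln (real p)) \<le> ln (real k)"
      using k by (intro sum_ln_prime_factors_le) auto
    moreover have "ln (real k) \<le> ln (real n)" using k by auto
    ultimately show "(\<Sum>p\<in>{p\<in>Q. p dvd k}. ln (real p)) \<le> ln (real n)" by (simp only:)
  qed
  also have "\<dots> = real n * ln (real n)" by simp
  finally have "real n * (\<Sum>p\<in>Q. ln (real p) / real p) / 2 \<le> real n * ln (real n)"
    by (simp add: sum_distrib_left sum_divide_distrib mult.commute)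
  then have "(\<Sum>p\<in>Q. ln (real p) / real p) \<le> 2 * ln (real n)" using n1 by simp
  also have "\<dots> \<le> 2 * ln y" using n1 ny by (simp add: ln_mono)
  finally show ?thesis by (simp add: Q)
qed

text \<open>For \<open>p > y\<close> the factor \<open>ln p / ln y\<close> is at least 1, so
  \<open>sum_ln_over_primes_le\<close> at \<open>y^2\<close> applies. This bound takes the place of
  Mertens' theorem wherever a sum of \<open>1 / p\<close> is estimated from above.\<close>

lemma sum_inverse_primes_between_square:
  fixes y :: real assumes "y > 1"
  shows "(\<Sum>p\<in>primes_between y (y ^ 2). 1 / real p) \<le> 4"
proof -
  have "(\<Sum>p\<in>primes_between y (y ^ 2). 1 / real p)
      \<le> (\<Sum>p\<in>primes_between y (y ^ 2). ln (real p) / real p / ln y)"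
  proof (rule sum_mono)
    fix p assume "p \<in> primes_between y (y ^ 2)"
    then have "y < real p" by simp
    then have "ln y \<le> ln (real p)" "real p > 0" "ln y > 0" using assms by auto
    then show "1 / real p \<le> ln (real p) / real p / ln y" by (simp add: field_simps)
  qed
  also have "\<dots> \<le> (\<Sum>p\<in>primes_le (y ^ 2). ln (real p) / real p / ln y)"
    using assms by (intro sum_mono2) (auto intro!: divide_nonneg_nonneg ln_ge_zero dest: prime_ge_1_nat)
  also have "\<dots> \<le> 2 * ln (y ^ 2) / ln y"
    using sum_ln_over_primes_le[of "y ^ 2"] assms
    unfolding sum_divide_distrib[symmetric] by (intro divide_right_mono) auto
  also have "\<dots> = 4" using assms by (simp add: ln_realpow)
  finally show ?thesis .
qed

text \<open>One square per step. After exponentiation each squaring costs a bounded factor, which is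
  the form in which the bound is used later.\<close>

lemma sum_inverse_primes_between:
  fixes y x :: real assumes "y > 1" "x \<le> y ^ (2 ^ i)"
  shows "(\<Sum>p\<in>primes_between y x. 1 / real p) \<le> 4 * real i"
proof -
  have "(\<Sum>p\<in>primes_between y (y ^ (2 ^ i)). 1 / real p) \<le> 4 * real i"
  proof (induction i)
    case 0
    have "primes_between y (y ^ (2 ^ 0)) = {}" by auto
    then show ?case by (simp only: sum.empty of_nat_0 mult_zero_right order_refl)
  next
    case (Suc i)
    define u where "u = y ^ (2 ^ i)"
    have u: "u > 1" using assms by (simp add: u_def)
    have eq: "y ^ (2 ^ Suc i) = u ^ 2" by (simp add: u_def mult.commute flip: power_mult)
    have "(\<Sum>p\<in>primes_between y (y ^ (2 ^ Suc i)). 1 / real p)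
        \<le> (\<Sum>p\<in>primes_between y u \<union> primes_between u (u ^ 2). 1 / real p)"
      unfolding eq by (intro sum_mono2) auto
    also have "\<dots> \<le> (\<Sum>p\<in>primes_between y u. 1 / real p) + (\<Sum>p\<in>primes_between u (u ^ 2). 1 / real p)"
      by (subst sum.union_inter[symmetric]) (auto intro!: sum_nonneg)
    also have "\<dots> \<le> 4 * real (Suc i)"
      using Suc sum_inverse_primes_between_square[OF u] by (simp add: u_def)
    finally show ?case .
  qed
  moreover have "(\<Sum>p\<in>primes_between y x. 1 / real p) \<le> (\<Sum>p\<in>primes_between y (y ^ (2 ^ i)). 1 / real p)"
    using assms by (intro sum_mono2) auto
  ultimately show ?thesis by linarith
qed

text \<open>About \<open>log 2 (log 2 x)\<close> squarings lead from 2 to \<open>x\<close>, so the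
  prime sum is \<open>O(log log x)\<close>. The exponent \<open>A\<close> is larger than the true
  one, but any power of \<open>ln x\<close> will do.\<close>

lemma exp_sum_inverse_primes_le:
  fixes \<kappa> :: real assumes "\<kappa> \<ge> 0"
  shows "\<exists>C>0. \<exists>A\<ge>0. \<forall>x\<ge>2. exp (\<kappa> * (\<Sum>p\<in>primes_le x. 1 / real p)) \<le> C * ln x powr A"
proof -
  define A where "A = 4 * \<kappa> / ln 2"
  \<comment> \<open>\<open>9 / 2\<close> is \<open>1 / 2\<close> for the prime 2, which
    \<open>primes_between 2 x\<close> omits, plus 4 for rounding \<open>log 2 L\<close> up; the last
    factor passes from \<open>log 2 x\<close> to \<open>ln x\<close>.\<close>
  define C where "C = exp (\<kappa> * (9 / 2)) * (1 / ln 2) powr A"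
  have "exp (\<kappa> * (\<Sum>p\<in>primes_le x. 1 / real p)) \<le> C * ln x powr A" if x: "x \<ge> 2" for x :: real
  proof -
    define L where "L = log 2 x"
    have L: "L \<ge> 1" using x by (simp add: L_def)
    define i where "i = nat \<lceil>log 2 L\<rceil>"
    have i: "real i \<le> 1 + log 2 L" "log 2 L \<le> real i" using L of_int_ceiling_le_add_one[of "log 2 L"] real_nat_ceiling_ge[of "log 2 L"]
      by (auto simp: i_def add.commute)
    have "L \<le> 2 ^ i" using i(2) L by (simp add: log_le_iff powr_realpow)
    then have "x \<le> 2 powr (2 ^ i)" using x by (simp add: L_def log_le_iff)
    then have "x \<le> 2 ^ (2 ^ i)" by (simp add: powr_realpow[symmetric])
    then have "(\<Sum>p\<in>primes_between 2 x. 1 / real p) \<le> 4 * real i"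
      by (intro sum_inverse_primes_between) auto
    moreover have "(\<Sum>p\<in>primes_le x. 1 / real p) \<le> (\<Sum>p\<in>insert 2 (primes_between 2 x). 1 / real p)"
      by (intro sum_mono2) (auto dest: prime_ge_2_nat)
    moreover have "\<dots> = 1 / 2 + (\<Sum>p\<in>primes_between 2 x. 1 / real p)"
      by (subst sum.insert) auto
    ultimately have "(\<Sum>p\<in>primes_le x. 1 / real p) \<le> 9 / 2 + 4 * log 2 L"
      using i by linarith
    then have "\<kappa> * (\<Sum>p\<in>primes_le x. 1 / real p) \<le> \<kappa> * (9 / 2) + A * ln L"
      using assms mult_left_mono[of _ _ \<kappa>] by (fastforce simp: A_def log_def algebra_simps)
    then have "exp (\<kappa> * (\<Sum>p\<in>primes_le x. 1 / real p)) \<le> exp (\<kappa> * (9 / 2)) * L powr A"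
      using L by (simp add: powr_def flip: exp_add)
    also have "L powr A = (1 / ln 2) powr A * ln x powr A"
      using x by (simp add: L_def log_def powr_divide)
    finally show ?thesis by (simp add: C_def mult.assoc)
  qed
  moreover have "C > 0" "A \<ge> 0" using assms by (auto simp: C_def A_def)
  ultimately show ?thesis by blast
qed

text \<open>Apply \<open>ln u \<le> u - 1\<close> at \<open>u = \<epsilon> * sqrt t\<close>, with
  \<open>\<epsilon>\<close> so small that \<open>2 * A * \<epsilon> \<le> c\<close>. Thus a saving
  \<open>exp (- c * sqrt (ln x))\<close> absorbs every power of \<open>ln x\<close>.\<close>

lemma powr_le_exp_sqrt:
  fixes A c :: real assumes "A \<ge> 0" "c > 0"
  shows "\<exists>C>0. \<forall>t>0. t powr A \<le> C * exp (c * sqrt t)"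
proof -
  define \<epsilon> where "\<epsilon> = c / (2 * (A + 1))"
  have \<epsilon>: "\<epsilon> > 0" "2 * A * \<epsilon> \<le> c" using assms by (auto simp: \<epsilon>_def field_simps)
  have "t powr A \<le> exp (2 * A * (- 1 - ln \<epsilon>)) * exp (c * sqrt t)" if "t > 0" for t
  proof -
    have "ln (\<epsilon> * sqrt t) \<le> \<epsilon> * sqrt t - 1" using \<epsilon> that by (intro ln_le_minus_one) auto
    then have "ln (sqrt t) \<le> \<epsilon> * sqrt t - 1 - ln \<epsilon>" using \<epsilon> that by (simp add: ln_mult)
    then have "2 * A * ln (sqrt t) \<le> 2 * A * (\<epsilon> * sqrt t - 1 - ln \<epsilon>)"
      using assms by (intro mult_left_mono) auto
    also have "\<dots> \<le> c * sqrt t + 2 * A * (- 1 - ln \<epsilon>)"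
      using mult_right_mono[OF \<epsilon>(2), of "sqrt t"] that by (simp add: algebra_simps)
    finally have "A * ln t \<le> c * sqrt t + 2 * A * (- 1 - ln \<epsilon>)" using that by (simp add: ln_sqrt)
    then show ?thesis using that by (simp add: powr_def add.commute flip: exp_add)
  qed
  then show ?thesis by (intro exI[of _ "exp (2 * A * (- 1 - ln \<epsilon>))"]) auto
qed

unbundle no vec_syntax
unbundle fps_syntax

section \<open>Sums of multiplicative functions with a prescribed number of prime factors\<close>

text \<open>\<open>w = id\<close> gives \<open>\<Omega>(m, E)\<close> and \<open>w l = of_bool (l \<ge> 1)\<close> gives \<open>\<omega>(m, E)\<close>.\<close>

definition wcount :: "(nat \<Rightarrow> nat) \<Rightarrow> nat \<Rightarrow> nat set \<Rightarrow> nat" where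
  "wcount w m E = (\<Sum>p\<in>prime_factors m \<inter> E. w (multiplicity p m))"

definition pfprod :: "(nat \<Rightarrow> nat \<Rightarrow> real) \<Rightarrow> nat \<Rightarrow> real" where
  "pfprod \<phi> m = (\<Prod>p\<in>prime_factors m. \<phi> p (multiplicity p m))"

definition smooth_upto :: "nat \<Rightarrow> nat set \<Rightarrow> nat set" where
  "smooth_upto N P = {m. 1 \<le> m \<and> m \<le> N \<and> prime_factors m \<subseteq> P}"

text \<open>A generating function whose variable counts prime factors in \<open>E\<close>. The
  cutoff \<open>m \<le> N\<close> keeps the coefficients finite sums, at the price that the Euler
  product holds only as an inequality (\<open>wcount_fps_insert_le\<close>).\<close>

definition wcount_fps :: "(nat \<Rightarrow> nat) \<Rightarrow> (nat \<Rightarrow> nat \<Rightarrow> real) \<Rightarrow> nat set \<Rightarrow> nat \<Rightarrow> nat set \<Rightarrow> real fps" where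
  "wcount_fps w \<phi> E N P = Abs_fps (\<lambda>j. \<Sum>m | m \<in> smooth_upto N P \<and> wcount w m E = j. pfprod \<phi> m)"

lemma finite_smooth_upto [simp]: "finite (smooth_upto N P)"
  by (rule finite_subset[of _ "{..N}"]) (auto simp: smooth_upto_def)

lemma pfprod_nonneg: "(\<And>p l. prime p \<Longrightarrow> l \<ge> 1 \<Longrightarrow> \<phi> p l \<ge> 0) \<Longrightarrow> pfprod \<phi> m \<ge> 0"
  unfolding pfprod_def by (intro prod_nonneg) (auto simp: prime_factors_multiplicity)

lemma wcount_fps_nonneg:
  "(\<And>p l. prime p \<Longrightarrow> l \<ge> 1 \<Longrightarrow> \<phi> p l \<ge> 0) \<Longrightarrow> wcount_fps w \<phi> E N P $ j \<ge> 0"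
  unfolding wcount_fps_def by (auto intro!: sum_nonneg pfprod_nonneg)

lemma prime_factors_prime_power_mult:
  fixes p m :: nat assumes "prime p" "\<not> p dvd m" "m > 0"
  shows "multiplicity p (p ^ l * m) = l"
    and "q \<noteq> p \<Longrightarrow> prime q \<Longrightarrow> multiplicity q (p ^ l * m) = multiplicity q m"
    and "prime_factors (p ^ l * m) = (if l = 0 then {} else {p}) \<union> prime_factors m"
proof -
  have p0: "p > 0" using assms by (simp add: prime_gt_0_nat)
  show 1: "multiplicity p (p ^ l * m) = l"
    using assms p0 by (simp add: prime_elem_multiplicity_mult_distrib not_dvd_imp_multiplicity_0)
  show "multiplicity q (p ^ l * m) = multiplicity q m" if "q \<noteq> p" "prime q"
    using assms p0 that
    by (simp add: prime_elem_multiplicity_mult_distrib multiplicity_distinct_prime_power)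
  show "prime_factors (p ^ l * m) = (if l = 0 then {} else {p}) \<union> prime_factors m"
    using assms p0 by (auto simp: prime_factors_product prime_factors_power prime_prime_factors)
qed

lemma
  fixes p m :: nat assumes "prime p" "\<not> p dvd m" "m > 0"
  shows pfprod_prime_power_mult:
      "pfprod \<phi> (p ^ l * m) = (if l = 0 then 1 else \<phi> p l) * pfprod \<phi> m"
    and wcount_prime_power_mult:
      "wcount w (p ^ l * m) E = (if p \<in> E \<and> l > 0 then w l else 0) + wcount w m E"
proof -
  note * = prime_factors_prime_power_mult[OF assms]
  have notin: "p \<notin> prime_factors m" using assms by (auto simp: in_prime_factors_iff)
  have eq: "multiplicity q (p ^ l * m) = multiplicity q m" if "q \<in> prime_factors m" for q
    using that notin by (intro *) (auto simp: in_prime_factors_iff)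
  show "pfprod \<phi> (p ^ l * m) = (if l = 0 then 1 else \<phi> p l) * pfprod \<phi> m"
    using notin by (auto simp: pfprod_def * eq intro!: prod.cong)
  have "(\<Sum>q\<in>prime_factors m \<inter> E. w (multiplicity q (p ^ l * m))) = wcount w m E"
    by (auto simp: wcount_def eq intro!: sum.cong)
  then show "wcount w (p ^ l * m) E = (if p \<in> E \<and> l > 0 then w l else 0) + wcount w m E"
    using notin by (auto simp: wcount_def *(1,3) Int_insert_left)
qed

text \<open>The Euler factor at \<open>p\<close>, from \<open>m = p^l * m'\<close> with
  \<open>p\<close> not dividing \<open>m'\<close>. The right side also contains products beyond
  \<open>N\<close>, hence only an inequality; \<open>l \<le> N\<close> suffices because
  \<open>l < 2^l \<le> p^l \<le> m\<close>. The first \<open>if\<close> supplies the value 1 at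
  \<open>l = 0\<close>, where \<open>\<phi>\<close> is unconstrained.\<close>

lemma wcount_fps_insert_le:
  assumes p: "prime p" "p \<notin> P" and nonneg: "\<And>p l. prime p \<Longrightarrow> l \<ge> 1 \<Longrightarrow> \<phi> p l \<ge> 0"
  shows "wcount_fps w \<phi> E N (insert p P) $ j \<le>
    (\<Sum>l\<le>N. fps_const (if l = 0 then 1 else \<phi> p l) *
       (fps_X ^ (if p \<in> E \<and> l > 0 then w l else 0) * wcount_fps w \<phi> E N P)) $ j"
proof -
  define \<psi> where "\<psi> l = (if l = 0 then 1 else \<phi> p l)" for l
  define w' where "w' l = (if p \<in> E \<and> l > 0 then w l else 0)" for l
  define S where "S = {m. m \<in> smooth_upto N (insert p P) \<and> wcount w m E = j}"
  define T where "T l = {m. m \<in> smooth_upto N P \<and> wcount w m E + w' l = j}" for l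
  have ndvd: "\<not> p dvd m" "m > 0" if "m \<in> smooth_upto N P" for m
    using that p by (auto simp: smooth_upto_def in_prime_factors_iff)
  have \<psi>0: "\<psi> l \<ge> 0" for l using nonneg[of p l] p by (auto simp: \<psi>_def)
  have sub: "S \<subseteq> (\<lambda>(l, m). p ^ l * m) ` (SIGMA l:{..N}. T l)"
  proof
    fix m assume m: "m \<in> S"
    then have m1: "1 \<le> m" "m \<le> N" "prime_factors m \<subseteq> insert p P" "wcount w m E = j"
      by (auto simp: S_def smooth_upto_def)
    define l where "l = multiplicity p m"
    obtain m' where m': "m = p ^ l * m'" "\<not> p dvd m'"
      using m1(1) p not_prime_unit[of p] unfolding l_def
      by (metis multiplicity_decompose' not_one_le_zero)
    have m'0: "m' > 0" using m' m1 by (intro gr0I) auto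
    note * = prime_factors_prime_power_mult[OF p(1) m'(2) m'0]
    have "l < 2 ^ l" by simp
    also have "\<dots> \<le> p ^ l" using p by (simp add: power_mono prime_ge_2_nat)
    also have "\<dots> \<le> m" using m'(1) m'0 by simp
    finally have lN: "l \<le> N" using m1 by simp
    have "m' \<le> m" using m'(1) p by (simp add: prime_gt_0_nat Suc_le_eq)
    moreover have "prime_factors m' \<subseteq> P"
      using m1(3) *(3)[of l] m' by (auto simp: in_prime_factors_iff split: if_splits)
    moreover have "w' l + wcount w m' E = j"
      using m1(4) wcount_prime_power_mult[OF p(1) m'(2) m'0, of w l E] m'(1)
      by (simp add: w'_def)
    ultimately have "m' \<in> T l" using m1 m'0 by (auto simp: T_def smooth_upto_def)
    then show "m \<in> (\<lambda>(l, m). p ^ l * m) ` (SIGMA l:{..N}. T l)"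
      using lN m'(1) by (intro image_eqI[of _ _ "(l, m')"]) auto
  qed
  have fin: "finite (T l)" for l unfolding T_def by (rule finite_subset[of _ "smooth_upto N P"]) auto
  have "wcount_fps w \<phi> E N (insert p P) $ j = (\<Sum>m\<in>S. pfprod \<phi> m)"
    by (simp add: wcount_fps_def S_def)
  also have "\<dots> \<le> (\<Sum>m\<in>(\<lambda>(l, m). p ^ l * m) ` (SIGMA l:{..N}. T l). pfprod \<phi> m)"
    using sub fin nonneg by (intro sum_mono2) (auto intro: pfprod_nonneg)
  also have "\<dots> \<le> (\<Sum>x\<in>(SIGMA l:{..N}. T l). (pfprod \<phi> \<circ> (\<lambda>(l, m). p ^ l * m)) x)"
    using fin nonneg by (intro sum_image_le) (auto intro: pfprod_nonneg)
  also have "\<dots> = (\<Sum>(l, m)\<in>(SIGMA l:{..N}. T l). \<psi> l * pfprod \<phi> m)"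
    using p ndvd by (intro sum.cong) (auto simp: pfprod_prime_power_mult \<psi>_def T_def)
  also have "\<dots> = (\<Sum>l\<le>N. \<psi> l * (\<Sum>m\<in>T l. pfprod \<phi> m))"
    using fin by (simp add: sum.Sigma[symmetric] sum_distrib_left)
  also have "\<dots> = (\<Sum>l\<le>N. \<psi> l * (fps_X ^ w' l * wcount_fps w \<phi> E N P) $ j)"
  proof (intro sum.cong refl arg_cong2[of _ _ _ _ "(*)"])
    fix l
    have "T l = (if j < w' l then {} else {m. m \<in> smooth_upto N P \<and> wcount w m E = j - w' l})"
      by (auto simp: T_def)
    then show "(\<Sum>m\<in>T l. pfprod \<phi> m) = (fps_X ^ w' l * wcount_fps w \<phi> E N P) $ j"
      by (simp add: fps_X_power_mult_nth wcount_fps_def)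
  qed
  also have "\<dots> = (\<Sum>l\<le>N. fps_const (\<psi> l) * (fps_X ^ w' l * wcount_fps w \<phi> E N P)) $ j"
    by (simp add: fps_sum_nth)
  finally show ?thesis by (simp add: \<psi>_def w'_def)
qed

text \<open>Each of the \<open>w\<close> factors of \<open>j! / (j - w)!\<close> is at most
  \<open>j \<le> \<beta> * T\<close>. This is where the range of \<open>k\<close> in the theorem
  takes effect: lowering the index by \<open>w\<close> costs only \<open>\<beta>^w\<close>.\<close>

lemma power_div_fact_diff_le:
  fixes T \<beta> :: real assumes "w \<le> j" "real j \<le> \<beta> * T" "T \<ge> 0"
  shows "T ^ (j - w) / fact (j - w) \<le> \<beta> ^ w * (T ^ j / fact j)"
proof -
  have "(fact j :: real) \<le> fact (j - w) * (\<beta> * T) ^ w"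
    using assms(1)
  proof (induction w)
    case (Suc w)
    have "(fact (j - w) :: real) = real (j - w) * fact (j - Suc w)"
      using Suc.prems by (metis Suc_diff_Suc Suc_le_eq fact_Suc of_nat_fact of_nat_mult)
    also have "\<dots> \<le> (\<beta> * T) * fact (j - Suc w)"
      using assms(2) by (intro mult_right_mono) auto
    finally have "(fact (j - w) :: real) * (\<beta> * T) ^ w \<le> (\<beta> * T) * fact (j - Suc w) * (\<beta> * T) ^ w"
      using assms(2) order_trans[OF of_nat_0_le_iff assms(2)] by (intro mult_right_mono) auto
    then show ?case using Suc by (simp add: algebra_simps)
  qed simp
  then have "T ^ (j - w) * fact j \<le> T ^ (j - w) * (fact (j - w) * (\<beta> * T) ^ w)"
    using assms by (intro mult_left_mono) auto
  also have "\<dots> = fact (j - w) * \<beta> ^ w * (T ^ (j - w) * T ^ w)"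
    by (simp add: power_mult_distrib)
  also have "T ^ (j - w) * T ^ w = T ^ j" using assms by (simp flip: power_add)
  finally show ?thesis by (simp add: field_simps)
qed

text \<open>The factor \<open>exp (R t)\<close> of the generating function absorbs, one prime at a time, the terms
  linear in \<open>t\<close>. Only the terms of higher order are then compared by means of \<open>j \<le> \<beta> T\<close>, so the
  bound loses just a constant factor.\<close>

lemma wcount_fps_mult_exp_le:
  assumes "finite P" "\<And>p. p \<in> P \<Longrightarrow> prime p" "N \<ge> 1"
    and nonneg: "\<And>p l. prime p \<Longrightarrow> l \<ge> 1 \<Longrightarrow> \<phi> p l \<ge> 0"
    and w1: "w 1 = 1"
    and W1: "\<And>p l. p \<in> P \<Longrightarrow> l \<ge> 2 \<Longrightarrow> p \<in> E \<Longrightarrow> W p l \<ge> \<beta> ^ w l"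
    and W2: "\<And>p l. p \<in> P \<Longrightarrow> l \<ge> 2 \<Longrightarrow> p \<notin> E \<Longrightarrow> W p l \<ge> 1"
    and \<beta>: "\<beta> \<ge> 0"
    and "R \<ge> 0" "R + (\<Sum>p\<in>P \<inter> E. \<phi> p 1) \<le> T" "real j \<le> \<beta> * T"
  shows "(wcount_fps w \<phi> E N P * fps_exp R) $ j \<le>
    T ^ j / fact j * exp ((\<Sum>p\<in>P - E. \<phi> p 1) + (\<Sum>p\<in>P. \<Sum>l=2..N. \<phi> p l * W p l))"
  using assms(1,2,9-11) W1 W2
proof (induction P arbitrary: R j rule: finite_induct)
  case empty
  have "smooth_upto N {} = {1}" using assms(3) by (auto simp: smooth_upto_def prime_factorization_empty_iff)
  moreover have "wcount w 1 E = 0" "pfprod \<phi> 1 = 1" by (simp_all add: wcount_def pfprod_def)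
  ultimately have "{m. m \<in> smooth_upto N {} \<and> wcount w m E = n} = (if n = 0 then {1} else {})" for n
    by auto
  then have "wcount_fps w \<phi> E N {} $ n = 1 $ n" for n
    using \<open>pfprod \<phi> 1 = 1\<close> by (simp add: wcount_fps_def)
  then have "wcount_fps w \<phi> E N {} = 1" by (rule fps_ext)
  moreover have "R ^ j \<le> T ^ j" using empty.prems(2,3) by (intro power_mono) auto
  ultimately show ?case by (simp add: divide_right_mono)
next
  case (insert p P)
  define D where "D = wcount_fps w \<phi> E N P"
  define Q where "Q = exp ((\<Sum>p\<in>P - E. \<phi> p 1) + (\<Sum>p\<in>P. \<Sum>l=2..N. \<phi> p l * W p l))"
  define \<psi> where "\<psi> l = (if l = 0 then 1 else \<phi> p l)" for l
  define w' where "w' l = (if p \<in> E \<and> l > 0 then w l else 0)" for l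
  define G where "G = D * fps_exp R"
  define B where "B = T ^ j / fact j * Q"
  have pr: "prime p" using insert by auto
  have \<phi>1: "\<phi> p 1 \<ge> 0" using nonneg pr by simp
  have Q0: "Q > 0" by (simp add: Q_def)
  have D0: "D $ i \<ge> 0" for i unfolding D_def using nonneg by (rule wcount_fps_nonneg)
  have G0: "G $ i \<ge> 0" for i
    unfolding G_def fps_mult_nth using D0 insert.prems(2) by (intro sum_nonneg mult_nonneg_nonneg) auto
  have SE: "(\<Sum>q\<in>insert p P \<inter> E. \<phi> q 1) = (if p \<in> E then \<phi> p 1 else 0) + (\<Sum>q\<in>P \<inter> E. \<phi> q 1)"
    using insert.hyps by (simp add: Int_insert_left)
  have SE0: "(\<Sum>q\<in>P \<inter> E. \<phi> q 1) \<ge> 0" using insert.prems(1) nonneg by (intro sum_nonneg) auto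
  have T0: "T \<ge> 0" using SE SE0 insert.prems(2,3) \<phi>1 by (auto split: if_splits)
  have IH: "(D * fps_exp R') $ i \<le> T ^ i / fact i * Q"
    if "R' \<ge> 0" "R' + (\<Sum>q\<in>P \<inter> E. \<phi> q 1) \<le> T" "real i \<le> \<beta> * T" for R' i
    unfolding D_def Q_def using that insert.prems(1,5,6) by (intro insert.IH) auto
  have RT: "R + (\<Sum>q\<in>P \<inter> E. \<phi> q 1) \<le> T" using insert.prems(3) SE \<phi>1 by (auto split: if_splits)
  have B0: "B \<ge> 0" using T0 Q0 by (simp add: B_def)
  have GB: "G $ j \<le> B" unfolding G_def B_def using RT insert.prems by (intro IH) auto
  have "(wcount_fps w \<phi> E N (insert p P) * fps_exp R) $ j \<le>
      ((\<Sum>l\<le>N. fps_const (\<psi> l) * (fps_X ^ w' l * D)) * fps_exp R) $ j"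
    unfolding fps_mult_nth[of _ "fps_exp R"]
    using wcount_fps_insert_le[where \<phi> = \<phi> and w = w and E = E and N = N, OF pr insert.hyps(2) nonneg]
      insert.prems(2)
    by (intro sum_mono mult_right_mono) (auto simp: \<psi>_def w'_def D_def)
  also have "\<dots> = (\<Sum>l\<le>N. \<psi> l * (fps_X ^ w' l * G) $ j)"
    by (simp add: sum_distrib_right mult.assoc fps_sum_nth G_def)
  also have "{..N} = insert 0 (insert 1 {2..N})" using assms(3) by auto
  also have "(\<Sum>l\<in>\<dots>. \<psi> l * (fps_X ^ w' l * G) $ j) =
      G $ j + \<phi> p 1 * (fps_X ^ w' 1 * G) $ j + (\<Sum>l=2..N. \<phi> p l * (fps_X ^ w' l * G) $ j)"
    by (simp add: \<psi>_def w'_def)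
  also have "\<dots> \<le> B * exp ((if p \<in> E then 0 else \<phi> p 1) + (\<Sum>l=2..N. \<phi> p l * W p l))"
  proof (cases "p \<in> E")
    case True
    \<comment> \<open>The two lowest terms of the Euler factor are dominated coefficientwise by an
      exponential series. Their product with \<open>G\<close> is then covered by the induction
      hypothesis at \<open>R + \<phi> p 1\<close>, for which the budget \<open>T\<close> still
      suffices.\<close>
    have linear_le: "(1 + fps_const (\<phi> p 1) * fps_X) $ n \<le> fps_exp (\<phi> p 1) $ n" for n
    proof (cases "n \<le> 1")
      case True
      then have "n = 0 \<or> n = 1" by linarith
      then show ?thesis by auto
    qed (use \<phi>1 in auto)
    have "G $ j + \<phi> p 1 * (fps_X ^ w' 1 * G) $ j = (G * (1 + fps_const (\<phi> p 1) * fps_X)) $ j"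
      using True w1 by (simp add: w'_def algebra_simps)
    also have "\<dots> \<le> (G * fps_exp (\<phi> p 1)) $ j"
      unfolding fps_mult_nth[of G] using G0 \<phi>1
      by (intro sum_mono mult_left_mono linear_le) auto
    also have "\<dots> = (D * fps_exp (R + \<phi> p 1)) $ j"
      by (simp add: G_def fps_exp_add_mult mult.assoc)
    also have "\<dots> \<le> B" unfolding B_def
      using insert.prems SE True \<phi>1 by (intro IH) auto
    finally have 1: "G $ j + \<phi> p 1 * (fps_X ^ w' 1 * G) $ j \<le> B" .
    \<comment> \<open>Here the index drops from \<open>j\<close> to \<open>j - w l\<close>. The
      induction hypothesis is taken at the unchanged \<open>R\<close>, and
      \<open>power_div_fact_diff_le\<close> turns the drop into \<open>\<beta> ^ w l\<close>, which
      \<open>W p l\<close> dominates.\<close>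
    have 2: "(\<Sum>l=2..N. \<phi> p l * (fps_X ^ w' l * G) $ j) \<le> (\<Sum>l=2..N. \<phi> p l * (W p l * B))"
    proof (intro sum_mono mult_left_mono)
      fix l assume l: "l \<in> {2..N}"
      then have w'l: "w' l = w l" using True by (simp add: w'_def)
      have Wl: "W p l \<ge> \<beta> ^ w l" using insert.prems(5)[of p l] True l by auto
      then have Wl0: "W p l \<ge> 0" using \<beta> zero_le_power[of \<beta> "w l"] by linarith
      show "(fps_X ^ w' l * G) $ j \<le> W p l * B"
      proof (cases "j < w l")
        case True
        then show ?thesis using Wl0 B0 by (simp add: fps_X_power_mult_nth w'l)
      next
        case False
        have "real (j - w l) \<le> real j" by simp
        then have "real (j - w l) \<le> \<beta> * T" using insert.prems(4) by linarith
        then have "G $ (j - w l) \<le> T ^ (j - w l) / fact (j - w l) * Q"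
          unfolding G_def using RT insert.prems(2) by (intro IH) auto
        also have "\<dots> \<le> \<beta> ^ w l * (T ^ j / fact j) * Q"
          using power_div_fact_diff_le[of "w l" j \<beta> T] False insert.prems(4) T0 Q0
          by (intro mult_right_mono) auto
        also have "\<dots> \<le> W p l * B"
          using Wl B0 mult_right_mono[OF Wl B0] by (simp add: B_def mult.assoc)
        finally show ?thesis using False by (simp add: fps_X_power_mult_nth w'l)
      qed
    qed (use nonneg pr in auto)
    have "B * (1 + (\<Sum>l=2..N. \<phi> p l * W p l)) \<le> B * exp (\<Sum>l=2..N. \<phi> p l * W p l)"
      using B0 by (intro mult_left_mono exp_ge_add_one_self) auto
    then show ?thesis using 1 2 True by (simp add: sum_distrib_left algebra_simps)
  next
    case False
    have "G $ j + \<phi> p 1 * (fps_X ^ w' 1 * G) $ j + (\<Sum>l=2..N. \<phi> p l * (fps_X ^ w' l * G) $ j)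
        = G $ j * (1 + (\<phi> p 1 + (\<Sum>l=2..N. \<phi> p l)))"
      using False by (simp add: w'_def sum_distrib_left algebra_simps)
    also have "\<dots> \<le> B * (1 + (\<phi> p 1 + (\<Sum>l=2..N. \<phi> p l)))"
      using nonneg pr GB by (intro mult_right_mono) (auto intro!: add_nonneg_nonneg sum_nonneg)
    also have "\<dots> \<le> B * (1 + (\<phi> p 1 + (\<Sum>l=2..N. \<phi> p l * W p l)))"
    proof -
      have "(\<Sum>l=2..N. \<phi> p l * 1) \<le> (\<Sum>l=2..N. \<phi> p l * W p l)"
        using insert.prems(6)[of p] False nonneg pr by (intro sum_mono mult_left_mono) auto
      then show ?thesis using B0 by (intro mult_left_mono) auto
    qed
    also have "\<dots> \<le> B * exp (\<phi> p 1 + (\<Sum>l=2..N. \<phi> p l * W p l))"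
      using B0 by (intro mult_left_mono exp_ge_add_one_self) auto
    finally show ?thesis using False by simp
  qed
  also have "\<dots> = T ^ j / fact j * exp ((\<Sum>q\<in>insert p P - E. \<phi> q 1) + (\<Sum>q\<in>insert p P. \<Sum>l=2..N. \<phi> q l * W q l))"
  proof -
    have "(\<Sum>q\<in>insert p P - E. \<phi> q 1) = (if p \<in> E then 0 else \<phi> p 1) + (\<Sum>q\<in>P - E. \<phi> q 1)"
      using insert.hyps by (simp add: insert_Diff_if)
    then show ?thesis using insert.hyps by (simp add: B_def Q_def mult.assoc algebra_simps flip: exp_add)
  qed
  finally show ?case .
qed

text \<open>The case \<open>R = 0\<close>; a general \<open>R\<close> serves the induction.\<close>

lemma sum_pfprod_wcount_le:
  assumes "finite P" "\<And>p. p \<in> P \<Longrightarrow> prime p" "N \<ge> 1"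
    and "\<And>p l. prime p \<Longrightarrow> l \<ge> 1 \<Longrightarrow> \<phi> p l \<ge> 0"
    and "w 1 = 1"
    and "\<And>p l. p \<in> P \<Longrightarrow> l \<ge> 2 \<Longrightarrow> p \<in> E \<Longrightarrow> W p l \<ge> \<beta> ^ w l"
    and "\<And>p l. p \<in> P \<Longrightarrow> l \<ge> 2 \<Longrightarrow> p \<notin> E \<Longrightarrow> W p l \<ge> 1"
    and "\<beta> \<ge> 0" "(\<Sum>p\<in>P \<inter> E. \<phi> p 1) \<le> T" "real j \<le> \<beta> * T"
  shows "(\<Sum>m | m \<in> smooth_upto N P \<and> wcount w m E = j. pfprod \<phi> m) \<le>
    T ^ j / fact j * exp ((\<Sum>p\<in>P - E. \<phi> p 1) + (\<Sum>p\<in>P. \<Sum>l=2..N. \<phi> p l * W p l))"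
proof -
  have "(wcount_fps w \<phi> E N P * fps_exp 0) $ j \<le>
      T ^ j / fact j * exp ((\<Sum>p\<in>P - E. \<phi> p 1) + (\<Sum>p\<in>P. \<Sum>l=2..N. \<phi> p l * W p l))"
    by (rule wcount_fps_mult_exp_le) (use assms in auto)
  then show ?thesis by (simp add: wcount_fps_def)
qed

section \<open>The Brun--Hooley sieve\<close>

definition subsets_upto :: "'a set \<Rightarrow> nat \<Rightarrow> 'a set set" where
  "subsets_upto P r = {D. D \<subseteq> P \<and> card D \<le> r}"

lemma subsets_upto_insert:
  assumes "finite P" "p \<notin> P"
  shows "subsets_upto (insert p P) (Suc r) = subsets_upto P (Suc r) \<union> insert p ` subsets_upto P r"
proof (intro subset_antisym subsetI)
  fix D assume D: "D \<in> subsets_upto (insert p P) (Suc r)"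
  show "D \<in> subsets_upto P (Suc r) \<union> insert p ` subsets_upto P r"
  proof (cases "p \<in> D")
    case True
    have "finite D" using D assms by (auto simp: subsets_upto_def intro: finite_subset)
    then have "D - {p} \<in> subsets_upto P r" using D True by (auto simp: subsets_upto_def)
    moreover have "D = insert p (D - {p})" using True by auto
    ultimately show ?thesis by blast
  qed (use D in \<open>auto simp: subsets_upto_def\<close>)
next
  fix D assume "D \<in> subsets_upto P (Suc r) \<union> insert p ` subsets_upto P r"
  then show "D \<in> subsets_upto (insert p P) (Suc r)"
    using assms by (auto simp: subsets_upto_def card_insert_if dest: finite_subset)
qed

lemma finite_subsets_upto [simp]: "finite P \<Longrightarrow> finite (subsets_upto P r)"
  by (rule finite_subset[of _ "Pow P"]) (auto simp: subsets_upto_def)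

lemma sum_subsets_upto_insert:
  fixes h :: "'a \<Rightarrow> real"
  assumes "finite P" "p \<notin> P"
  shows "(\<Sum>D\<in>subsets_upto (insert p P) (Suc r). \<Prod>q\<in>D. h q) =
    (\<Sum>D\<in>subsets_upto P (Suc r). \<Prod>q\<in>D. h q) + h p * (\<Sum>D\<in>subsets_upto P r. \<Prod>q\<in>D. h q)"
proof -
  have notin: "p \<notin> D" "finite D" if "D \<in> subsets_upto P s" for D s
    using that assms by (auto simp: subsets_upto_def intro: finite_subset)
  have "inj_on (insert p) (subsets_upto P r)"
    by (rule inj_onI) (metis notin(1) insert_ident)
  moreover have "subsets_upto P (Suc r) \<inter> insert p ` subsets_upto P r = {}"
    using notin by blast
  ultimately show ?thesis
    using assms notin unfolding subsets_upto_insert[OF assms]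
    by (subst sum.union_disjoint) (auto simp: sum.reindex sum_distrib_left intro!: sum.cong)
qed

lemma subsets_upto_0 [simp]: "finite P \<Longrightarrow> subsets_upto P 0 = {{}}"
  by (auto simp: subsets_upto_def dest: finite_subset)

lemma subsets_upto_empty [simp]: "subsets_upto {} r = {{}}"
  by (auto simp: subsets_upto_def)

text \<open>Adding \<open>p\<close> turns the deviation at level \<open>s + 1\<close> into that at
  level \<open>s + 1\<close> minus \<open>x p\<close> times that at level \<open>s\<close>, and
  these two have opposite signs. Reals in \<open>[0, 1]\<close> cover both uses:
  \<open>x = 1\<close> for the pointwise sieve inequality, densities for the main term.\<close>

lemma bonferroni:
  fixes x :: "'a \<Rightarrow> real"
  assumes "finite P" "\<And>q. q \<in> P \<Longrightarrow> x q \<ge> 0" "\<And>q. q \<in> P \<Longrightarrow> x q \<le> 1"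
  shows "(- 1) ^ r * ((\<Sum>D\<in>subsets_upto P r. \<Prod>q\<in>D. - x q) - (\<Prod>q\<in>P. 1 - x q)) \<ge> 0"
  using assms
proof (induction P arbitrary: r rule: finite_induct)
  case (insert p P)
  have IH: "(- 1) ^ r * ((\<Sum>D\<in>subsets_upto P r. \<Prod>q\<in>D. - x q) - (\<Prod>q\<in>P. 1 - x q)) \<ge> 0" for r
    using insert by auto
  have xp: "x p \<ge> 0" using insert by auto
  show ?case
  proof (cases r)
    case 0
    have "(\<Prod>q\<in>insert p P. 1 - x q) \<le> 1"
      using insert.prems by (intro prod_le_1) auto
    then show ?thesis using 0 insert.hyps by simp
  next
    case (Suc s)
    have "(- 1) ^ Suc s * ((\<Sum>D\<in>subsets_upto (insert p P) (Suc s). \<Prod>q\<in>D. - x q) - (\<Prod>q\<in>insert p P. 1 - x q))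
      = (- 1) ^ Suc s * ((\<Sum>D\<in>subsets_upto P (Suc s). \<Prod>q\<in>D. - x q) - (\<Prod>q\<in>P. 1 - x q))
        + x p * ((- 1) ^ s * ((\<Sum>D\<in>subsets_upto P s. \<Prod>q\<in>D. - x q) - (\<Prod>q\<in>P. 1 - x q)))"
      using insert.hyps by (simp add: sum_subsets_upto_insert algebra_simps)
    moreover have "\<dots> \<ge> 0"
      by (rule add_nonneg_nonneg[OF IH mult_nonneg_nonneg[OF xp IH]])
    ultimately show ?thesis unfolding Suc by (simp only:)
  qed
qed simp

text \<open>In the expansion of the \<open>r\<close>-th power each \<open>r\<close>-element set
  occurs \<open>r!\<close> times. The induction on \<open>P\<close> uses just the first two terms of
  a binomial expansion.\<close>

lemma elementary_symmetric_le:
  fixes x :: "'a \<Rightarrow> real"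
  assumes "finite P" "\<And>q. q \<in> P \<Longrightarrow> x q \<ge> 0"
  shows "(\<Sum>D | D \<subseteq> P \<and> card D = r. \<Prod>q\<in>D. x q) \<le> (\<Sum>q\<in>P. x q) ^ r / fact r"
  using assms
proof (induction P arbitrary: r rule: finite_induct)
  case empty
  show ?case
  proof (cases "r = 0")
    case True
    then have "{D::'a set. D \<subseteq> {} \<and> card D = r} = {{}}" by auto
    then show ?thesis using True by (simp only: sum.insert) simp
  next
    case False
    then have "{D::'a set. D \<subseteq> {} \<and> card D = r} = {}" by auto
    then show ?thesis using False by (simp only: sum.empty) simp
  qed
next
  case (insert p P)
  define S where "S = (\<Sum>q\<in>P. x q)"
  have S0: "S \<ge> 0" using insert.prems by (auto simp: S_def intro!: sum_nonneg)
  have xp: "x p \<ge> 0" using insert by auto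
  have IH: "(\<Sum>D | D \<subseteq> P \<and> card D = r. \<Prod>q\<in>D. x q) \<le> S ^ r / fact r" for r
    using insert by (auto simp: S_def)
  show ?case
  proof (cases r)
    case 0
    have "{D. D \<subseteq> insert p P \<and> card D = 0} = {{}}" using insert.hyps by (auto dest: finite_subset)
    then show ?thesis using 0 by simp
  next
    case (Suc s)
    have notin: "p \<notin> D" "finite D" if "D \<subseteq> P" for D
      using that insert.hyps by (auto intro: finite_subset)
    have split: "{D. D \<subseteq> insert p P \<and> card D = Suc s} =
        {D. D \<subseteq> P \<and> card D = Suc s} \<union> insert p ` {D. D \<subseteq> P \<and> card D = s}" (is "?A = ?B \<union> ?C")
    proof (intro subset_antisym subsetI)
      fix D assume D: "D \<in> ?A"
      show "D \<in> ?B \<union> ?C"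
      proof (cases "p \<in> D")
        case True
        have "D - {p} \<in> {D. D \<subseteq> P \<and> card D = s}" using D True by auto
        moreover have "D = insert p (D - {p})" using True by auto
        ultimately show ?thesis by blast
      qed (use D in auto)
    next
      fix D assume D: "D \<in> ?B \<union> ?C"
      then show "D \<in> ?A" using insert.hyps by (auto simp: card_insert_if notin)
    qed
    have "inj_on (insert p) {D. D \<subseteq> P \<and> card D = s}"
      by (rule inj_onI) (metis (mono_tags, lifting) mem_Collect_eq notin(1) insert_ident)
    then have "(\<Sum>D\<in>?A. \<Prod>q\<in>D. x q) =
        (\<Sum>D\<in>?B. \<Prod>q\<in>D. x q) + x p * (\<Sum>D | D \<subseteq> P \<and> card D = s. \<Prod>q\<in>D. x q)"
      unfolding split using insert.hyps notin
      by (subst sum.union_disjoint)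
         (auto simp: sum.reindex sum_distrib_left intro!: sum.cong)
    also have "\<dots> \<le> S ^ Suc s / fact (Suc s) + x p * (S ^ s / fact s)"
      using xp by (intro add_mono IH mult_left_mono) auto
    also have "\<dots> = (S ^ Suc s + real (Suc s) * x p * S ^ s) / fact (Suc s)"
    proof -
      have "S ^ s / fact s = real (Suc s) * S ^ s / fact (Suc s)" by (simp del: of_nat_Suc)
      then show ?thesis by (simp only: add_divide_distrib times_divide_eq_right mult.assoc mult.left_commute)
    qed
    also have "S ^ Suc s + real (Suc s) * x p * S ^ s \<le> (S + x p) ^ Suc s"
    proof -
      \<comment> \<open>Bernoulli's inequality multiplied by \<open>S\<close>, which avoids the
        exponent \<open>n - 1\<close> in the induction; \<open>S\<close> is cancelled below unless
        it is 0.\<close>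
      have "S ^ n * (S + real n * x p) \<le> S * (S + x p) ^ n" for n
      proof (induction n)
        case (Suc n)
        have "S ^ Suc n * (S + real (Suc n) * x p) \<le> S ^ n * (S + real n * x p) * (S + x p)"
        proof -
          have "0 \<le> real n * x p ^ 2 * S ^ n" using S0 by simp
          then show ?thesis by (simp add: algebra_simps power2_eq_square)
        qed
        also have "\<dots> \<le> S * (S + x p) ^ n * (S + x p)"
          using Suc S0 xp by (intro mult_right_mono) auto
        finally show ?case by (simp add: algebra_simps)
      qed simp
      from this[of "Suc s"] have le: "S * (S ^ Suc s + real (Suc s) * x p * S ^ s) \<le> S * (S + x p) ^ Suc s"
        by (simp add: algebra_simps)
      show ?thesis
      proof (cases "S = 0")
        case True
        then show ?thesis using xp by (cases s) auto
      next
        case False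
        then show ?thesis using le S0 by (simp only: mult_le_cancel_left_pos)
      qed
    qed
    finally show ?thesis using Suc insert.hyps by (simp add: S_def add.commute divide_right_mono)
  qed
qed

text \<open>Level \<open>2 * b\<close> overshoots and level \<open>2 * b + 1\<close> undershoots, so
  the excess is at most the layer of sets with \<open>2 * b + 1\<close> elements.\<close>

lemma truncated_product_le:
  fixes x :: "'a \<Rightarrow> real"
  assumes "finite P" "\<And>q. q \<in> P \<Longrightarrow> x q \<ge> 0" "\<And>q. q \<in> P \<Longrightarrow> x q \<le> 1"
  shows "(\<Sum>D\<in>subsets_upto P (2 * b). \<Prod>q\<in>D. - x q) \<le>
    (\<Prod>q\<in>P. 1 - x q) + (\<Sum>q\<in>P. x q) ^ (2 * b + 1) / fact (2 * b + 1)"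
proof -
  have eq: "subsets_upto P (2 * b + 1) = subsets_upto P (2 * b) \<union> {D. D \<subseteq> P \<and> card D = 2 * b + 1}"
    by (auto simp: subsets_upto_def)
  have "(\<Sum>D\<in>subsets_upto P (2 * b + 1). \<Prod>q\<in>D. - x q) =
      (\<Sum>D\<in>subsets_upto P (2 * b). \<Prod>q\<in>D. - x q) + (\<Sum>D | D \<subseteq> P \<and> card D = 2 * b + 1. \<Prod>q\<in>D. - x q)"
    unfolding eq using assms(1) by (subst sum.union_disjoint) (auto simp: subsets_upto_def)
  also have "(\<Sum>D | D \<subseteq> P \<and> card D = 2 * b + 1. \<Prod>q\<in>D. - x q) =
      - (\<Sum>D | D \<subseteq> P \<and> card D = 2 * b + 1. \<Prod>q\<in>D. x q)"
    by (subst sum_negf[symmetric]) (auto intro!: sum.cong simp: prod_uminus)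
  finally show ?thesis
    using bonferroni[where x = x and r = "2 * b + 1", OF assms]
      elementary_symmetric_le[where x = x and r = "2 * b + 1", OF assms(1,2)]
    by simp
qed

text \<open>Squarefree moduli are encoded by their sets of prime factors: \<open>\<theta> D\<close>
  is the sieve weight at the product of \<open>D\<close>, and \<open>B\<close> stands for the set of
  sieving primes that strike a given integer.\<close>

definition upper_sieve :: "nat set \<Rightarrow> (nat set \<Rightarrow> real) \<Rightarrow> bool" where
  "upper_sieve P \<theta> \<longleftrightarrow> (\<forall>B\<subseteq>P. of_bool (B = {}) \<le> (\<Sum>D\<in>Pow B. \<theta> D))"

definition join_weights :: "nat set \<Rightarrow> nat set \<Rightarrow> (nat set \<Rightarrow> real) \<Rightarrow> (nat set \<Rightarrow> real) \<Rightarrow> nat set \<Rightarrow> real" where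
  "join_weights P Q \<theta> \<eta> D = \<theta> (D \<inter> P) * \<eta> (D \<inter> Q)"

lemma sum_Pow_Un:
  fixes f g :: "'a set \<Rightarrow> real"
  assumes "finite P" "finite Q" "P \<inter> Q = {}"
  shows "(\<Sum>D\<in>Pow (P \<union> Q). f (D \<inter> P) * g (D \<inter> Q)) = (\<Sum>D\<in>Pow P. f D) * (\<Sum>D\<in>Pow Q. g D)"
proof -
  have "(\<Sum>D\<in>Pow P. f D) * (\<Sum>D\<in>Pow Q. g D) = (\<Sum>(A, B)\<in>Pow P \<times> Pow Q. f A * g B)"
    by (simp add: sum_product sum.cartesian_product)
  also have "\<dots> = (\<Sum>D\<in>Pow (P \<union> Q). f (D \<inter> P) * g (D \<inter> Q))"
    using assms(3)
    by (intro sum.reindex_bij_witness[of _ "\<lambda>D. (D \<inter> P, D \<inter> Q)" "\<lambda>(A, B). A \<union> B"])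
       (auto intro!: arg_cong2[of _ _ _ _ "\<lambda>A B. f A * g B"])
  finally show ?thesis by simp
qed

text \<open>Applied to densities for the main term, and to residue counts with absolute weights for
  the remainder.\<close>

lemma join_weights_sum:
  fixes h :: "nat \<Rightarrow> real"
  assumes "finite P" "finite Q" "P \<inter> Q = {}"
  shows "(\<Sum>D\<in>Pow (P \<union> Q). join_weights P Q \<theta> \<eta> D * (\<Prod>q\<in>D. h q)) =
     (\<Sum>D\<in>Pow P. \<theta> D * (\<Prod>q\<in>D. h q)) * (\<Sum>D\<in>Pow Q. \<eta> D * (\<Prod>q\<in>D. h q))"
proof -
  have prod: "(\<Prod>q\<in>D. h q) = (\<Prod>q\<in>D \<inter> P. h q) * (\<Prod>q\<in>D \<inter> Q. h q)" if "D \<subseteq> P \<union> Q" for D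
  proof -
    have "D = (D \<inter> P) \<union> (D \<inter> Q)" using that by blast
    then have "(\<Prod>q\<in>D. h q) = (\<Prod>q\<in>(D \<inter> P) \<union> (D \<inter> Q). h q)" by simp
    also have "\<dots> = (\<Prod>q\<in>D \<inter> P. h q) * (\<Prod>q\<in>D \<inter> Q. h q)"
      using assms by (intro prod.union_disjoint) auto
    finally show ?thesis .
  qed
  have "(\<Sum>D\<in>Pow (P \<union> Q). join_weights P Q \<theta> \<eta> D * (\<Prod>q\<in>D. h q)) =
      (\<Sum>D\<in>Pow (P \<union> Q). (\<theta> (D \<inter> P) * (\<Prod>q\<in>D \<inter> P. h q)) * (\<eta> (D \<inter> Q) * (\<Prod>q\<in>D \<inter> Q. h q)))"
    by (intro sum.cong) (auto simp: join_weights_def prod)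
  then show ?thesis
    using sum_Pow_Un[OF assms, of "\<lambda>D. \<theta> D * (\<Prod>q\<in>D. h q)" "\<lambda>D. \<eta> D * (\<Prod>q\<in>D. h q)"] by simp
qed

text \<open>Upper sieves multiply because their sums majorise an indicator and so are nonnegative.
  This is what allows each interval of primes to be treated by itself.\<close>

lemma upper_sieve_join:
  assumes "finite P" "finite Q" "P \<inter> Q = {}" "upper_sieve P \<theta>" "upper_sieve Q \<eta>"
  shows "upper_sieve (P \<union> Q) (join_weights P Q \<theta> \<eta>)"
  unfolding upper_sieve_def
proof safe
  fix B assume B: "B \<subseteq> P \<union> Q"
  have BB: "B = (B \<inter> P) \<union> (B \<inter> Q)" using B by blast
  have "B = {} \<longleftrightarrow> B \<inter> P = {} \<and> B \<inter> Q = {}" using B by blast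
  then have "of_bool (B = {}) = of_bool (B \<inter> P = {}) * (of_bool (B \<inter> Q = {}) :: real)" by simp
  also have "\<dots> \<le> (\<Sum>D\<in>Pow (B \<inter> P). \<theta> D) * (\<Sum>D\<in>Pow (B \<inter> Q). \<eta> D)"
  proof -
    have le: "of_bool (B \<inter> P = {}) \<le> (\<Sum>D\<in>Pow (B \<inter> P). \<theta> D)" "of_bool (B \<inter> Q = {}) \<le> (\<Sum>D\<in>Pow (B \<inter> Q). \<eta> D)"
      by (rule assms(4,5)[unfolded upper_sieve_def, rule_format, OF Int_lower2])+
    have "0 \<le> (\<Sum>D\<in>Pow (B \<inter> P). \<theta> D)" by (rule order_trans[OF _ le(1)]) simp
    then show ?thesis by (intro mult_mono le) simp_all
  qed
  also have "\<dots> = (\<Sum>D\<in>Pow ((B \<inter> P) \<union> (B \<inter> Q)). \<theta> (D \<inter> (B \<inter> P)) * \<eta> (D \<inter> (B \<inter> Q)))"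
    using assms by (intro sum_Pow_Un[symmetric]) auto
  also have "\<dots> = (\<Sum>D\<in>Pow B. join_weights P Q \<theta> \<eta> D)"
  proof (intro sum.cong)
    show "Pow ((B \<inter> P) \<union> (B \<inter> Q)) = Pow B" using BB by simp
    fix D assume "D \<in> Pow B"
    then have "D \<inter> (B \<inter> P) = D \<inter> P" "D \<inter> (B \<inter> Q) = D \<inter> Q" by blast+
    then show "\<theta> (D \<inter> (B \<inter> P)) * \<eta> (D \<inter> (B \<inter> Q)) = join_weights P Q \<theta> \<eta> D"
      by (simp add: join_weights_def)
  qed
  finally show "of_bool (B = {}) \<le> (\<Sum>D\<in>Pow B. join_weights P Q \<theta> \<eta> D)" .
qed

text \<open>The Moebius function truncated at an even number of primes, so that it errs upwards by
  \<open>bonferroni\<close>.\<close>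

definition brun_weights :: "nat \<Rightarrow> nat set \<Rightarrow> real" where
  "brun_weights b D = of_bool (card D \<le> 2 * b) * (- 1) ^ card D"

lemma sum_brun_weights:
  assumes "finite P"
  shows "(\<Sum>D\<in>Pow P. brun_weights b D * (\<Prod>q\<in>D. h q)) = (\<Sum>D\<in>subsets_upto P (2 * b). \<Prod>q\<in>D. - h q)"
proof -
  have "(\<Sum>D\<in>subsets_upto P (2 * b). \<Prod>q\<in>D. - h q) = (\<Sum>D\<in>Pow P. if D \<in> subsets_upto P (2 * b) then \<Prod>q\<in>D. - h q else 0)"
    using assms by (subst sum.inter_restrict[symmetric]) (auto intro!: sum.cong simp: subsets_upto_def)
  also have "\<dots> = (\<Sum>D\<in>Pow P. brun_weights b D * (\<Prod>q\<in>D. h q))"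
    by (intro sum.cong) (auto simp: subsets_upto_def brun_weights_def prod_uminus)
  finally show ?thesis by simp
qed

lemma upper_sieve_brun_weights:
  assumes "finite P" shows "upper_sieve P (brun_weights b)"
  unfolding upper_sieve_def
proof safe
  fix B assume "B \<subseteq> P"
  then have fin: "finite B" using assms by (rule finite_subset)
  have "(\<Prod>q\<in>B. 1 - (1::real)) \<le> (\<Sum>D\<in>subsets_upto B (2 * b). \<Prod>q\<in>D. - (1::real))"
    using bonferroni[where x = "\<lambda>_. 1" and r = "2 * b", OF fin] by simp
  also have "\<dots> = (\<Sum>D\<in>Pow B. brun_weights b D)"
    using sum_brun_weights[OF fin, of b "\<lambda>_. 1"] by simp
  also have "(\<Prod>q\<in>B. 1 - (1::real)) = of_bool (B = {})" using fin by auto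
  finally show "of_bool (B = {}) \<le> (\<Sum>D\<in>Pow B. brun_weights b D)" .
qed

lemma sum_subsets_upto_le:
  fixes x :: "'a \<Rightarrow> real"
  assumes "finite P" "\<And>q. q \<in> P \<Longrightarrow> x q \<ge> 0"
  shows "(\<Sum>D\<in>subsets_upto P r. \<Prod>q\<in>D. x q) \<le> (1 + (\<Sum>q\<in>P. x q)) ^ r"
  using assms
proof (induction P arbitrary: r rule: finite_induct)
  case (insert p P)
  define S where "S = (\<Sum>q\<in>P. x q)"
  have S0: "S \<ge> 0" using insert.prems by (auto simp: S_def intro!: sum_nonneg)
  have xp: "x p \<ge> 0" using insert by auto
  have IH: "(\<Sum>D\<in>subsets_upto P r. \<Prod>q\<in>D. x q) \<le> (1 + S) ^ r" for r
    using insert by (auto simp: S_def)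
  show ?case
  proof (cases r)
    case (Suc s)
    have "(\<Sum>D\<in>subsets_upto (insert p P) (Suc s). \<Prod>q\<in>D. x q) \<le> (1 + S) ^ Suc s + x p * (1 + S) ^ s"
      unfolding sum_subsets_upto_insert[OF insert.hyps] using xp by (intro add_mono IH mult_left_mono)
    also have "\<dots> = (1 + S + x p) * (1 + S) ^ s" by (simp add: algebra_simps)
    also have "\<dots> \<le> (1 + S + x p) * (1 + S + x p) ^ s"
      using S0 xp by (intro mult_left_mono power_mono) auto
    finally show ?thesis using Suc insert.hyps by (simp add: S_def algebra_simps)
  qed (use insert.hyps in simp)
qed simp

lemma sum_abs_brun_weights_le:
  fixes h :: "nat \<Rightarrow> real"
  assumes "finite P" "\<And>q. q \<in> P \<Longrightarrow> h q \<ge> 0"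
  shows "(\<Sum>D\<in>Pow P. \<bar>brun_weights b D\<bar> * (\<Prod>q\<in>D. h q)) \<le> (1 + (\<Sum>q\<in>P. h q)) ^ (2 * b)"
proof -
  have "(\<Sum>D\<in>Pow P. \<bar>brun_weights b D\<bar> * (\<Prod>q\<in>D. h q)) = (\<Sum>D\<in>Pow P. if D \<in> subsets_upto P (2 * b) then \<Prod>q\<in>D. h q else 0)"
    by (intro sum.cong) (auto simp: subsets_upto_def brun_weights_def abs_mult power_abs)
  also have "\<dots> = (\<Sum>D\<in>subsets_upto P (2 * b). \<Prod>q\<in>D. h q)"
    using assms by (subst sum.inter_restrict[symmetric]) (auto intro!: sum.cong simp: subsets_upto_def)
  also have "\<dots> \<le> (1 + (\<Sum>q\<in>P. h q)) ^ (2 * b)" using assms by (rule sum_subsets_upto_le)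
  finally show ?thesis .
qed

text \<open>The additive truncation error is made relative: \<open>1 - t \<ge> exp (- 2 * t)\<close>
  for \<open>0 \<le> t \<le> 1 / 2\<close> bounds the product below by \<open>exp (- 2 * L)\<close>,
  so the error is at most \<open>exp (2 * L)\<close> times itself times the product.\<close>

lemma sum_brun_weights_le:
  assumes "finite P" "\<And>q. q \<in> P \<Longrightarrow> 0 \<le> x q" "\<And>q. q \<in> P \<Longrightarrow> x q \<le> 1 / 2"
    and "(\<Sum>q\<in>P. x q) \<le> L"
  shows "(\<Sum>D\<in>Pow P. brun_weights b D * (\<Prod>q\<in>D. x q)) \<le>
    (\<Prod>q\<in>P. 1 - x q) * exp (exp (2 * L) * (L ^ (2 * b + 1) / fact (2 * b + 1)))"
proof -
  have "0 \<le> (\<Sum>q\<in>P. x q)" using assms(2) by (rule sum_nonneg)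
  then have L0: "L \<ge> 0" using assms(4) by linarith
  define V where "V = (\<Prod>q\<in>P. 1 - x q)"
  define e where "e = L ^ (2 * b + 1) / fact (2 * b + 1)"
  have e0: "e \<ge> 0" using L0 by (simp add: e_def)
  have "exp (- 2 * L) \<le> exp (- 2 * (\<Sum>q\<in>P. x q))" using assms(4) by simp
  also have "\<dots> = (\<Prod>q\<in>P. exp (- 2 * x q))" using assms(1) by (simp add: exp_sum[symmetric] sum_distrib_left)
  also have "\<dots> \<le> V" unfolding V_def
  proof (intro prod_mono conjI)
    fix q assume q: "q \<in> P"
    have "0 < 1 - x q" using assms(3)[OF q] by linarith
    have "exp (2 * x q) * (1 - x q) \<ge> (1 + 2 * x q) * (1 - x q)"
      using assms(3)[OF q] by (intro mult_right_mono) auto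
    moreover have "(1 + 2 * x q) * (1 - x q) = 1 + x q * (1 - 2 * x q)" by (simp add: algebra_simps)
    moreover have "x q * (1 - 2 * x q) \<ge> 0" using assms(2,3)[OF q] by (intro mult_nonneg_nonneg) auto
    ultimately have "exp (2 * x q) * (1 - x q) \<ge> 1" by linarith
    then show "exp (- 2 * x q) \<le> 1 - x q" by (simp add: exp_minus field_simps)
  qed auto
  finally have Pi: "1 \<le> exp (2 * L) * V" by (simp add: exp_minus field_simps)
  have Pi0: "V \<ge> 0" unfolding V_def
  proof (intro prod_nonneg)
    fix q assume "q \<in> P"
    then show "0 \<le> 1 - x q" using assms(3)[of q] by linarith
  qed
  have "(\<Sum>D\<in>Pow P. brun_weights b D * (\<Prod>q\<in>D. x q)) \<le> V + (\<Sum>q\<in>P. x q) ^ (2 * b + 1) / fact (2 * b + 1)"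
    unfolding sum_brun_weights[OF assms(1)] V_def
  proof (intro truncated_product_le assms(1,2))
    fix q assume "q \<in> P"
    then show "x q \<le> 1" using assms(3)[of q] by linarith
  qed
  also have "\<dots> \<le> V + e" unfolding e_def using assms(2,4)
    by (intro add_left_mono divide_right_mono power_mono) (auto intro: sum_nonneg)
  also have "\<dots> \<le> V + (exp (2 * L) * V) * e" using mult_right_mono[OF Pi e0] by simp
  also have "\<dots> = V * (1 + exp (2 * L) * e)" by (simp add: algebra_simps)
  also have "\<dots> \<le> V * exp (exp (2 * L) * e)" using Pi0 by (intro mult_left_mono exp_ge_add_one_self)
  finally show ?thesis by (simp add: V_def e_def)
qed

lemma card_primes_le_bound: "x \<ge> 0 \<Longrightarrow> real (card (primes_le x)) \<le> x"
proof -
  assume x: "x \<ge> 0"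
  have "card (primes_le x) \<le> card {1..nat \<lfloor>x\<rfloor>}"
    by (intro card_mono) (auto simp: le_nat_floor dest: prime_ge_1_nat)
  then show ?thesis using x by simp linarith
qed

text \<open>The Brun--Hooley construction: on the \<open>j\<close>-th interval \<open>(w, w\<^sup>2]\<close> from the top the
  inclusion-exclusion is truncated at level \<open>2 (s + j)\<close>. Growing truncation levels make the
  product of the relative errors converge, while the double exponential decay of the intervals
  keeps the total size of the weights polynomial.\<close>

lemma brun_hooley_weights:
  fixes u :: real and \<kappa> :: nat and \<rho> :: "nat \<Rightarrow> nat"
  assumes u: "u \<ge> 2 * real \<kappa> + 2" and \<rho>: "\<And>q. prime q \<Longrightarrow> \<rho> q \<le> \<kappa>"
  defines "L \<equiv> 4 * real \<kappa>"
  shows "\<exists>\<theta>. upper_sieve (primes_between u (u ^ (2 ^ i))) \<theta> \<and>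
    (\<Sum>D\<in>Pow (primes_between u (u ^ (2 ^ i))). \<theta> D * (\<Prod>q\<in>D. real (\<rho> q) / real q)) \<le>
      (\<Prod>q\<in>primes_between u (u ^ (2 ^ i)). 1 - real (\<rho> q) / real q) *
      exp (exp (2 * L) * (\<Sum>j<i. L ^ (2 * (s + j) + 1) / fact (2 * (s + j) + 1))) \<and>
    (\<Sum>D\<in>Pow (primes_between u (u ^ (2 ^ i))). \<bar>\<theta> D\<bar> * (\<Prod>q\<in>D. real (\<rho> q))) \<le> (u ^ (2 ^ i)) ^ (8 * s + 8)"
proof (induction i arbitrary: s)
  case 0
  have e: "primes_between u (u ^ (2 ^ 0)) = {}" by auto
  have "1 \<le> (u ^ 2 ^ 0) ^ (8 * s + 8)" using u by (intro one_le_power) auto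
  then show ?case unfolding e
    by (intro exI[of _ "\<lambda>_. 1"]) (auto simp: upper_sieve_def)
next
  case (Suc i)
  define w where "w = u ^ (2 ^ i)"
  have u1: "u > 1" using u by linarith
  have wu: "w \<ge> u" using u1 by (simp add: w_def self_le_power)
  then have w: "w > 1" using u1 by linarith
  have eq: "u ^ (2 ^ Suc i) = w ^ 2" by (simp add: w_def mult.commute flip: power_mult)
  have ww: "w \<le> w ^ 2" using w by (simp add: self_le_power)
  define P where "P = primes_between u w"
  define I where "I = primes_between w (w ^ 2)"
  have U: "primes_between u (u ^ (2 ^ Suc i)) = P \<union> I"
    unfolding eq P_def I_def using wu ww by auto
  have disj: "P \<inter> I = {}" by (auto simp: P_def I_def)
  have fin: "finite P" "finite I" by (auto simp: P_def I_def)
  define x where "x q = real (\<rho> q) / real q" for q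
  \<comment> \<open>\<open>u \<ge> 2 * \<kappa>\<close> keeps the densities at most
    \<open>1 / 2\<close>, as \<open>sum_brun_weights_le\<close> requires.\<close>
  have x: "0 \<le> x q" "x q \<le> 1 / 2" "x q \<le> real \<kappa> * (1 / real q)" if "q \<in> P \<union> I" for q
  proof -
    have q: "prime q" "real q > u" using that wu by (auto simp: P_def I_def)
    have "2 * real (\<rho> q) \<le> real q" using \<rho>[OF q(1)] q(2) u by linarith
    then show "x q \<le> 1 / 2" using q u1 by (simp add: x_def field_simps)
    show "x q \<le> real \<kappa> * (1 / real q)" using \<rho>[OF q(1)] by (simp add: x_def divide_right_mono)
  qed (simp add: x_def)
  have x1: "x q \<le> 1" if "q \<in> P \<union> I" for q using x(2)[OF that] by linarith
  \<comment> \<open>Level \<open>s\<close> belongs to the topmost interval \<open>I\<close>; the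
    primes up to \<open>w\<close> start at \<open>Suc s\<close>, so the induction must run over all
    \<open>s\<close>.\<close>
  obtain \<eta> where \<eta>: "upper_sieve P \<eta>"
      "(\<Sum>D\<in>Pow P. \<eta> D * (\<Prod>q\<in>D. x q)) \<le> (\<Prod>q\<in>P. 1 - x q) *
      exp (exp (2 * L) * (\<Sum>j<i. L ^ (2 * (Suc s + j) + 1) / fact (2 * (Suc s + j) + 1)))"
      "(\<Sum>D\<in>Pow P. \<bar>\<eta> D\<bar> * (\<Prod>q\<in>D. real (\<rho> q))) \<le> w ^ (8 * Suc s + 8)"
    using Suc.IH[of "Suc s"] unfolding P_def w_def x_def by blast
  define a where "a n = L ^ (2 * n + 1) / fact (2 * n + 1)" for n
  have SI: "(\<Sum>q\<in>I. x q) \<le> L"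
  proof -
    have "(\<Sum>q\<in>I. x q) \<le> (\<Sum>q\<in>I. real \<kappa> * (1 / real q))" using x by (intro sum_mono) auto
    also have "\<dots> = real \<kappa> * (\<Sum>q\<in>I. 1 / real q)" by (rule sum_distrib_left[symmetric])
    also have "\<dots> \<le> real \<kappa> * 4"
      unfolding I_def using sum_inverse_primes_between_square[OF w] by (intro mult_left_mono) auto
    finally show ?thesis by (simp add: L_def)
  qed
  have I1: "(\<Sum>D\<in>Pow I. brun_weights s D * (\<Prod>q\<in>D. x q)) \<le> (\<Prod>q\<in>I. 1 - x q) * exp (exp (2 * L) * a s)"
    unfolding a_def using fin x SI by (intro sum_brun_weights_le) auto
  have I2: "(\<Sum>D\<in>Pow I. \<bar>brun_weights s D\<bar> * (\<Prod>q\<in>D. real (\<rho> q))) \<le> (w ^ 2) ^ (4 * s)"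
  proof -
    have "(\<Sum>q\<in>I. real (\<rho> q)) \<le> (\<Sum>q\<in>I. real \<kappa>)" using \<rho> by (intro sum_mono) (auto simp: I_def)
    also have "\<dots> = real \<kappa> * real (card I)" by simp
    also have "\<dots> \<le> real \<kappa> * (w ^ 2)"
    proof -
      have "card I \<le> card (primes_le (w ^ 2))" by (intro card_mono) (auto simp: I_def)
      then show ?thesis using card_primes_le_bound[of "w ^ 2"] by (intro mult_left_mono) auto
    qed
    also have "1 + real \<kappa> * (w ^ 2) \<le> w ^ 2 * w ^ 2"
    proof -
      have "real \<kappa> + 1 \<le> w ^ 2" using ww wu u by linarith
      then have "(real \<kappa> + 1) * w ^ 2 \<le> w ^ 2 * w ^ 2" by (intro mult_right_mono) auto
      moreover have "1 \<le> w ^ 2" using w by simp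
      ultimately show ?thesis by (simp add: algebra_simps)
    qed
    finally have "1 + (\<Sum>q\<in>I. real (\<rho> q)) \<le> (w ^ 2) ^ 2" by (simp add: power2_eq_square)
    then have "(1 + (\<Sum>q\<in>I. real (\<rho> q))) ^ (2 * s) \<le> ((w ^ 2) ^ 2) ^ (2 * s)"
      by (intro power_mono) (auto intro!: add_nonneg_nonneg sum_nonneg)
    moreover have "((w ^ 2) ^ 2) ^ (2 * s) = (w ^ 2) ^ (4 * s)" by (simp flip: power_mult)
    ultimately show ?thesis using sum_abs_brun_weights_le[OF fin(2), of "\<lambda>q. real (\<rho> q)" s] by simp
  qed
  define \<theta> where "\<theta> = join_weights P I \<eta> (brun_weights s)"
  have 1: "upper_sieve (P \<union> I) \<theta>"
    unfolding \<theta>_def using fin disj \<eta>(1) by (intro upper_sieve_join upper_sieve_brun_weights)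
  have Pi0: "0 \<le> (\<Prod>q\<in>P. 1 - x q)" "0 \<le> (\<Prod>q\<in>I. 1 - x q)"
    using x1 by (auto intro!: prod_nonneg)
  have "(\<Sum>D\<in>Pow (P \<union> I). \<theta> D * (\<Prod>q\<in>D. x q)) =
      (\<Sum>D\<in>Pow P. \<eta> D * (\<Prod>q\<in>D. x q)) * (\<Sum>D\<in>Pow I. brun_weights s D * (\<Prod>q\<in>D. x q))"
    unfolding \<theta>_def using fin disj by (rule join_weights_sum)
  also have "\<dots> \<le> ((\<Prod>q\<in>P. 1 - x q) * exp (exp (2 * L) * (\<Sum>j<i. a (Suc s + j)))) *
      ((\<Prod>q\<in>I. 1 - x q) * exp (exp (2 * L) * a s))"
  proof (rule mult_mono)
    show "0 \<le> (\<Sum>D\<in>Pow I. brun_weights s D * (\<Prod>q\<in>D. x q))"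
    proof -
      have "0 \<le> (\<Prod>q\<in>I. 1 - x q)" by (rule Pi0)
      also have "\<dots> \<le> (\<Sum>D\<in>subsets_upto I (2 * s). \<Prod>q\<in>D. - x q)"
        using bonferroni[where x = x and r = "2 * s", OF fin(2)] x(1) x1 by auto
      finally show ?thesis by (simp add: sum_brun_weights fin)
    qed
    show "0 \<le> (\<Prod>q\<in>P. 1 - x q) * exp (exp (2 * L) * (\<Sum>j<i. a (Suc s + j)))"
      using Pi0 by simp
  qed (use \<eta>(2) I1 in \<open>auto simp: a_def\<close>)
  also have "\<dots> = (\<Prod>q\<in>P \<union> I. 1 - x q) * exp (exp (2 * L) * (\<Sum>j<Suc i. a (s + j)))"
    using fin disj unfolding sum.lessThan_Suc_shift
    by (simp add: prod.union_disjoint algebra_simps exp_add)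
  finally have 2: "(\<Sum>D\<in>Pow (P \<union> I). \<theta> D * (\<Prod>q\<in>D. x q)) \<le>
      (\<Prod>q\<in>P \<union> I. 1 - x q) * exp (exp (2 * L) * (\<Sum>j<Suc i. a (s + j)))" .
  have "(\<Sum>D\<in>Pow (P \<union> I). \<bar>\<theta> D\<bar> * (\<Prod>q\<in>D. real (\<rho> q))) =
      (\<Sum>D\<in>Pow (P \<union> I). join_weights P I (\<lambda>D. \<bar>\<eta> D\<bar>) (\<lambda>D. \<bar>brun_weights s D\<bar>) D * (\<Prod>q\<in>D. real (\<rho> q)))"
    by (simp add: \<theta>_def join_weights_def abs_mult)
  also have "\<dots> = (\<Sum>D\<in>Pow P. \<bar>\<eta> D\<bar> * (\<Prod>q\<in>D. real (\<rho> q))) * (\<Sum>D\<in>Pow I. \<bar>brun_weights s D\<bar> * (\<Prod>q\<in>D. real (\<rho> q)))"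
    using fin disj by (rule join_weights_sum)
  also have "\<dots> \<le> w ^ (8 * Suc s + 8) * (w ^ 2) ^ (4 * s)"
    using \<eta>(3) I2 w by (intro mult_mono) (auto intro!: sum_nonneg mult_nonneg_nonneg prod_nonneg)
  \<comment> \<open>This identity fixes the exponent in the claim:
    \<open>8 * (s + 1) + 8 + 8 * s = 2 * (8 * s + 8)\<close>.\<close>
  also have "\<dots> = (w ^ 2) ^ (8 * s + 8)"
    by (simp flip: power_mult power_add add: algebra_simps)
  finally have 3: "(\<Sum>D\<in>Pow (P \<union> I). \<bar>\<theta> D\<bar> * (\<Prod>q\<in>D. real (\<rho> q))) \<le> (w ^ 2) ^ (8 * s + 8)" .
  show ?case
    unfolding U unfolding eq
    by (intro exI[of _ \<theta>] conjI 1 2[unfolded x_def a_def] 3)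
qed

section \<open>Counting residue classes and applying the sieve weights\<close>

lemma card_periodic_mult:
  fixes d :: nat assumes "d > 0" "\<And>n. Pr (n mod d) = Pr n"
  shows "card {n\<in>{..<d * a}. Pr n} = a * card {n\<in>{..<d}. Pr n}"
proof (induction a)
  case (Suc a)
  have per: "Pr (d * a + r) = Pr r" for r using assms(2)[of "d * a + r"] assms(2)[of r] by simp
  have eq: "{n\<in>{..<d * Suc a}. Pr n} = {n\<in>{..<d * a}. Pr n} \<union> (+) (d * a) ` {n\<in>{..<d}. Pr n}" (is "?A = ?B \<union> ?C")
  proof (intro subset_antisym subsetI)
    fix n assume n: "n \<in> ?A"
    show "n \<in> ?B \<union> ?C"
    proof (cases "n < d * a")
      case False
      then obtain r where "n = d * a + r" using le_Suc_ex not_less by blast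
      then show ?thesis using n per by auto
    qed (use n in auto)
  qed (auto simp: per)
  have "card ?A = card ?B + card ?C" unfolding eq by (intro card_Un_disjoint) auto
  then show ?case using Suc by (simp add: card_image)
qed simp

lemma card_periodic_bound:
  fixes d :: nat assumes "d > 0" "\<And>n. Pr (n mod d) = Pr n"
  defines "c \<equiv> card {n\<in>{..<d}. Pr n}"
  shows "\<bar>real (card {n\<in>{..<N}. Pr n}) - real N * (real c / real d)\<bar> \<le> real c"
proof -
  define a where "a = N div d"
  have N: "d * a \<le> N" "N \<le> d * Suc a"
    using assms(1) dividend_less_times_div[of d N] by (auto simp: a_def mult.commute)
  have "a * c \<le> card {n\<in>{..<N}. Pr n}"
    unfolding c_def card_periodic_mult[where Pr = Pr, OF assms(1,2), symmetric] using N(1) by (intro card_mono) auto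
  moreover have "card {n\<in>{..<N}. Pr n} \<le> Suc a * c"
    unfolding c_def card_periodic_mult[where Pr = Pr, OF assms(1,2), symmetric] using N(2) by (intro card_mono) auto
  ultimately have "real (a * c) \<le> real (card {n\<in>{..<N}. Pr n})" "real (card {n\<in>{..<N}. Pr n}) \<le> real (Suc a * c)"
    by (simp_all only: of_nat_le_iff)
  then have 1: "real a * real c \<le> real (card {n\<in>{..<N}. Pr n})" "real (card {n\<in>{..<N}. Pr n}) \<le> (real a + 1) * real c"
    by (simp_all add: algebra_simps)
  have "real (d * a) \<le> real N" "real N \<le> real (d * Suc a)" using N by (simp_all only: of_nat_le_iff)
  then have "real a \<le> real N / real d" "real N / real d \<le> real a + 1"
    using assms(1) by (simp_all add: field_simps)
  then have "real a * real c \<le> real N / real d * real c" "real N / real d * real c \<le> (real a + 1) * real c"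
    by (intro mult_right_mono; simp)+
  then show ?thesis using 1 by (simp add: abs_le_iff algebra_simps)
qed

text \<open>Chinese remainder theorem, one prime at a time.\<close>

lemma card_residues_prod:
  fixes D :: "nat set" and bad :: "nat \<Rightarrow> nat \<Rightarrow> bool"
  assumes "finite D" "\<And>q. q \<in> D \<Longrightarrow> prime q"
    and per: "\<And>q n. bad q (n mod q) = bad q n"
  shows "card {n\<in>{..<\<Prod>D}. \<forall>q\<in>D. bad q n} = (\<Prod>q\<in>D. card {r\<in>{..<q}. bad q r})"
  using assms(1,2)
proof (induction D rule: finite_induct)
  case empty
  have "{n\<in>{..<\<Prod>({}::nat set)}. \<forall>q\<in>{}. bad q n} = {0}" by auto
  then show ?case by (simp only:) simp
next
  case (insert q D)
  define d where "d = \<Prod>D"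
  have q: "prime q" "q > 0" using insert by (auto simp: prime_gt_0_nat)
  have d: "d > 0" using insert.prems unfolding d_def by (intro prod_pos) (auto simp: prime_gt_0_nat)
  have cop: "coprime d q"
    using insert.prems insert.hyps unfolding d_def
    by (intro prod_coprime_left) (auto intro!: primes_coprime)
  have perd: "bad r (n mod d) = bad r n" if "r \<in> D" for r n
  proof -
    have "r dvd d" using that insert.hyps by (auto simp: d_def intro: dvd_prodI)
    then have "n mod d mod r = n mod r" by (simp add: mod_mod_cancel)
    then show ?thesis by (metis per)
  qed
  let ?A = "{n\<in>{..<d * q}. \<forall>r\<in>insert q D. bad r n}"
  let ?B = "{n\<in>{..<d}. \<forall>r\<in>D. bad r n} \<times> {r\<in>{..<q}. bad q r}"
  have "bij_betw (\<lambda>n. (n mod d, n mod q)) ?A ?B"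
    unfolding bij_betw_def
  proof
    show "inj_on (\<lambda>n. (n mod d, n mod q)) ?A"
    proof (rule inj_onI)
      fix m n assume mn: "m \<in> ?A" "n \<in> ?A" "(m mod d, m mod q) = (n mod d, n mod q)"
      have "\<exists>!x. x < d * q \<and> [x = n] (mod d) \<and> [x = n] (mod q)"
        using cop d q by (intro binary_chinese_remainder_unique_nat) auto
      moreover have "m < d * q" "[m = n] (mod d)" "[m = n] (mod q)" "n < d * q" using mn by (auto simp: unique_euclidean_semiring_class.cong_def)
      ultimately show "m = n" by (metis cong_refl)
    qed
    show "(\<lambda>n. (n mod d, n mod q)) ` ?A = ?B"
    proof (intro subset_antisym subsetI)
      fix y assume "y \<in> (\<lambda>n. (n mod d, n mod q)) ` ?A"
      then show "y \<in> ?B" using d q by (auto simp: perd per)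
    next
      fix y assume "y \<in> ?B"
      then obtain a b where y: "y = (a, b)" "a < d" "\<forall>r\<in>D. bad r a" "b < q" "bad q b" by auto
      obtain n where n: "n < d * q" "[n = a] (mod d)" "[n = b] (mod q)"
        using binary_chinese_remainder_unique_nat[OF cop, of a b] d q by auto
      then have m: "n mod d = a" "n mod q = b" using y by (auto simp: unique_euclidean_semiring_class.cong_def)
      have "bad q n" using y m per[of q n] by simp
      moreover have "bad r n" if "r \<in> D" for r using y m perd[OF that, of n] that by simp
      ultimately show "y \<in> (\<lambda>n. (n mod d, n mod q)) ` ?A"
        using n(1) y(1) m by (intro image_eqI[of _ _ n]) auto
    qed
  qed
  then have "card ?A = card ?B" by (rule bij_betw_same_card)
  also have "\<dots> = (\<Prod>r\<in>insert q D. card {s\<in>{..<r}. bad r s})"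
    using insert by (simp add: card_cartesian_product d_def)
  finally show ?case using insert.hyps by (simp add: d_def mult.commute)
qed

text \<open>Summing the upper sieve inequality over \<open>n\<close> and exchanging sums leaves, for
  each \<open>D\<close>, a count that is periodic modulo the product of \<open>D\<close>; its
  rounding error is at most the number of bad classes.\<close>

lemma card_sieved_le:
  assumes "finite P" "\<And>q. q \<in> P \<Longrightarrow> prime q" "upper_sieve P \<theta>"
    and per: "\<And>q n. bad q (n mod q) = bad q n"
    and \<rho>: "\<And>q. q \<in> P \<Longrightarrow> \<rho> q = card {r\<in>{..<q}. bad q r}"
  shows "real (card {n\<in>{..<N}. \<forall>q\<in>P. \<not> bad q n}) \<le>
     real N * (\<Sum>D\<in>Pow P. \<theta> D * (\<Prod>q\<in>D. real (\<rho> q) / real q))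
     + (\<Sum>D\<in>Pow P. \<bar>\<theta> D\<bar> * (\<Prod>q\<in>D. real (\<rho> q)))"
proof -
  define B where "B n = {q\<in>P. bad q n}" for n
  have "real (card {n\<in>{..<N}. \<forall>q\<in>P. \<not> bad q n}) = (\<Sum>n<N. of_bool (B n = {}))"
    by (subst sum_of_bool_eq) (auto simp: B_def intro!: arg_cong[of _ _ card])
  also have "\<dots> \<le> (\<Sum>n<N. \<Sum>D\<in>Pow (B n). \<theta> D)"
  proof (rule sum_mono)
    fix n
    have "B n \<subseteq> P" by (auto simp: B_def)
    then show "of_bool (B n = {}) \<le> (\<Sum>D\<in>Pow (B n). \<theta> D)"
      by (rule assms(3)[unfolded upper_sieve_def, rule_format])
  qed
  also have "\<dots> = (\<Sum>n<N. \<Sum>D\<in>{D\<in>Pow P. \<forall>q\<in>D. bad q n}. \<theta> D)"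
    by (intro sum.cong) (auto simp: B_def)
  also have "\<dots> = (\<Sum>D\<in>Pow P. \<Sum>n\<in>{n\<in>{..<N}. \<forall>q\<in>D. bad q n}. \<theta> D)"
    using assms(1) by (intro sum.swap_restrict) auto
  also have "\<dots> = (\<Sum>D\<in>Pow P. \<theta> D * real (card {n\<in>{..<N}. \<forall>q\<in>D. bad q n}))"
    by (simp add: mult.commute)
  also have "\<dots> \<le> (\<Sum>D\<in>Pow P. real N * (\<theta> D * (\<Prod>q\<in>D. real (\<rho> q) / real q)) + \<bar>\<theta> D\<bar> * (\<Prod>q\<in>D. real (\<rho> q)))"
  proof (rule sum_mono)
    fix D assume "D \<in> Pow P"
    then have D: "D \<subseteq> P" "finite D" "\<And>q. q \<in> D \<Longrightarrow> prime q" using assms(1,2) by (auto intro: finite_subset)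
    have pos: "\<Prod>D > 0" using D(3) by (intro prod_pos) (auto simp: prime_gt_0_nat)
    have perD: "(\<forall>q\<in>D. bad q (n mod \<Prod>D)) = (\<forall>q\<in>D. bad q n)" for n
    proof (intro ball_cong refl)
      fix q assume "q \<in> D"
      then have "n mod \<Prod>D mod q = n mod q" using D(2) by (intro mod_mod_cancel) (auto intro: dvd_prodI)
      then show "bad q (n mod \<Prod>D) = bad q n" by (metis per)
    qed
    define c where "c = card {n\<in>{..<\<Prod>D}. \<forall>q\<in>D. bad q n}"
    have "c = (\<Prod>q\<in>D. card {r\<in>{..<q}. bad q r})"
      unfolding c_def by (rule card_residues_prod[where bad = bad, OF D(2,3) per])
    also have "\<dots> = (\<Prod>q\<in>D. \<rho> q)" using \<rho> D(1) by (intro prod.cong) auto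
    finally have c: "real c = (\<Prod>q\<in>D. real (\<rho> q))" by simp
    have "\<bar>real (card {n\<in>{..<N}. \<forall>q\<in>D. bad q n}) - real N * (real c / real (\<Prod>D))\<bar> \<le> real c"
      unfolding c_def by (rule card_periodic_bound[where Pr = "\<lambda>n. \<forall>q\<in>D. bad q n", OF pos perD])
    moreover have "real c / real (\<Prod>D) = (\<Prod>q\<in>D. real (\<rho> q) / real q)"
      using D(2) by (simp add: c prod_dividef)
    ultimately have *: "\<bar>real (card {n\<in>{..<N}. \<forall>q\<in>D. bad q n}) - real N * (\<Prod>q\<in>D. real (\<rho> q) / real q)\<bar> \<le> (\<Prod>q\<in>D. real (\<rho> q))"
      by (simp only: c)
    have "\<theta> D * (real (card {n\<in>{..<N}. \<forall>q\<in>D. bad q n}) - real N * (\<Prod>q\<in>D. real (\<rho> q) / real q))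
        \<le> \<bar>\<theta> D\<bar> * \<bar>real (card {n\<in>{..<N}. \<forall>q\<in>D. bad q n}) - real N * (\<Prod>q\<in>D. real (\<rho> q) / real q)\<bar>"
      unfolding abs_mult[symmetric] by (rule abs_ge_self)
    also have "\<dots> \<le> \<bar>\<theta> D\<bar> * (\<Prod>q\<in>D. real (\<rho> q))" using * by (intro mult_left_mono) auto
    finally show "\<theta> D * real (card {n\<in>{..<N}. \<forall>q\<in>D. bad q n}) \<le>
        real N * (\<theta> D * (\<Prod>q\<in>D. real (\<rho> q) / real q)) + \<bar>\<theta> D\<bar> * (\<Prod>q\<in>D. real (\<rho> q))"
      by (simp add: algebra_simps)
  qed
  also have "\<dots> = real N * (\<Sum>D\<in>Pow P. \<theta> D * (\<Prod>q\<in>D. real (\<rho> q) / real q))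
     + (\<Sum>D\<in>Pow P. \<bar>\<theta> D\<bar> * (\<Prod>q\<in>D. real (\<rho> q)))"
    by (simp add: sum.distrib sum_distrib_left)
  finally show ?thesis .
qed

text \<open>The reciprocal of the sieve factor is thus at most a multiple of \<open>sqrt x\<close>,
  so terms of size \<open>sqrt x\<close>, such as the sieve remainder, fit under the main
  term.\<close>

lemma exp_sum_inverse_primes_le_sqrt:
  fixes \<kappa> :: real assumes "\<kappa> \<ge> 0"
  shows "\<exists>C>0. \<forall>x\<ge>2. exp (\<kappa> * (\<Sum>p\<in>primes_le x. 1 / real p)) \<le> C * sqrt x"
proof -
  obtain C A where CA: "C > 0" "A \<ge> 0"
    "\<And>x. x \<ge> 2 \<Longrightarrow> exp (\<kappa> * (\<Sum>p\<in>primes_le x. 1 / real p)) \<le> C * ln x powr A"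
    using exp_sum_inverse_primes_le[OF assms] by blast
  obtain C' where C': "C' > 0" "\<And>t. t > 0 \<Longrightarrow> t powr A \<le> C' * exp (1 * sqrt t)"
    using powr_le_exp_sqrt[OF CA(2), of 1] by auto
  have "exp (\<kappa> * (\<Sum>p\<in>primes_le x. 1 / real p)) \<le> (C * C' * exp (1 / 2)) * sqrt x" if x: "x \<ge> 2" for x
  proof -
    define t where "t = ln x"
    have t: "t > 0" using x by (simp add: t_def)
    have "0 \<le> (sqrt t - 1) ^ 2" by simp
    then have "sqrt t \<le> (1 + t) / 2" using t by (simp add: power2_diff)
    then have "exp (1 * sqrt t) \<le> exp (1 / 2) * exp (t / 2)" by (simp add: field_simps flip: exp_add)
    also have "exp (t / 2) = sqrt x" using x by (simp add: t_def ln_sqrt[symmetric])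
    finally have "C * (C' * exp (1 * sqrt t)) \<le> C * (C' * (exp (1 / 2) * sqrt x))"
      using CA C' by (intro mult_left_mono) auto
    moreover have "C * t powr A \<le> C * (C' * exp (1 * sqrt t))"
      using CA C'(2)[OF t] by (intro mult_left_mono) auto
    ultimately show ?thesis using CA(3)[OF x] by (simp add: t_def mult.assoc)
  qed
  then show ?thesis using CA C' by (intro exI[of _ "C * C' * exp (1 / 2)"]) auto
qed

lemma sum_odd_terms_le_exp:
  fixes L :: real assumes "L \<ge> 0"
  shows "(\<Sum>j<i. L ^ (2 * j + 1) / fact (2 * j + 1)) \<le> exp L"
proof -
  define a where "a n = L ^ n / fact n" for n
  have a0: "a n \<ge> 0" for n using assms by (simp add: a_def)
  have "(\<Sum>j<i. a (2 * j + 1)) \<le> (\<Sum>n<2 * i. a n)"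
  proof (induction i)
    case (Suc i)
    then show ?case using a0[of "2 * i"] by simp
  qed simp
  then have "(\<Sum>j<i. L ^ (2 * j + 1) / fact (2 * j + 1)) \<le> (\<Sum>n<2 * i. L ^ n / fact n)"
    by (simp only: a_def)
  also have "\<dots> \<le> (\<Sum>n. L ^ n / fact n)"
    using assms summable_exp[of L] by (intro sum_le_suminf) (auto simp: field_simps)
  also have "\<dots> = exp L" by (simp add: exp_def scaleR_conv_of_real field_simps)
  finally show ?thesis .
qed

text \<open>With \<open>s = 0\<close> the weights of \<open>brun_hooley_weights\<close> leave a
  remainder of at most \<open>W^8\<close>, so sifting up to \<open>W\<close> with
  \<open>W^16 \<le> X\<close> keeps it below \<open>sqrt X\<close>. The scale also satisfies
  \<open>X < W^32\<close>: five squarings lead from \<open>W\<close> past \<open>X\<close>, and the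
  exponent may be extended to all primes up to \<open>X\<close> at bounded cost. Sifting only by
  \<open>q\<close> with \<open>q^16 \<le> X\<close> lets larger primes survive, as the application
  to primes demands.\<close>

lemma sieve_upper_bound:
  fixes \<kappa> :: nat
  shows "\<exists>C>0. \<forall>X bad. X \<ge> 2 \<and> (\<forall>q n. bad q (n mod q) = bad q n) \<and>
      (\<forall>q. prime q \<longrightarrow> card {r\<in>{..<q}. bad q r} \<le> \<kappa>) \<longrightarrow>
      real (card {n::nat. real n \<le> X \<and> (\<forall>q. prime q \<and> real q ^ 16 \<le> X \<longrightarrow> \<not> bad q n)}) \<le>
      C * X * exp (- (\<Sum>q\<in>primes_le X. real (card {r\<in>{..<q}. bad q r}) / real q))"
proof -
  define u where "u = 2 * real \<kappa> + 2"
  have u: "u \<ge> 2" by (simp add: u_def)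
  define L where "L = 4 * real \<kappa>"
  obtain C0 where C0: "C0 > 0" "\<And>x. x \<ge> 2 \<Longrightarrow> exp (real \<kappa> * (\<Sum>p\<in>primes_le x. 1 / real p)) \<le> C0 * sqrt x"
    using exp_sum_inverse_primes_le_sqrt[of "real \<kappa>"] by auto
  \<comment> \<open>The summands pay for small \<open>X\<close>, for the main term of the sieve, and
    for its remainder. In \<open>u + 20\<close> the primes up to \<open>u\<close> account for
    \<open>u\<close> and the five squarings for \<open>20 = 4 * 5\<close>.\<close>
  define C where "C = 2 * exp (real \<kappa> * u ^ 16) + 2 * exp (exp (2 * L) * exp L) * exp (real \<kappa> * (u + 20)) + C0"
  have "real (card {n::nat. real n \<le> X \<and> (\<forall>q. prime q \<and> real q ^ 16 \<le> X \<longrightarrow> \<not> bad q n)}) \<le>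
      C * X * exp (- (\<Sum>q\<in>primes_le X. real (card {r\<in>{..<q}. bad q r}) / real q))"
    if X: "X \<ge> 2" and per: "\<And>q n. bad q (n mod q) = bad q n"
      and \<kappa>: "\<And>q. prime q \<Longrightarrow> card {r\<in>{..<q}. bad q r} \<le> \<kappa>" for X :: real and bad :: "nat \<Rightarrow> nat \<Rightarrow> bool"
  proof -
    define \<rho> where "\<rho> q = card {r\<in>{..<q}. bad q r}" for q
    define S where "S = (\<Sum>q\<in>primes_le X. real (\<rho> q) / real q)"
    define A where "A = {n::nat. real n \<le> X \<and> (\<forall>q. prime q \<and> real q ^ 16 \<le> X \<longrightarrow> \<not> bad q n)}"
    define N where "N = Suc (nat \<lfloor>X\<rfloor>)"
    have N: "real N \<le> 2 * X" using X by (simp add: N_def) linarith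
    have AN: "A \<subseteq> {..<N}" unfolding A_def N_def using X by (auto simp: le_nat_floor less_Suc_eq_le)
    have \<rho>le: "real (\<rho> q) / real q \<le> real \<kappa> * (1 / real q)" if "prime q" for q
      using \<kappa>[OF that] by (simp add: \<rho>_def divide_right_mono)
    have Sle: "(\<Sum>q\<in>Q. real (\<rho> q) / real q) \<le> real \<kappa> * (\<Sum>q\<in>Q. 1 / real q)" if "\<And>q. q \<in> Q \<Longrightarrow> prime q" for Q
      unfolding sum_distrib_left using that by (intro sum_mono \<rho>le)
    have card: "(\<Sum>q\<in>primes_le y. 1 / real q) \<le> y" if "y \<ge> 0" for y
    proof -
      have "(\<Sum>q\<in>primes_le y. 1 / real q) \<le> (\<Sum>q\<in>primes_le y. 1)"
        by (intro sum_mono) (auto dest: prime_ge_1_nat)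
      then show ?thesis using card_primes_le_bound[OF that] by simp
    qed
    have "real (card A) \<le> C * (X * exp (- S))"
    proof (cases "X < u ^ 16")
      case True
      have "S \<le> real \<kappa> * (\<Sum>q\<in>primes_le X. 1 / real q)" unfolding S_def by (intro Sle) auto
      also have "\<dots> \<le> real \<kappa> * X" using X by (intro mult_left_mono card) auto
      also have "\<dots> \<le> real \<kappa> * u ^ 16" using True by (intro mult_left_mono) auto
      finally have "1 \<le> exp (real \<kappa> * u ^ 16) * exp (- S)" by (simp flip: exp_add)
      then have "2 * X * 1 \<le> 2 * X * (exp (real \<kappa> * u ^ 16) * exp (- S))" using X by (intro mult_left_mono) auto
      also have "\<dots> \<le> C * (X * exp (- S))"
      proof -
        have "2 * exp (real \<kappa> * u ^ 16) \<le> C" using C0(1) by (simp add: C_def)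
        then have "2 * exp (real \<kappa> * u ^ 16) * (X * exp (- S)) \<le> C * (X * exp (- S))"
          using X by (intro mult_right_mono) auto
        then show ?thesis by (simp add: algebra_simps)
      qed
      finally have "2 * X \<le> C * (X * exp (- S))" by simp
      moreover have "card A \<le> N" using card_mono[OF _ AN] by simp
      ultimately show ?thesis using N by linarith
    next
      case False
      have ex: "\<exists>i. X < (u ^ (2 ^ Suc i)) ^ 16"
      proof -
        obtain n where n: "X < u ^ n" using u real_arch_pow[of u X] by auto
        have "n < 2 ^ n" by simp
        also have "(2::nat) ^ n \<le> 2 ^ Suc n * 16" by simp
        finally have "u ^ n \<le> u ^ (2 ^ Suc n * 16)" using u by (intro power_increasing) auto
        then show ?thesis using n by (intro exI[of _ n]) (simp flip: power_mult)
      qed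
      define i where "i = (LEAST i. X < (u ^ (2 ^ Suc i)) ^ 16)"
      define W where "W = u ^ (2 ^ i)"
      have up: "X < (W ^ 2) ^ 16"
        using LeastI_ex[OF ex] unfolding i_def[symmetric] W_def by (simp add: mult.commute flip: power_mult)
      have low: "W ^ 16 \<le> X"
      proof (cases i)
        case 0
        then show ?thesis using False by (simp add: W_def)
      next
        case (Suc j)
        then have "\<not> X < (u ^ (2 ^ Suc j)) ^ 16" using not_less_Least[of j "\<lambda>i. X < (u ^ (2 ^ Suc i)) ^ 16"] by (simp add: i_def)
        then show ?thesis by (simp add: W_def Suc)
      qed
      have W1: "W > 1" using u by (simp add: W_def)
      define P where "P = primes_between u W"
      have \<rho>\<kappa>: "\<And>q. prime q \<Longrightarrow> \<rho> q \<le> \<kappa>" using \<kappa> by (simp add: \<rho>_def)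
      obtain \<theta> where \<theta>: "upper_sieve P \<theta>"
        "(\<Sum>D\<in>Pow P. \<theta> D * (\<Prod>q\<in>D. real (\<rho> q) / real q)) \<le>
          (\<Prod>q\<in>P. 1 - real (\<rho> q) / real q) * exp (exp (2 * L) * (\<Sum>j<i. L ^ (2 * j + 1) / fact (2 * j + 1)))"
        "(\<Sum>D\<in>Pow P. \<bar>\<theta> D\<bar> * (\<Prod>q\<in>D. real (\<rho> q))) \<le> W ^ 8"
        using brun_hooley_weights[of \<kappa> u \<rho> i 0] \<rho>\<kappa> unfolding P_def W_def L_def u_def by auto
      have "(\<Prod>q\<in>P. 1 - real (\<rho> q) / real q) \<le> (\<Prod>q\<in>P. exp (- (real (\<rho> q) / real q)))"
      proof (intro prod_mono conjI)
        fix q assume q: "q \<in> P"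
        then have "\<rho> q \<le> \<kappa>" "real q > u" using \<rho>\<kappa> by (auto simp: P_def)
        then have "real (\<rho> q) \<le> real q" "real q > 0" using u by (auto simp: u_def)
        then show "0 \<le> 1 - real (\<rho> q) / real q" by simp
        show "1 - real (\<rho> q) / real q \<le> exp (- (real (\<rho> q) / real q))"
          using exp_ge_add_one_self[of "- (real (\<rho> q) / real q)"] by simp
      qed
      also have "\<dots> = exp (- (\<Sum>q\<in>P. real (\<rho> q) / real q))"
        by (simp add: P_def exp_sum sum_negf[symmetric])
      also have "\<dots> \<le> exp (real \<kappa> * (u + 20)) * exp (- S)"
      proof -
        have "S \<le> (\<Sum>q\<in>P \<union> (primes_le u \<union> primes_between W X). real (\<rho> q) / real q)"
          unfolding S_def by (intro sum_mono2) (auto simp: P_def)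
        also have "\<dots> \<le> (\<Sum>q\<in>P. real (\<rho> q) / real q) + (\<Sum>q\<in>primes_le u \<union> primes_between W X. real (\<rho> q) / real q)"
          by (subst sum.union_inter[symmetric]) (auto simp: P_def intro!: sum_nonneg)
        also have "(\<Sum>q\<in>primes_le u \<union> primes_between W X. real (\<rho> q) / real q)
            \<le> real \<kappa> * (\<Sum>q\<in>primes_le u \<union> primes_between W X. 1 / real q)" by (intro Sle) auto
        also have "(\<Sum>q\<in>primes_le u \<union> primes_between W X. 1 / real q)
           \<le> (\<Sum>q\<in>primes_le u. 1 / real q) + (\<Sum>q\<in>primes_between W X. 1 / real q)"
          by (subst sum.union_inter[symmetric]) (auto intro!: sum_nonneg)
        also have "\<dots> \<le> u + 4 * real (5::nat)"
          using up u W1 by (intro add_mono card sum_inverse_primes_between) (auto simp flip: power_mult)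
        finally have "S \<le> (\<Sum>q\<in>P. real (\<rho> q) / real q) + real \<kappa> * (u + 20)"
          by (simp add: mult_left_mono)
        then show ?thesis by (simp flip: exp_add)
      qed
      finally have Pi: "(\<Prod>q\<in>P. 1 - real (\<rho> q) / real q) \<le> exp (real \<kappa> * (u + 20)) * exp (- S)" .
      have "exp (exp (2 * L) * (\<Sum>j<i. L ^ (2 * j + 1) / fact (2 * j + 1))) \<le> exp (exp (2 * L) * exp L)"
        using sum_odd_terms_le_exp[of L i] by (simp add: L_def)
      then have "(\<Prod>q\<in>P. 1 - real (\<rho> q) / real q) * exp (exp (2 * L) * (\<Sum>j<i. L ^ (2 * j + 1) / fact (2 * j + 1)))
         \<le> (exp (real \<kappa> * (u + 20)) * exp (- S)) * exp (exp (2 * L) * exp L)"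
        using Pi by (intro mult_mono) auto
      then have V: "(\<Sum>D\<in>Pow P. \<theta> D * (\<Prod>q\<in>D. real (\<rho> q) / real q)) \<le>
          exp (exp (2 * L) * exp L) * exp (real \<kappa> * (u + 20)) * exp (- S)"
        using \<theta>(2) by (simp add: mult_ac)
      have W8: "W ^ 8 \<le> C0 * (X * exp (- S))"
      proof -
        have "(W ^ 8) ^ 2 \<le> X" using low by (simp flip: power_mult)
        then have "W ^ 8 \<le> sqrt X" by (intro real_le_rsqrt)
        moreover have "exp S \<le> C0 * sqrt X"
        proof -
          have "S \<le> real \<kappa> * (\<Sum>q\<in>primes_le X. 1 / real q)" unfolding S_def by (intro Sle) auto
          then show ?thesis using C0(2)[OF X] by (meson exp_le_cancel_iff order_trans)
        qed
        then have "sqrt X * exp S \<le> sqrt X * (C0 * sqrt X)" using X by (intro mult_left_mono) auto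
        then have "sqrt X \<le> C0 * (X * exp (- S))" using X by (simp add: exp_minus field_simps)
        ultimately show ?thesis by linarith
      qed
      have "A \<subseteq> {n\<in>{..<N}. \<forall>q\<in>P. \<not> bad q n}"
      proof
        fix n assume n: "n \<in> A"
        have "real q ^ 16 \<le> X" if "q \<in> P" for q
        proof -
          have "real q ^ 16 \<le> W ^ 16" using that by (intro power_mono) (auto simp: P_def)
          then show ?thesis using low by linarith
        qed
        then show "n \<in> {n\<in>{..<N}. \<forall>q\<in>P. \<not> bad q n}" using n AN by (auto simp: A_def P_def)
      qed
      then have "card A \<le> card {n\<in>{..<N}. \<forall>q\<in>P. \<not> bad q n}" by (intro card_mono) auto
      then have "real (card A) \<le> real (card {n\<in>{..<N}. \<forall>q\<in>P. \<not> bad q n})" by simp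
      also have "\<dots> \<le> real N * (\<Sum>D\<in>Pow P. \<theta> D * (\<Prod>q\<in>D. real (\<rho> q) / real q))
          + (\<Sum>D\<in>Pow P. \<bar>\<theta> D\<bar> * (\<Prod>q\<in>D. real (\<rho> q)))"
        using per \<theta>(1) by (intro card_sieved_le) (auto simp: P_def \<rho>_def)
      also have "\<dots> \<le> real N * (exp (exp (2 * L) * exp L) * exp (real \<kappa> * (u + 20)) * exp (- S)) + C0 * (X * exp (- S))"
        using V \<theta>(3) W8 by (intro add_mono mult_left_mono) auto
      also have "\<dots> \<le> (2 * X) * (exp (exp (2 * L) * exp L) * exp (real \<kappa> * (u + 20)) * exp (- S)) + C0 * (X * exp (- S))"
        using N by (intro add_mono mult_right_mono) auto
      also have "\<dots> \<le> C * (X * exp (- S))"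
      proof -
        have "2 * exp (exp (2 * L) * exp L) * exp (real \<kappa> * (u + 20)) + C0 \<le> C" by (simp add: C_def)
        then have "(2 * exp (exp (2 * L) * exp L) * exp (real \<kappa> * (u + 20)) + C0) * (X * exp (- S)) \<le> C * (X * exp (- S))"
          using X by (intro mult_right_mono) auto
        then show ?thesis by (simp add: algebra_simps)
      qed
      finally show ?thesis .
    qed
    then show ?thesis by (simp add: A_def S_def \<rho>_def mult.assoc)
  qed
  moreover have "C > 0" using C0(1) by (simp add: C_def add_pos_pos)
  ultimately show ?thesis by (intro exI[of _ C]) blast
qed

section \<open>Sums over prime powers, and Euler's lower bound for the sum of
  \<open>1 / p\<close>\<close>

lemma sum_powr_tail_le:
  fixes \<tau> p :: real assumes "\<tau> > 0" "p \<ge> 2"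
  shows "(\<Sum>l=2..N. p powr (- \<tau> * real l)) \<le> p powr (- 2 * \<tau>) / (1 - 2 powr (- \<tau>))"
proof -
  define r where "r = p powr (- \<tau>)"
  have r0: "r > 0" using assms by (simp add: r_def)
  \<comment> \<open>Comparison with \<open>p = 2\<close> makes the denominator of the geometric
    series independent of \<open>p\<close>.\<close>
  have r2: "r \<le> 2 powr (- \<tau>)" unfolding r_def using assms by (intro powr_mono2') auto
  have "2 powr (- \<tau>) < 1" using assms by (simp add: powr_minus_divide)
  then have r1: "r < 1" and t1: "1 - 2 powr (- \<tau>) > 0" using r2 by auto
  have rl: "p powr (- \<tau> * real l) = r ^ l" for l
  proof -
    have "r ^ l = r powr real l" using r0 by (simp add: powr_realpow)
    then show ?thesis by (simp add: r_def powr_powr)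
  qed
  have "(\<Sum>l=2..N. p powr (- \<tau> * real l)) = (\<Sum>l=2..N. r ^ l)" by (simp only: rl)
  also have "\<dots> \<le> r ^ 2 / (1 - r)"
  proof -
    have eq: "(\<Sum>l=2..Suc n. r ^ l) * (1 - r) = r ^ 2 - r ^ Suc (Suc n)" for n
    proof (induction n)
      case (Suc n)
      have "(\<Sum>l=2..Suc (Suc n). r ^ l) = (\<Sum>l=2..Suc n. r ^ l) + r ^ Suc (Suc n)"
        by (subst sum.nat_ivl_Suc') simp_all
      then show ?case by (simp only: distrib_right Suc) (simp add: algebra_simps)
    qed (simp add: power2_eq_square)
    have "(\<Sum>l=2..N. r ^ l) * (1 - r) \<le> r ^ 2"
      using eq[of "N - 1"] r0 by (cases N) simp_all
    then show ?thesis using r1 by (simp add: field_simps)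
  qed
  also have "\<dots> \<le> r ^ 2 / (1 - 2 powr (- \<tau>))" using r2 t1 by (intro divide_left_mono) auto
  also have "r ^ 2 = p powr (- 2 * \<tau>)"
    using rl[of 2] by (simp add: mult.commute)
  finally show ?thesis .
qed

lemma sum_powr_primes_le:
  fixes s :: real assumes "s > 1"
  shows "\<exists>C>0. \<forall>P. finite P \<longrightarrow> (\<Sum>p\<in>P. real p powr (- s)) \<le> C"
proof -
  have "summable (\<lambda>n. real n powr (- s))" using assms by (simp add: summable_real_powr_iff)
  then have "(\<Sum>p\<in>P. real p powr (- s)) \<le> (\<Sum>n. real n powr (- s))" if "finite P" for P
    using that by (intro sum_le_suminf) auto
  then have "\<forall>P. finite P \<longrightarrow> (\<Sum>p\<in>P. real p powr (- s)) \<le> \<bar>\<Sum>n. real n powr (- s)\<bar> + 1"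
    by (meson abs_ge_self add_increasing2 order_trans zero_le_one)
  then show ?thesis by (intro exI[of _ "\<bar>\<Sum>n. real n powr (- s)\<bar> + 1"]) auto
qed

text \<open>\<open>2 * \<tau> > 1\<close> makes the leading terms, at \<open>l = 2\<close>, summable
  over the primes.\<close>

lemma sum_prime_powers_le:
  fixes \<tau> :: real assumes "\<tau> > 1 / 2"
  shows "\<exists>C>0. \<forall>P N. finite P \<and> (\<forall>p\<in>P. prime p) \<longrightarrow> (\<Sum>p\<in>P. \<Sum>l=2..N. real p powr (- \<tau> * real l)) \<le> C"
proof -
  obtain C where C: "C > 0" "\<And>P. finite P \<Longrightarrow> (\<Sum>p\<in>P. real p powr (- (2 * \<tau>))) \<le> C"
    using sum_powr_primes_le[of "2 * \<tau>"] assms by auto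
  have "2 powr (- \<tau>) < 1" using assms by (simp add: powr_minus_divide)
  then have t: "1 - 2 powr (- \<tau>) > 0" by simp
  have "(\<Sum>p\<in>P. \<Sum>l=2..N. real p powr (- \<tau> * real l)) \<le> C / (1 - 2 powr (- \<tau>))"
    if P: "finite P" "\<forall>p\<in>P. prime p" for P N
  proof -
    have "(\<Sum>p\<in>P. \<Sum>l=2..N. real p powr (- \<tau> * real l)) \<le> (\<Sum>p\<in>P. real p powr (- 2 * \<tau>) / (1 - 2 powr (- \<tau>)))"
      using P(2) assms by (intro sum_mono sum_powr_tail_le) (auto dest: prime_ge_2_nat)
    also have "\<dots> \<le> C / (1 - 2 powr (- \<tau>))"
      using C(2)[OF P(1)] t unfolding sum_divide_distrib[symmetric] by (intro divide_right_mono) auto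
    finally show ?thesis .
  qed
  then show ?thesis using C t by (intro exI[of _ "C / (1 - 2 powr (- \<tau>))"]) auto
qed

lemma smooth_upto_all:
  assumes "real N \<le> x" shows "smooth_upto N (primes_le x) = {1..N}"
proof (intro subset_antisym subsetI)
  fix m assume m: "m \<in> {1..N}"
  have "real p \<le> x" if "p \<in> prime_factors m" for p
  proof -
    have "p \<le> m" using that m by (intro dvd_imp_le) (auto simp: in_prime_factors_iff)
    then have "real p \<le> real N" using m by simp
    then show ?thesis using assms by linarith
  qed
  then show "m \<in> smooth_upto N (primes_le x)" using m by (auto simp: smooth_upto_def)
qed (auto simp: smooth_upto_def)

text \<open>Euler's argument: the harmonic sum up to \<open>x\<close> is at most an Euler product
  over the primes up to \<open>x\<close>, to which proper prime powers contribute a bounded factor.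
  This lower bound later turns the residue class 0 of the sieve into a factor
  \<open>1 / ln X\<close>.\<close>

lemma ln_le_exp_sum_inverse_primes:
  "\<exists>C>0. \<forall>x\<ge>2. ln x \<le> C * exp (\<Sum>p\<in>primes_le x. 1 / real p)"
proof -
  obtain C where C: "C > 0" "\<And>P N. finite P \<Longrightarrow> (\<forall>p\<in>P. prime p) \<Longrightarrow> (\<Sum>p\<in>P. \<Sum>l=2..N. real p powr (- 1 * real l)) \<le> C"
    using sum_prime_powers_le[of 1] by (auto simp del: mult_minus1)
  have "ln x \<le> exp C * exp (\<Sum>p\<in>primes_le x. 1 / real p)" if x: "x \<ge> 2" for x :: real
  proof -
    define N where "N = nat \<lfloor>x\<rfloor>"
    have N: "real N \<le> x" "x \<le> real N + 1" "N \<ge> 1" using x by (auto simp: N_def le_nat_floor)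
    define P where "P = primes_le x"
    define \<phi> where "\<phi> p l = 1 / real (p ^ l)" for p l :: nat
    have "pfprod \<phi> m = 1 / real m" if "m > 0" for m
      unfolding pfprod_def \<phi>_def using that
      by (subst (2) prime_factorization_nat[OF that]) (simp add: prod_dividef)
    moreover have "{m. m \<in> smooth_upto N P \<and> wcount id m {} = 0} = {1..N}"
      unfolding P_def smooth_upto_all[OF N(1)] by (auto simp: wcount_def)
    ultimately have "(\<Sum>m | m \<in> smooth_upto N P \<and> wcount id m {} = 0. pfprod \<phi> m) = (\<Sum>m=1..N. 1 / real m)"
      by simp
    also have "\<dots> = harm N" by (simp add: harm_def inverse_eq_divide)
    finally have "ln (real N + 1) \<le> (\<Sum>m | m \<in> smooth_upto N P \<and> wcount id m {} = 0. pfprod \<phi> m)"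
      using ln_le_harm[of N] by simp
    \<comment> \<open>The generating function bound with \<open>E = {}\<close> and
      \<open>T = \<beta> = j = 0\<close>: no prime is counted, and
      \<open>0 ^ 0 / fact 0 = 1\<close>.\<close>
    also have "\<dots> \<le> 0 ^ 0 / fact 0 * exp ((\<Sum>p\<in>P - {}. \<phi> p 1) + (\<Sum>p\<in>P. \<Sum>l=2..N. \<phi> p l * 1))"
      using N(3) by (intro sum_pfprod_wcount_le[where \<beta> = 0]) (auto simp: P_def \<phi>_def)
    also have "\<dots> = exp ((\<Sum>p\<in>P. 1 / real p) + (\<Sum>p\<in>P. \<Sum>l=2..N. \<phi> p l))" by (simp add: \<phi>_def)
    also have "(\<Sum>p\<in>P. \<Sum>l=2..N. \<phi> p l) = (\<Sum>p\<in>P. \<Sum>l=2..N. real p powr (- 1 * real l))"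
      by (intro sum.cong refl) (auto simp: \<phi>_def P_def powr_minus_divide powr_realpow prime_gt_0_nat)
    also have "exp ((\<Sum>p\<in>P. 1 / real p) + (\<Sum>p\<in>P. \<Sum>l=2..N. real p powr (- 1 * real l))) \<le> exp ((\<Sum>p\<in>P. 1 / real p) + C)"
      unfolding exp_le_cancel_iff add_le_cancel_left by (rule C(2)) (simp_all add: P_def)
    finally have "ln (real N + 1) \<le> exp C * exp (\<Sum>p\<in>P. 1 / real p)" by (simp add: exp_add mult.commute)
    moreover have "ln x \<le> ln (real N + 1)" using x N(2) by simp
    ultimately show ?thesis by (simp add: P_def)
  qed
  then show ?thesis by (intro exI[of _ "exp C"]) auto
qed

lemma multiplicative_prime_powers:
  fixes f :: "nat \<Rightarrow> real"
  assumes "f 1 = 1" and mult: "\<And>m n. m \<ge> 1 \<Longrightarrow> n \<ge> 1 \<Longrightarrow> coprime m n \<Longrightarrow> f (m * n) = f m * f n"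
    and "m > 0"
  shows "f m = (\<Prod>p\<in>prime_factors m. f (p ^ multiplicity p m))"
proof -
  have "f (\<Prod>p\<in>D. p ^ e p) = (\<Prod>p\<in>D. f (p ^ e p))"
    if "finite D" "\<And>p. p \<in> D \<Longrightarrow> prime p" for D and e :: "nat \<Rightarrow> nat"
    using that
  proof (induction D rule: finite_induct)
    case (insert p D)
    have "coprime (p ^ e p) (\<Prod>p\<in>D. p ^ e p)"
      using insert.prems insert.hyps
      by (intro prod_coprime_right) (auto intro!: primes_coprime coprime_power_left_iff[THEN iffD2] coprime_power_right_iff[THEN iffD2])
    moreover have "p ^ e p \<ge> 1" "(\<Prod>p\<in>D. p ^ e p) \<ge> 1"
    proof -
      show "p ^ e p \<ge> 1" using insert.prems[of p] by (simp add: Suc_le_eq prime_gt_0_nat)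
      have "(\<Prod>p\<in>D. p ^ e p) > 0" using insert.prems by (intro prod_pos) (auto simp: prime_gt_0_nat)
      then show "(\<Prod>p\<in>D. p ^ e p) \<ge> 1" by simp
    qed
    ultimately show ?case using insert by (simp add: mult)
  qed (use assms in simp)
  from this[of "prime_factors m" "\<lambda>p. multiplicity p m"] show ?thesis
    using prime_factorization_nat[OF assms(3)] by (auto simp: in_prime_factors_imp_prime)
qed

section \<open>Primes \<open>p\<close> for which \<open>m p\<close> is sifted\<close>

lemma card_sieved_residues:
  fixes m q :: nat
  assumes q: "prime q" and R: "R \<subseteq> Units (residue_ring (int q))"
  shows "card {r\<in>{..<q}. q dvd r \<or> int (m * r) mod int q \<in> R} = 1 + (if q dvd m then 0 else card R)"
proof -
  interpret residues_prime q "residue_ring (int q)" using q by unfold_locales auto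
  have q2: "q \<ge> 2" using q by (rule prime_ge_2_nat)
  then have R': "R \<subseteq> {1..int q - 1}" using R res_prime_units_eq by (simp add: of_nat_diff)
  define g where "g r = int (m * r) mod int q" for r
  \<comment> \<open>\<open>R\<close> consists of units, so the class 0, which encodes
    \<open>q dvd r\<close>, is not among those with \<open>m * r\<close> in \<open>R\<close> and
    counts separately.\<close>
  have eq: "{r\<in>{..<q}. q dvd r \<or> int (m * r) mod int q \<in> R} = insert 0 {r\<in>{1..<q}. g r \<in> R}"
    using q2 R' by (auto simp: g_def dest: dvd_imp_le)
  have "card {r\<in>{1..<q}. g r \<in> R} = (if q dvd m then 0 else card R)"
  proof (cases "q dvd m")
    case True
    then have "g r = 0" for r by (auto simp: g_def mod_eq_0_iff_dvd simp flip: of_nat_mult)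
    then have "{r\<in>{1..<q}. g r \<in> R} = {}" using R' by auto
    then show ?thesis using True by simp
  next
    case False
    have cop: "coprime (int m) (int q)" using prime_imp_coprime[OF q False] by (simp add: coprime_commute)
    \<comment> \<open>For \<open>q\<close> not dividing \<open>m\<close>, multiplication by
      \<open>m\<close> permutes the nonzero classes, so exactly as many are struck as
      \<open>R\<close> has elements.\<close>
    have inj: "inj_on g {1..<q}"
    proof (rule inj_onI)
      fix r s assume rs: "r \<in> {1..<q}" "s \<in> {1..<q}" "g r = g s"
      then have "[int m * int r = int m * int s] (mod int q)"
        by (simp add: g_def unique_euclidean_semiring_class.cong_def)
      then have "[int r = int s] (mod int q)" using cop by (simp add: cong_mult_lcancel)
      then show "r = s" using rs by (simp add: unique_euclidean_semiring_class.cong_def)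
    qed
    have "g ` {1..<q} \<subseteq> {1..int q - 1}"
    proof
      fix y assume "y \<in> g ` {1..<q}"
      then obtain r where r: "r \<in> {1..<q}" "y = g r" by auto
      have "\<not> q dvd m * r" using r(1) False q by (auto simp: prime_dvd_mult_iff dest: dvd_imp_le)
      then have "y \<noteq> 0" using r(2) by (auto simp: g_def mod_eq_0_iff_dvd simp flip: of_nat_mult)
      moreover have "y \<ge> 0" "y < int q" using r(2) q2 by (auto simp: g_def)
      ultimately show "y \<in> {1..int q - 1}" by auto
    qed
    moreover have "card (g ` {1..<q}) = card {1..int q - 1}" using inj by (simp add: card_image)
    ultimately have surj: "g ` {1..<q} = {1..int q - 1}" by (intro card_subset_eq) auto
    have img: "g ` {r\<in>{1..<q}. g r \<in> R} = R"
    proof (intro subset_antisym subsetI)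
      fix y assume y: "y \<in> R"
      then have "y \<in> g ` {1..<q}" unfolding surj using R' by (rule rev_subsetD)
      then show "y \<in> g ` {r\<in>{1..<q}. g r \<in> R}" using y by auto
    qed auto
    have "inj_on g {r\<in>{1..<q}. g r \<in> R}" using inj by (rule inj_on_subset) auto
    then have "card (g ` {r\<in>{1..<q}. g r \<in> R}) = card {r\<in>{1..<q}. g r \<in> R}" by (rule card_image)
    then have "card {r\<in>{1..<q}. g r \<in> R} = card R" unfolding img by simp
    then show ?thesis using False by simp
  qed
  then show ?thesis unfolding eq by simp
qed

definition valid_residues :: "nat \<Rightarrow> (nat \<Rightarrow> int set) \<Rightarrow> (nat \<Rightarrow> nat) \<Rightarrow> bool" where
  "valid_residues v R \<nu> \<longleftrightarrow>
     (\<forall>p. prime p \<longrightarrow> R p \<subseteq> Units (residue_ring (int p)) \<and> card (R p) = \<nu> p \<and> \<nu> p \<le> v)"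

definition prime_weight :: "nat \<Rightarrow> nat \<Rightarrow> real" where
  "prime_weight v m = (\<Prod>q\<in>prime_factors m. exp (real v / real q))"

lemma prime_weight_ge_1: "prime_weight v m \<ge> 1"
  unfolding prime_weight_def by (intro prod_ge_1) auto

text \<open>With \<open>X = x / m\<close>, a prime counted here is at most \<open>sqrt X\<close>, or
  it has no prime factor up to \<open>X^(1/16)\<close> and survives a sieve by at most
  \<open>v + 1\<close> classes. The class 0 yields the factor \<open>1 / ln X\<close>, the classes
  \<open>R q\<close> the exponential of \<open>msum\<close>; those lost at \<open>q dvd m\<close>
  are paid for by \<open>prime_weight v m\<close>.\<close>

lemma card_sifted_primes_le:
  fixes v :: nat
  shows "\<exists>C>0. \<forall>x m R \<nu>. valid_residues v R \<nu> \<and> m > 0 \<and> x / real m \<ge> 2 \<longrightarrow>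
     real (card {p. prime p \<and> m * p \<in> sifted x R}) \<le>
     C * (x / real m) / ln (x / real m) * exp (- msum (\<lambda>p. real (\<nu> p)) (x / real m) Primes) * prime_weight v m"
proof -
  define \<kappa> where "\<kappa> = v + 1"
  obtain C1 where C1: "C1 > 0" and C1_all: "\<forall>X bad. X \<ge> 2 \<and> (\<forall>q n. bad q (n mod q) = bad q n) \<and>
      (\<forall>q. prime q \<longrightarrow> card {r\<in>{..<q}. bad q r} \<le> \<kappa>) \<longrightarrow>
      real (card {n::nat. real n \<le> X \<and> (\<forall>q. prime q \<and> real q ^ 16 \<le> X \<longrightarrow> \<not> bad q n)}) \<le>
      C1 * X * exp (- (\<Sum>q\<in>primes_le X. real (card {r\<in>{..<q}. bad q r}) / real q))"
    using sieve_upper_bound[of \<kappa>] by (elim exE conjE) (rule that)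
  obtain C2 where C2: "C2 > 0" "\<And>x. x \<ge> 2 \<Longrightarrow> exp (real \<kappa> * (\<Sum>p\<in>primes_le x. 1 / real p)) \<le> C2 * sqrt x"
    using exp_sum_inverse_primes_le_sqrt[of "real \<kappa>"] by auto
  obtain C3 where C3: "C3 > 0" "\<And>x. x \<ge> 2 \<Longrightarrow> ln x \<le> C3 * exp (\<Sum>p\<in>primes_le x. 1 / real p)"
    using ln_le_exp_sum_inverse_primes by blast
  have "real (card {p. prime p \<and> m * p \<in> sifted x R}) \<le>
     (C1 + C2) * C3 * (x / real m) / ln (x / real m) * exp (- msum (\<lambda>p. real (\<nu> p)) (x / real m) Primes) * prime_weight v m"
    if R: "valid_residues v R \<nu>" and m: "m > 0" and X2: "x / real m \<ge> 2" for x m R \<nu>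
  proof -
    define X where "X = x / real m"
    define bad where "bad q n \<longleftrightarrow> q dvd n \<or> int (m * n) mod int q \<in> R q" for q n :: nat
    define \<rho> where "\<rho> q = card {r\<in>{..<q}. bad q r}" for q
    have X: "X \<ge> 2" using X2 by (simp add: X_def)
    have per: "bad q (n mod q) = bad q n" for q n
    proof -
      have "int (m * (n mod q)) mod int q = int (m * n) mod int q"
        by (metis mod_mult_right_eq of_nat_mod of_nat_mult)
      then show ?thesis by (simp add: bad_def dvd_mod_iff)
    qed
    have \<rho>: "\<rho> q = 1 + (if q dvd m then 0 else \<nu> q)" if "prime q" for q
      unfolding \<rho>_def bad_def using R that card_sieved_residues[OF that, of "R q" m]
      by (simp add: valid_residues_def)
    have \<nu>: "\<nu> q \<le> v" if "prime q" for q using R that by (simp add: valid_residues_def)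
    have \<rho>\<kappa>: "\<rho> q \<le> \<kappa>" if "prime q" for q using \<rho>[OF that] \<nu>[OF that] by (simp add: \<kappa>_def)
    define S where "S = (\<Sum>q\<in>primes_le X. real (\<rho> q) / real q)"
    define A where "A = {n::nat. real n \<le> X \<and> (\<forall>q. prime q \<and> real q ^ 16 \<le> X \<longrightarrow> \<not> bad q n)}"
    have sub: "{p. prime p \<and> m * p \<in> sifted x R} \<subseteq> primes_le (sqrt X) \<union> A"
    proof
      fix p assume "p \<in> {p. prime p \<and> m * p \<in> sifted x R}"
      then have p: "prime p" "real (m * p) \<le> x" "\<And>q. prime q \<Longrightarrow> int (m * p) mod int q \<notin> R q"
        by (auto simp: sifted_def)
      have pX: "real p \<le> X" using p(2) m by (simp add: X_def field_simps)
      show "p \<in> primes_le (sqrt X) \<union> A"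
      proof (cases "real p ^ 16 \<le> X")
        case True
        have "real p ^ 2 \<le> real p ^ 16" using p(1) by (intro power_increasing) (auto dest: prime_ge_1_nat)
        then have "real p \<le> sqrt X" using True by (intro real_le_rsqrt) auto
        then show ?thesis using p by simp
      next
        case False
        have "\<not> q dvd p" if "prime q" "real q ^ 16 \<le> X" for q
          using that False p(1) primes_dvd_imp_eq by blast
        then have "p \<in> A" using p pX by (auto simp: A_def bad_def)
        then show ?thesis by simp
      qed
    qed
    have finA: "finite A"
      unfolding A_def by (rule finite_subset[OF _ finite_nat_real_le[of "\<lambda>_. True" X]]) auto
    have "card {p. prime p \<and> m * p \<in> sifted x R} \<le> card (primes_le (sqrt X) \<union> A)"
      using sub finA by (intro card_mono) auto
    also have "\<dots> \<le> card (primes_le (sqrt X)) + card A" by (rule card_Un_le)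
    finally have "real (card {p. prime p \<and> m * p \<in> sifted x R}) \<le> real (card (primes_le (sqrt X))) + real (card A)"
      by linarith
    also have "\<dots> \<le> sqrt X + C1 * X * exp (- S)"
    proof (intro add_mono card_primes_le_bound)
      show "real (card A) \<le> C1 * X * exp (- S)"
        unfolding A_def S_def \<rho>_def
        by (rule C1_all[rule_format]) (use X per \<rho>\<kappa>[unfolded \<rho>_def] in blast)
    qed (use X in simp)
    also have "sqrt X \<le> C2 * X * exp (- S)"
    proof -
      have "S \<le> (\<Sum>q\<in>primes_le X. real \<kappa> * (1 / real q))"
        unfolding S_def using \<rho>\<kappa> by (intro sum_mono) (auto intro!: divide_right_mono)
      then have "S \<le> real \<kappa> * (\<Sum>q\<in>primes_le X. 1 / real q)" by (simp only: sum_distrib_left)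
      then have "exp S \<le> C2 * sqrt X" using C2(2)[OF X] by (meson exp_le_cancel_iff order_trans)
      then have "sqrt X * exp S \<le> sqrt X * (C2 * sqrt X)" using X by (intro mult_left_mono) auto
      then show ?thesis using X by (simp add: exp_minus field_simps)
    qed
    finally have 1: "real (card {p. prime p \<and> m * p \<in> sifted x R}) \<le> (C1 + C2) * X * exp (- S)"
      by (simp add: algebra_simps)
    define T where "T = (\<Sum>q\<in>primes_le X. 1 / real q)"
    define M where "M = msum (\<lambda>p. real (\<nu> p)) X Primes"
    have "T + M - (\<Sum>q\<in>prime_factors m. real v / real q) \<le> S"
    proof -
      have "T + M = (\<Sum>q\<in>primes_le X. 1 / real q + real (\<nu> q) / real q)"
        by (simp add: T_def M_def msum_def sum.distrib)
      also have "\<dots> \<le> (\<Sum>q\<in>primes_le X. real (\<rho> q) / real q + (if q dvd m then real v / real q else 0))"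
      proof (rule sum_mono)
        fix q assume q: "q \<in> primes_le X"
        then have q0: "real q > 0" by (auto dest: prime_gt_0_nat)
        have "1 + real (\<nu> q) \<le> real (\<rho> q) + (if q dvd m then real v else 0)"
          using q \<rho>[of q] \<nu>[of q] by auto
        then have "(1 + real (\<nu> q)) / real q \<le> (real (\<rho> q) + (if q dvd m then real v else 0)) / real q"
          using q0 by (intro divide_right_mono) auto
        then show "1 / real q + real (\<nu> q) / real q \<le> real (\<rho> q) / real q + (if q dvd m then real v / real q else 0)"
          by (simp add: add_divide_distrib split: if_splits)
      qed
      also have "\<dots> = S + (\<Sum>q\<in>primes_le X. if q dvd m then real v / real q else 0)"
        by (simp add: S_def sum.distrib)
      also have "(\<Sum>q\<in>primes_le X. if q dvd m then real v / real q else 0) = (\<Sum>q\<in>{q\<in>primes_le X. q dvd m}. real v / real q)"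
        by (rule sum.inter_filter[symmetric]) simp
      also have "\<dots> \<le> (\<Sum>q\<in>prime_factors m. real v / real q)"
        using m by (intro sum_mono2) (auto simp: in_prime_factors_iff)
      finally show ?thesis by simp
    qed
    then have "exp (- S) \<le> exp (- T + - M + (\<Sum>q\<in>prime_factors m. real v / real q))" by simp
    also have "\<dots> = exp (- T) * exp (- M) * prime_weight v m"
      by (simp only: exp_add prime_weight_def exp_sum finite_set_mset)
    also have "\<dots> \<le> (C3 / ln X) * exp (- M) * prime_weight v m"
    proof -
      have "ln X * exp (- T) \<le> C3" using C3(2)[OF X] by (simp add: T_def exp_minus field_simps)
      then have "exp (- T) \<le> C3 / ln X" using X by (simp add: field_simps)
      then show ?thesis using prime_weight_ge_1[of v m] by (intro mult_right_mono) auto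
    qed
    finally have "(C1 + C2) * X * exp (- S) \<le> (C1 + C2) * X * ((C3 / ln X) * exp (- M) * prime_weight v m)"
      using C1(1) C2(1) X by (intro mult_left_mono) auto
    then have "real (card {p. prime p \<and> m * p \<in> sifted x R}) \<le> (C1 + C2) * X * ((C3 / ln X) * exp (- M) * prime_weight v m)"
      using 1 by linarith
    then show ?thesis by (simp add: X_def M_def mult_ac)
  qed
  then show ?thesis using C1(1) C2(1) C3(1) by (intro exI[of _ "(C1 + C2) * C3"]) auto
qed

section \<open>Rankin sums\<close>

text \<open>\<open>b\<close> bounds the ratio \<open>k / M\<close>. The last condition makes \<open>\<Sum>\<^sub>l b^(w l) f(p^l) / p^l\<close> converge
  at the small primes of \<open>E\<close>; for \<open>\<Omega>\<close> it encodes \<open>b \<le> p\<^sub>0 powr \<theta>\<close>.\<close>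

definition admissible ::
  "real \<Rightarrow> real \<Rightarrow> real \<Rightarrow> real \<Rightarrow> (nat \<Rightarrow> real) \<Rightarrow> nat set \<Rightarrow> (nat \<Rightarrow> nat) \<Rightarrow> bool" where
  "admissible A B b \<theta> f E w \<longleftrightarrow>
     (\<forall>n\<ge>1. f n \<ge> 0) \<and> f 1 = 1 \<and>
     (\<forall>m\<ge>1. \<forall>n\<ge>1. coprime m n \<longrightarrow> f (m * n) = f m * f n) \<and>
     (\<forall>p l. prime p \<longrightarrow> f (p ^ l) \<le> A ^ l) \<and>
     (\<forall>p l. prime p \<longrightarrow> f (p ^ l) \<le> B * real (p ^ l) powr ((1 - \<theta>) / 16)) \<and>
     E \<subseteq> Primes \<and> w 1 = 1 \<and> (\<forall>l. w l \<le> l) \<and>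
     (\<forall>p\<in>E. \<forall>l. b ^ w l \<le> b * real p powr (\<theta> * real l))"

text \<open>The factor \<open>exp (v / p)\<close> pays for the primes dividing \<open>m\<close>, at which the residues \<open>R p\<close> put no
  condition on the prime \<open>n / m\<close>; \<open>\<eta>\<close> is Rankin's exponent, and \<open>2 \<delta>\<close> serves to bound the \<open>n\<close> that are
  divisible by a large proper prime power.\<close>

definition rankin_term :: "(nat \<Rightarrow> real) \<Rightarrow> nat \<Rightarrow> real \<Rightarrow> real \<Rightarrow> nat \<Rightarrow> nat \<Rightarrow> real" where
  "rankin_term f v \<delta> \<eta> p l = f (p ^ l) * exp (real v / real p) / real (p ^ l) *
     (if l = 1 then real p powr \<eta> else real (p ^ l) powr (2 * \<delta>))"

lemma admissible_prime_power_nonneg: "admissible A B b \<theta> f E w \<Longrightarrow> prime p \<Longrightarrow> f (p ^ l) \<ge> 0"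
  unfolding admissible_def by (metis Suc_le_eq One_nat_def prime_gt_0_nat zero_less_power)

lemma rankin_term_nonneg:
  assumes "admissible A B b \<theta> f E w" "prime p"
  shows "rankin_term f v \<delta> \<eta> p l \<ge> 0"
  using admissible_prime_power_nonneg[OF assms, of l] by (simp add: rankin_term_def)

text \<open>For \<open>p \<le> y\<close> the exponent \<open>t = v / p + \<eta> * ln p\<close> is
  bounded, so the extra factor is \<open>1 + O(t)\<close>. The excess sums to a constant:
  \<open>1 / p^2\<close> is summable, and \<open>\<eta>\<close> times the sum of
  \<open>ln p / p\<close> is at most \<open>2 * \<eta> * ln y \<le> 2\<close>. Rankin's trick thus
  shifts \<open>M\<close> by a constant only.\<close>

lemma sum_rankin_term_primes_le:
  fixes A :: real and v :: nat
  assumes "A > 0"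
  shows "\<exists>K\<ge>0. \<forall>B b \<theta> \<delta> f E w y \<eta> Q. admissible A B b \<theta> f E w \<and> y \<ge> 1 \<and> \<eta> \<ge> 0 \<and> \<eta> * ln y \<le> 1 \<and> Q \<subseteq> primes_le y \<longrightarrow>
    (\<Sum>p\<in>Q. rankin_term f v \<delta> \<eta> p 1) \<le> (\<Sum>p\<in>Q. f p / real p) + K"
proof -
  obtain C where C: "C > 0" "\<And>P. finite P \<Longrightarrow> (\<Sum>p\<in>P. real p powr (- 2)) \<le> C"
    using sum_powr_primes_le[of 2] by auto
  define D where "D = A * exp (real v + 1)"
  have D: "D > 0" using assms by (simp add: D_def)
  have "(\<Sum>p\<in>Q. rankin_term f v \<delta> \<eta> p 1) \<le> (\<Sum>p\<in>Q. f p / real p) + D * (real v * C + 2)"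
    if adm: "admissible A B b \<theta> f E w" and y: "y \<ge> 1" and \<eta>: "\<eta> \<ge> 0" "\<eta> * ln y \<le> 1" and Q: "Q \<subseteq> primes_le y"
    for B b \<theta> \<delta> f E w y \<eta> Q
  proof -
    have fin: "finite Q" using Q by (rule finite_subset) simp
    have "rankin_term f v \<delta> \<eta> p 1 \<le> f p / real p + D * (real v * real p powr (- 2) + \<eta> * (ln (real p) / real p))"
      if "p \<in> Q" for p
    proof -
      have p: "prime p" "real p \<le> y" "real p \<ge> 1"
        using that Q prime_ge_1_nat[of p] by auto
      have fp: "f p \<ge> 0" "f p \<le> A"
        using admissible_prime_power_nonneg[OF adm p(1), of 1] adm p(1) power_one_right
        unfolding admissible_def by (simp, metis power_one_right)
      define t where "t = real v / real p + \<eta> * ln (real p)"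
      have t0: "t \<ge> 0" using p \<eta> by (simp add: t_def)
      have "\<eta> * ln (real p) \<le> \<eta> * ln y" using p \<eta> y by (intro mult_left_mono) auto
      moreover have "real v / real p \<le> real v" using p(3) divide_left_mono[of 1 "real p" "real v"] by simp
      ultimately have t1: "t \<le> real v + 1" using \<eta> by (simp add: t_def)
      have "1 - t \<le> exp (- t)" using exp_ge_add_one_self[of "- t"] by simp
      then have "(1 - t) * exp t \<le> exp (- t) * exp t" by (intro mult_right_mono) auto
      then have "exp t \<le> 1 + t * exp t" by (simp add: algebra_simps flip: exp_add)
      also have "\<dots> \<le> 1 + t * exp (real v + 1)" using t0 t1 by (intro add_left_mono mult_left_mono) auto
      finally have et: "exp t \<le> 1 + t * exp (real v + 1)" .
      have "rankin_term f v \<delta> \<eta> p 1 = f p / real p * exp t"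
        using p by (simp add: rankin_term_def t_def exp_add powr_def)
      also have "\<dots> \<le> f p / real p * (1 + t * exp (real v + 1))"
        using et fp p by (intro mult_left_mono) auto
      also have "\<dots> = f p / real p + f p / real p * (t * exp (real v + 1))" by (simp add: algebra_simps)
      also have "\<dots> \<le> f p / real p + A / real p * (t * exp (real v + 1))"
        using fp t0 p by (intro add_left_mono mult_right_mono divide_right_mono) auto
      also have "A / real p * (t * exp (real v + 1)) = D * (real v * real p powr (- 2) + \<eta> * (ln (real p) / real p))"
        using p by (simp add: D_def t_def powr_minus_divide powr_numeral field_simps power2_eq_square)
      finally show ?thesis .
    qed
    then have "(\<Sum>p\<in>Q. rankin_term f v \<delta> \<eta> p 1) \<le>
        (\<Sum>p\<in>Q. f p / real p + D * (real v * real p powr (- 2) + \<eta> * (ln (real p) / real p)))"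
      by (rule sum_mono)
    also have "\<dots> = (\<Sum>p\<in>Q. f p / real p) + D * (real v * (\<Sum>p\<in>Q. real p powr (- 2)) + \<eta> * (\<Sum>p\<in>Q. ln (real p) / real p))"
      by (simp only: sum.distrib sum_distrib_left[symmetric])
    also have "\<dots> \<le> (\<Sum>p\<in>Q. f p / real p) + D * (real v * C + 2)"
    proof (intro add_left_mono mult_left_mono add_mono)
      show "(\<Sum>p\<in>Q. real p powr (- 2)) \<le> C" using fin by (rule C(2))
      have "(\<Sum>p\<in>Q. ln (real p) / real p) \<le> (\<Sum>p\<in>primes_le y. ln (real p) / real p)"
        using Q by (intro sum_mono2) (auto intro!: divide_nonneg_nonneg ln_ge_zero dest: prime_ge_1_nat)
      also have "\<dots> \<le> 2 * ln y" using y by (rule sum_ln_over_primes_le)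
      finally have "\<eta> * (\<Sum>p\<in>Q. ln (real p) / real p) \<le> \<eta> * (2 * ln y)" using \<eta> by (intro mult_left_mono) auto
      then show "\<eta> * (\<Sum>p\<in>Q. ln (real p) / real p) \<le> 2" using \<eta> by simp
    qed (use D in auto)
    finally show ?thesis .
  qed
  moreover have "D * (real v * C + 2) \<ge> 0" using C D by (intro mult_nonneg_nonneg add_nonneg_nonneg) auto
  ultimately show ?thesis by (intro exI[of _ "D * (real v * C + 2)"]) auto
qed

text \<open>Two regimes. For \<open>p \<le> p1\<close> the bound with \<open>B\<close> and the
  condition on \<open>b ^ w l\<close> give a convergent geometric series, and such primes are
  boundedly many. For larger \<open>p\<close> the bound \<open>A ^ l\<close> leaves
  \<open>p powr (- 3 / 4 * l)\<close>, which is summable over \<open>p\<close> and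
  \<open>l \<ge> 2\<close>.\<close>

lemma sum_rankin_term_prime_powers_le:
  fixes A B b \<theta> :: real and v :: nat
  assumes A: "A > 0" and B: "B > 0" and b: "b \<ge> 1" and \<theta>: "0 \<le> \<theta>" "\<theta> < 1"
  shows "\<exists>C>0. \<forall>f E w \<eta> P N. admissible A B b \<theta> f E w \<and> finite P \<and> (\<forall>p\<in>P. prime p) \<longrightarrow>
    (\<Sum>p\<in>P. \<Sum>l=2..N. rankin_term f v ((1 - \<theta>) / 16) \<eta> p l * (if p \<in> E then b ^ w l else 1)) \<le> C"
proof -
  define \<delta> where "\<delta> = (1 - \<theta>) / 16"
  \<comment> \<open>\<open>\<theta>\<close> is spent on \<open>b ^ w l\<close>,
    \<open>\<delta>\<close> on \<open>f (p^l)\<close> and \<open>2 * \<delta>\<close> on Rankin's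
    weight; what remains is \<open>\<tau> = 13 * \<delta>\<close>.\<close>
  define \<tau> where "\<tau> = 1 - \<theta> - 3 * \<delta>"
  have \<delta>: "\<delta> > 0" "\<delta> \<le> 1 / 16" and \<tau>: "\<tau> > 0" using \<theta> by (auto simp: \<delta>_def \<tau>_def)
  \<comment> \<open>Beyond \<open>p1\<close> one has \<open>A * b \<le> p powr (1 / 8)\<close>, and
    \<open>1 / 8 + 2 * \<delta> - 1 \<le> - 3 / 4\<close>.\<close>
  define p1 where "p1 = (A * b) ^ 8"
  have p1: "p1 > 0" using A b by (simp add: p1_def)
  have "2 powr (- \<tau>) < 1" using \<tau> by (simp add: powr_minus_divide)
  then have t: "1 - 2 powr (- \<tau>) > 0" by simp
  define c1 where "c1 = B * exp (real v) * b / (1 - 2 powr (- \<tau>))"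
  define c2 where "c2 = exp (real v) * b"
  have c: "c1 > 0" "c2 > 0" using B b t by (auto simp: c1_def c2_def)
  obtain C where C: "C > 0" "\<And>P N. finite P \<Longrightarrow> (\<forall>p\<in>P. prime p) \<Longrightarrow> (\<Sum>p\<in>P. \<Sum>l=2..N. real p powr (- (3 / 4) * real l)) \<le> C"
    using sum_prime_powers_le[of "3 / 4"] by (auto simp del: mult_minus_left)
  have "(\<Sum>p\<in>P. \<Sum>l=2..N. rankin_term f v \<delta> \<eta> p l * (if p \<in> E then b ^ w l else 1)) \<le> c1 * p1 + c2 * C"
    if adm: "admissible A B b \<theta> f E w" and P: "finite P" "\<forall>p\<in>P. prime p" for f E w \<eta> P N
  proof -
    have "(\<Sum>l=2..N. rankin_term f v \<delta> \<eta> p l * (if p \<in> E then b ^ w l else 1)) \<le>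
        (if real p \<le> p1 then c1 else 0) + (\<Sum>l=2..N. c2 * real p powr (- (3 / 4) * real l))" if "p \<in> P" for p
    proof -
      have p: "prime p" using that P by auto
      then have p2: "real p \<ge> 2" using prime_ge_2_nat by force
      define q where "q = real p"
      have q: "q \<ge> 2" "q > 0" using p2 by (auto simp: q_def)
      define W where "W l = (if p \<in> E then b ^ w l else 1)" for l
      have W0: "W l \<ge> 0" for l using b by (simp add: W_def)
      have W1: "W l \<le> b * q powr (\<theta> * real l)" for l
      proof (cases "p \<in> E")
        case True
        then show ?thesis using adm by (simp add: W_def admissible_def q_def)
      next
        case False
        have "1 \<le> q powr (\<theta> * real l)" using q \<theta> by (intro ge_one_powr_ge_zero) auto
        then show ?thesis using b False mult_mono[of 1 b 1 "q powr (\<theta> * real l)"] by (simp add: W_def)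
      qed
      have W2: "W l \<le> b * b ^ l" for l
      proof (cases "p \<in> E")
        case True
        have "w l \<le> Suc l" using adm by (simp add: admissible_def le_SucI)
        then have "b ^ w l \<le> b ^ Suc l" using b by (intro power_increasing) auto
        then show ?thesis using True by (simp add: W_def)
      next
        case False
        then show ?thesis using b one_le_power[of b "Suc l"] by (simp add: W_def)
      qed
      have ql: "real (p ^ l) = q powr real l" for l using q by (simp add: q_def powr_realpow)
      define F where "F l = f (p ^ l)" for l
      have F0: "F l \<ge> 0" for l unfolding F_def using adm p by (rule admissible_prime_power_nonneg)
      have rt: "rankin_term f v \<delta> \<eta> p l * W l \<le> F l * W l * (exp (real v) * q powr ((2 * \<delta> - 1) * real l))"
        if "l \<ge> 2" for l
      proof -
        have "rankin_term f v \<delta> \<eta> p l * W l = (F l * W l) * (exp (real v / q) * q powr ((2 * \<delta> - 1) * real l))"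
          using that unfolding rankin_term_def ql
          by (simp add: q_def[symmetric] F_def powr_powr powr_diff algebra_simps)
        also have "exp (real v / q) \<le> exp (real v)" using q divide_left_mono[of 1 q "real v"] by simp
        finally show ?thesis using F0 W0 by (simp add: mult_left_mono mult_right_mono)
      qed
      show ?thesis
      proof (cases "q \<le> p1")
        case True
        have "rankin_term f v \<delta> \<eta> p l * W l \<le> B * exp (real v) * b * q powr (- \<tau> * real l)" if l: "l \<ge> 2" for l
        proof -
          have "F l \<le> B * real (p ^ l) powr \<delta>"
            unfolding F_def \<delta>_def using adm p unfolding admissible_def by blast
          then have "F l \<le> B * q powr (\<delta> * real l)"
            unfolding ql by (simp add: powr_powr mult.commute)
          then have "F l * W l \<le> (B * q powr (\<delta> * real l)) * (b * q powr (\<theta> * real l))"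
            using W1 F0 W0 B b by (intro mult_mono) auto
          then have "F l * W l * (exp (real v) * q powr ((2 * \<delta> - 1) * real l)) \<le>
              (B * q powr (\<delta> * real l)) * (b * q powr (\<theta> * real l)) * (exp (real v) * q powr ((2 * \<delta> - 1) * real l))"
            by (intro mult_right_mono) auto
          also have "\<dots> = B * exp (real v) * b * q powr (\<delta> * real l + \<theta> * real l + (2 * \<delta> - 1) * real l)"
            by (simp add: powr_add mult_ac)
          also have "\<delta> * real l + \<theta> * real l + (2 * \<delta> - 1) * real l = - \<tau> * real l"
            by (simp add: \<tau>_def algebra_simps)
          finally show ?thesis using rt[OF l] by linarith
        qed
        then have "(\<Sum>l=2..N. rankin_term f v \<delta> \<eta> p l * W l) \<le> (\<Sum>l=2..N. B * exp (real v) * b * q powr (- \<tau> * real l))"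
          by (intro sum_mono) auto
        also have "\<dots> = B * exp (real v) * b * (\<Sum>l=2..N. q powr (- \<tau> * real l))" by (rule sum_distrib_left[symmetric])
        also have "\<dots> \<le> B * exp (real v) * b * (1 / (1 - 2 powr (- \<tau>)))"
        proof (intro mult_left_mono)
          have "(\<Sum>l=2..N. q powr (- \<tau> * real l)) \<le> q powr (- 2 * \<tau>) / (1 - 2 powr (- \<tau>))"
            using \<tau> q by (intro sum_powr_tail_le) auto
          also have "\<dots> \<le> 1 / (1 - 2 powr (- \<tau>))"
          proof (intro divide_right_mono)
            have "q powr (- 2 * \<tau>) \<le> q powr 0" using q \<tau> by (intro powr_mono) auto
            then show "q powr (- 2 * \<tau>) \<le> 1" using q by simp
          qed (use t in auto)
          finally show "(\<Sum>l=2..N. q powr (- \<tau> * real l)) \<le> 1 / (1 - 2 powr (- \<tau>))" .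
        qed (use B b in auto)
        also have "\<dots> = c1" by (simp add: c1_def)
        finally have "(\<Sum>l=2..N. rankin_term f v \<delta> \<eta> p l * W l) \<le> c1" .
        moreover have "(\<Sum>l=2..N. c2 * real p powr (- (3 / 4) * real l)) \<ge> 0" using c by (intro sum_nonneg) auto
        ultimately show ?thesis using True by (simp add: W_def q_def)
      next
        case False
        have "rankin_term f v \<delta> \<eta> p l * W l \<le> c2 * q powr (- (3 / 4) * real l)" if l: "l \<ge> 2" for l
        proof -
          have Ab: "A * b > 0" using A b by simp
          have "p1 = (A * b) powr 8" using powr_numeral[OF less_imp_le[OF Ab]] by (simp add: p1_def)
          then have "p1 powr (1 / 8) = (A * b) powr (8 * (1 / 8))" by (simp only: powr_powr)
          then have "A * b = p1 powr (1 / 8)" using Ab by simp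
          also have "\<dots> \<le> q powr (1 / 8)" using False p1 by (intro powr_mono2) auto
          finally have "(A * b) ^ l \<le> (q powr (1 / 8)) ^ l" using A b by (intro power_mono) auto
          also have "\<dots> = (q powr (1 / 8)) powr real l" using q by (intro powr_realpow[symmetric]) simp
          also have "\<dots> = q powr (1 / 8 * real l)" by (simp only: powr_powr)
          finally have Abl: "(A * b) ^ l \<le> q powr (1 / 8 * real l)" .
          have "F l \<le> A ^ l" using adm p by (auto simp: admissible_def F_def)
          then have "F l * W l \<le> A ^ l * (b * b ^ l)" using W2 F0 W0 A by (intro mult_mono) auto
          also have "\<dots> = b * (A * b) ^ l" by (simp add: power_mult_distrib)
          also have "\<dots> \<le> b * q powr (1 / 8 * real l)" using Abl b by (intro mult_left_mono) auto
          finally have "F l * W l * (exp (real v) * q powr ((2 * \<delta> - 1) * real l)) \<le>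
              b * q powr (1 / 8 * real l) * (exp (real v) * q powr ((2 * \<delta> - 1) * real l))"
            by (intro mult_right_mono) auto
          also have "\<dots> = c2 * q powr (1 / 8 * real l + (2 * \<delta> - 1) * real l)"
            by (simp add: c2_def powr_add mult_ac)
          also have "\<dots> \<le> c2 * q powr (- (3 / 4) * real l)"
          proof (intro mult_left_mono powr_mono)
            have "(1 / 8 + (2 * \<delta> - 1)) * real l \<le> - (3 / 4) * real l" using \<delta> by (intro mult_right_mono) auto
            then show "1 / 8 * real l + (2 * \<delta> - 1) * real l \<le> - (3 / 4) * real l" by (simp only: distrib_right)
          qed (use c q in auto)
          finally show ?thesis using rt[OF l] by linarith
        qed
        then have "(\<Sum>l=2..N. rankin_term f v \<delta> \<eta> p l * W l) \<le> (\<Sum>l=2..N. c2 * q powr (- (3 / 4) * real l))"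
          by (intro sum_mono) auto
        then show ?thesis using False by (simp add: W_def q_def)
      qed
    qed
    then have "(\<Sum>p\<in>P. \<Sum>l=2..N. rankin_term f v \<delta> \<eta> p l * (if p \<in> E then b ^ w l else 1)) \<le>
        (\<Sum>p\<in>P. (if real p \<le> p1 then c1 else 0) + (\<Sum>l=2..N. c2 * real p powr (- (3 / 4) * real l)))"
      by (rule sum_mono)
    also have "\<dots> = (\<Sum>p\<in>P. if real p \<le> p1 then c1 else 0) + c2 * (\<Sum>p\<in>P. \<Sum>l=2..N. real p powr (- (3 / 4) * real l))"
      by (simp only: sum.distrib sum_distrib_left)
    also have "\<dots> \<le> c1 * p1 + c2 * C"
    proof (intro add_mono mult_left_mono)
      have "(\<Sum>p\<in>P. if real p \<le> p1 then c1 else 0) = (\<Sum>p\<in>{p\<in>P. real p \<le> p1}. c1)"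
        by (rule sum.inter_filter[symmetric]) (rule P)
      also have "\<dots> = c1 * real (card {p\<in>P. real p \<le> p1})" by simp
      also have "\<dots> \<le> c1 * real (card (primes_le p1))"
        using c P by (intro mult_left_mono of_nat_mono card_mono) auto
      also have "\<dots> \<le> c1 * p1" using c p1 by (intro mult_left_mono card_primes_le_bound) auto
      finally show "(\<Sum>p\<in>P. if real p \<le> p1 then c1 else 0) \<le> c1 * p1" .
      show "(\<Sum>p\<in>P. \<Sum>l=2..N. real p powr (- (3 / 4) * real l)) \<le> C" using P by (rule C(2))
    qed (use c in auto)
    finally show ?thesis .
  qed
  moreover have "c1 * p1 + c2 * C > 0" using c p1 C by (intro add_pos_pos mult_pos_pos) auto
  ultimately show ?thesis unfolding \<delta>_def by (intro exI[of _ "c1 * p1 + c2 * C"]) auto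
qed

text \<open>The order of magnitude to expect of the sum of \<open>f(m) / m\<close> over the
  \<open>m\<close> with \<open>j\<close> prime factors in \<open>E\<close> and none above
  \<open>x\<close>: a Poisson-like term for \<open>E\<close>, a full Euler product outside
  \<open>E\<close>.\<close>

definition main_size :: "(nat \<Rightarrow> real) \<Rightarrow> real \<Rightarrow> nat set \<Rightarrow> nat \<Rightarrow> real" where
  "main_size f x E j = msum f x E ^ j / fact j * exp (msum f x (Primes - E))"

text \<open>The generating function bound with \<open>T = M + K\<close>, where \<open>K\<close> is
  the shift from \<open>sum_rankin_term_primes_le\<close>. The comparison size is taken at
  \<open>x\<close> for every smoothness bound \<open>y\<close>, so that contributions of different
  \<open>y\<close> can be added up.\<close>

lemma rankin_sum_le:
  fixes A B b \<theta> :: real and v :: nat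
  assumes A: "A > 0" and B: "B > 0" and b: "b \<ge> 1" and \<theta>: "0 \<le> \<theta>" "\<theta> < 1"
  shows "\<exists>C>0. \<forall>f E w x y \<eta> N j. admissible A B b \<theta> f E w \<and> y \<ge> 1 \<and> y \<le> x \<and> \<eta> \<ge> 0 \<and> \<eta> * ln y \<le> 1 \<and> N \<ge> 1 \<and>
      real j \<le> b * msum f x E \<longrightarrow>
    (\<Sum>m | m \<in> smooth_upto N (primes_le y) \<and> wcount w m E = j. pfprod (rankin_term f v ((1 - \<theta>) / 16) \<eta>) m)
      \<le> C * main_size f x E j"
proof -
  obtain K where K: "K \<ge> 0" and K_all: "\<forall>B b \<theta> \<delta> f E w y \<eta> Q. admissible A B b \<theta> f E w \<and> y \<ge> 1 \<and> \<eta> \<ge> 0 \<and> \<eta> * ln y \<le> 1 \<and> Q \<subseteq> primes_le y \<longrightarrow>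
    (\<Sum>p\<in>Q. rankin_term f v \<delta> \<eta> p 1) \<le> (\<Sum>p\<in>Q. f p / real p) + K"
    using sum_rankin_term_primes_le[OF A, of v] by (elim exE conjE) (rule that)
  obtain C where C: "C > 0" and C_all: "\<forall>f E w \<eta> P N. admissible A B b \<theta> f E w \<and> finite P \<and> (\<forall>p\<in>P. prime p) \<longrightarrow>
    (\<Sum>p\<in>P. \<Sum>l=2..N. rankin_term f v ((1 - \<theta>) / 16) \<eta> p l * (if p \<in> E then b ^ w l else 1)) \<le> C"
    using sum_rankin_term_prime_powers_le[OF assms, of v] by (elim exE conjE) (rule that)
  have "(\<Sum>m | m \<in> smooth_upto N (primes_le y) \<and> wcount w m E = j. pfprod (rankin_term f v ((1 - \<theta>) / 16) \<eta>) m)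
      \<le> exp (K * b + K + C) * main_size f x E j"
    if adm: "admissible A B b \<theta> f E w" and y: "y \<ge> 1" "y \<le> x" and \<eta>: "\<eta> \<ge> 0" "\<eta> * ln y \<le> 1" and N: "N \<ge> 1"
      and j: "real j \<le> b * msum f x E" for f E w x y \<eta> N j
  proof -
    define \<phi> where "\<phi> = rankin_term f v ((1 - \<theta>) / 16) \<eta>"
    define P where "P = primes_le y"
    define M where "M = msum f x E"
    define M' where "M' = msum f x (Primes - E)"
    have E: "E \<subseteq> Primes" using adm by (simp add: admissible_def)
    have fp: "f p / real p \<ge> 0" if "prime p" for p
      using admissible_prime_power_nonneg[OF adm that, of 1] by simp
    have M0: "M \<ge> 0" unfolding M_def msum_def using E fp by (intro sum_nonneg) auto
    have S1: "(\<Sum>p\<in>P \<inter> E. \<phi> p 1) \<le> M + K"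
    proof -
      have "(\<Sum>p\<in>P \<inter> E. \<phi> p 1) \<le> (\<Sum>p\<in>P \<inter> E. f p / real p) + K"
        unfolding \<phi>_def P_def using adm y \<eta> by (intro K_all[rule_format]) auto
      also have "(\<Sum>p\<in>P \<inter> E. f p / real p) \<le> M"
        unfolding M_def msum_def P_def using y fp E by (intro sum_mono2) auto
      finally show ?thesis by simp
    qed
    have S2: "(\<Sum>p\<in>P - E. \<phi> p 1) \<le> M' + K"
    proof -
      have "(\<Sum>p\<in>P - E. \<phi> p 1) \<le> (\<Sum>p\<in>P - E. f p / real p) + K"
        unfolding \<phi>_def P_def using adm y \<eta> by (intro K_all[rule_format]) auto
      also have "(\<Sum>p\<in>P - E. f p / real p) \<le> M'"
        unfolding M'_def msum_def P_def using y fp by (intro sum_mono2) auto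
      finally show ?thesis by simp
    qed
    have S3: "(\<Sum>p\<in>P. \<Sum>l=2..N. \<phi> p l * (if p \<in> E then b ^ w l else 1)) \<le> C"
      unfolding \<phi>_def P_def using adm by (intro C_all[rule_format]) auto
    have "b * M \<le> b * (M + K)" using b K by (intro mult_left_mono) auto
    then have "real j \<le> b * (M + K)" using j unfolding M_def by linarith
    then have "(\<Sum>m | m \<in> smooth_upto N P \<and> wcount w m E = j. pfprod \<phi> m) \<le>
        (M + K) ^ j / fact j * exp ((\<Sum>p\<in>P - E. \<phi> p 1) + (\<Sum>p\<in>P. \<Sum>l=2..N. \<phi> p l * (if p \<in> E then b ^ w l else 1)))"
      using adm N b S1
      by (intro sum_pfprod_wcount_le[where \<beta> = b])
         (auto simp: P_def \<phi>_def admissible_def intro: rankin_term_nonneg[OF adm])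
    also have "\<dots> \<le> (M + K) ^ j / fact j * exp (M' + K + C)"
      using S2 S3 M0 K by (intro mult_left_mono) auto
    also have "\<dots> \<le> (M ^ j * exp (K * b)) / fact j * exp (M' + K + C)"
    proof (intro mult_right_mono divide_right_mono)
      \<comment> \<open>\<open>(1 + K / M)^j \<le> exp (K * j / M)\<close> and
        \<open>j \<le> b * M\<close>; if \<open>M = 0\<close>, then \<open>j = 0\<close> and both
        powers are 1.\<close>
      show "(M + K) ^ j \<le> M ^ j * exp (K * b)"
      proof (cases "M = 0")
        case True
        then have "j = 0" using j by (simp add: M_def)
        then show ?thesis using K b by simp
      next
        case False
        then have Mp: "M > 0" using M0 by simp
        have "(M + K) ^ j = M ^ j * (1 + K / M) ^ j"
          using Mp by (simp add: field_simps flip: power_mult_distrib)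
        also have "\<dots> \<le> M ^ j * exp (K / M) ^ j"
          using Mp K by (intro mult_left_mono power_mono exp_ge_add_one_self) auto
        also have "exp (K / M) ^ j = exp (K * (real j / M))"
          by (simp add: exp_of_nat_mult[symmetric] mult.commute)
        also have "M ^ j * exp (K * (real j / M)) \<le> M ^ j * exp (K * b)"
          using Mp K j by (intro mult_left_mono) (auto simp: M_def field_simps intro!: mult_left_mono)
        finally show ?thesis .
      qed
    qed auto
    also have "\<dots> = exp (K * b + K + C) * main_size f x E j"
      by (simp add: main_size_def M_def M'_def exp_add)
    finally show ?thesis by (simp add: \<phi>_def P_def)
  qed
  then show ?thesis by (intro exI[of _ "exp (K * b + K + C)"]) auto
qed

lemma pfprod_rankin_term:
  assumes adm: "admissible A B b \<theta> f E w" and m: "m > 0"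
  shows "pfprod (rankin_term f v \<delta> \<eta>) m = f m * prime_weight v m / real m *
    (\<Prod>p\<in>prime_factors m. if multiplicity p m = 1 then real p powr \<eta> else real (p ^ multiplicity p m) powr (2 * \<delta>))"
proof -
  have fm: "f m = (\<Prod>p\<in>prime_factors m. f (p ^ multiplicity p m))"
    using adm m unfolding admissible_def by (intro multiplicative_prime_powers) auto
  have "real m = real (\<Prod>p\<in>prime_factors m. p ^ multiplicity p m)" using prime_factorization_nat[OF m] by simp
  then have rm: "real m = (\<Prod>p\<in>prime_factors m. real (p ^ multiplicity p m))" by simp
  show ?thesis
    unfolding pfprod_def rankin_term_def prime_weight_def
    by (subst fm, subst rm) (simp only: prod.distrib prod_dividef)
qed

text \<open>Two ways to exploit the weight. As \<open>\<eta> \<le> 2 * \<delta>\<close>, it is at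
  least the \<open>\<eta>\<close>-th power of every exact prime power of \<open>m\<close>, which
  multiplies up to \<open>m powr \<eta>\<close>. Or one proper prime power keeps its own weight
  while the others are dropped, being at least 1.\<close>

lemma pfprod_rankin_term_ge:
  assumes adm: "admissible A B b \<theta> f E w" and m: "m > 0" and \<eta>: "0 \<le> \<eta>" "\<eta> \<le> 2 * \<delta>"
  shows "f m * prime_weight v m / real m * real m powr \<eta> \<le> pfprod (rankin_term f v \<delta> \<eta>) m"
    and "prime p \<Longrightarrow> multiplicity p m \<ge> 2 \<Longrightarrow>
      f m / real m * real (p ^ multiplicity p m) powr (2 * \<delta>) \<le> pfprod (rankin_term f v \<delta> \<eta>) m"
proof -
  define s where "s p = (if multiplicity p m = 1 then real p powr \<eta> else real (p ^ multiplicity p m) powr (2 * \<delta>))" for p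
  have eq: "pfprod (rankin_term f v \<delta> \<eta>) m = f m * prime_weight v m / real m * (\<Prod>p\<in>prime_factors m. s p)"
    unfolding s_def using adm m by (rule pfprod_rankin_term)
  have f0: "f m \<ge> 0" using adm m by (simp add: admissible_def)
  have base: "f m * prime_weight v m / real m \<ge> f m / real m"
    using f0 mult_left_mono[OF prime_weight_ge_1[of v m] f0] by (intro divide_right_mono) auto
  have ge1: "real p \<ge> 1" "real (p ^ multiplicity p m) \<ge> 1" if "p \<in> prime_factors m" for p
    using that in_prime_factors_imp_prime[OF that] prime_ge_1_nat[of p] by (auto intro!: one_le_power)
  have s1: "s p \<ge> real (p ^ multiplicity p m) powr \<eta>" if "p \<in> prime_factors m" for p
    using ge1[OF that] \<eta> unfolding s_def by (auto intro!: powr_mono)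
  have s2: "s p \<ge> 1" if "p \<in> prime_factors m" for p
    using ge1[OF that] \<eta> by (auto simp: s_def intro!: ge_one_powr_ge_zero)
  have "real m = real (\<Prod>p\<in>prime_factors m. p ^ multiplicity p m)" using prime_factorization_nat[OF m] by simp
  then have "real m powr \<eta> = (\<Prod>p\<in>prime_factors m. real (p ^ multiplicity p m)) powr \<eta>" by simp
  also have "\<dots> = (\<Prod>p\<in>prime_factors m. real (p ^ multiplicity p m) powr \<eta>)"
    by (rule prod_powr_distrib)
  also have "\<dots> \<le> (\<Prod>p\<in>prime_factors m. s p)" using s1 by (intro prod_mono) auto
  finally have "real m powr \<eta> \<le> (\<Prod>p\<in>prime_factors m. s p)" .
  then show "f m * prime_weight v m / real m * real m powr \<eta> \<le> pfprod (rankin_term f v \<delta> \<eta>) m"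
    unfolding eq using f0 prime_weight_ge_1[of v m] by (intro mult_left_mono) auto
  assume p: "prime p" "multiplicity p m \<ge> 2"
  then have pm: "p \<in> prime_factors m" by (simp add: prime_factors_multiplicity)
  have "real (p ^ multiplicity p m) powr (2 * \<delta>) = s p" using p by (simp add: s_def)
  also have "\<dots> \<le> s p * (\<Prod>q\<in>prime_factors m - {p}. s q)"
  proof -
    have "(\<Prod>q\<in>prime_factors m - {p}. s q) \<ge> 1" using s2 by (intro prod_ge_1) auto
    then show ?thesis using s2[OF pm] mult_left_mono[of 1 "\<Prod>q\<in>prime_factors m - {p}. s q" "s p"] by simp
  qed
  also have "\<dots> = (\<Prod>q\<in>prime_factors m. s q)" using pm by (intro prod.remove[symmetric]) auto
  finally show "f m / real m * real (p ^ multiplicity p m) powr (2 * \<delta>) \<le> pfprod (rankin_term f v \<delta> \<eta>) m"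
    unfolding eq using base f0 by (intro mult_mono order_trans[OF _ base]) auto
qed

section \<open>Splitting off the largest prime factor\<close>

lemma ex_power_of_two_ivl:
  fixes t :: real assumes "t \<ge> 1"
  shows "\<exists>i. 2 ^ i \<le> t \<and> t < 2 ^ Suc i"
proof -
  define i where "i = nat \<lfloor>log 2 t\<rfloor>"
  have "log 2 t \<ge> 0" using assms by simp
  then have i: "real i \<le> log 2 t" "log 2 t < real (Suc i)" by (auto simp: i_def) linarith
  have "2 powr real i \<le> t" using i(1) assms by (simp add: le_log_iff)
  moreover have "t < 2 powr real (Suc i)" using i(2) assms by (simp only: log_less_iff)
  ultimately show ?thesis by (intro exI[of _ i]) (simp only: powr_realpow zero_less_numeral)
qed

lemma power_le_fact_mult_exp:
  fixes y :: real assumes "y \<ge> 0"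
  shows "y ^ k \<le> fact k * exp y"
proof -
  have "(\<Sum>n\<in>{k}. y ^ n / fact n) \<le> (\<Sum>n. y ^ n / fact n)"
    using assms summable_exp[of y] by (intro sum_le_suminf) (auto simp: field_simps)
  also have "\<dots> = exp y" by (simp add: exp_def scaleR_conv_of_real field_simps)
  finally show ?thesis by (simp add: field_simps)
qed

text \<open>If \<open>2 * D < 2^k\<close>, then
  \<open>(2 * D)^i \<le> (2^i)^k \<le> k! * exp (2^i)\<close>, so the terms decay like
  \<open>2^(- i)\<close>. This adds up loss against gain over the scales of
  \<open>sum_cofactors_le\<close>.\<close>

lemma sum_power_mult_exp_two_power_le:
  fixes D :: real assumes "D > 0"
  shows "\<exists>C>0. \<forall>I. finite I \<longrightarrow> (\<Sum>i\<in>I. D ^ Suc i * exp (1 - 2 ^ i)) \<le> C"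
proof -
  obtain k where k: "2 * D < 2 ^ k" using real_arch_pow[of 2 "2 * D"] by auto
  define c where "c = D * exp 1 * fact k"
  have c: "c > 0" using assms by (simp add: c_def)
  have "(\<Sum>i\<in>I. D ^ Suc i * exp (1 - 2 ^ i)) \<le> c * 2" if "finite I" for I :: "nat set"
  proof -
    have "(\<Sum>i\<in>I. D ^ Suc i * exp (1 - 2 ^ i)) \<le> (\<Sum>i\<in>I. c * (1 / 2) ^ i)"
    proof (rule sum_mono)
      fix i
      have "(2 * D) ^ i \<le> (2 ^ k) ^ i" using k assms by (intro power_mono) auto
      also have "\<dots> = (2 ^ i) ^ k" by (simp add: mult.commute flip: power_mult)
      also have "\<dots> \<le> fact k * exp (2 ^ i)" by (intro power_le_fact_mult_exp) simp
      finally have "D ^ i \<le> fact k * exp (2 ^ i) * (1 / 2) ^ i" by (simp add: power_mult_distrib field_simps)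
      then have "D * exp 1 * exp (- (2 ^ i)) * D ^ i \<le> D * exp 1 * exp (- (2 ^ i)) * (fact k * exp (2 ^ i) * (1 / 2) ^ i)"
        using assms by (intro mult_left_mono) auto
      also have "\<dots> = c * (1 / 2) ^ i * (exp (- (2 ^ i)) * exp (2 ^ i))" by (simp add: c_def)
      also have "\<dots> = c * (1 / 2) ^ i" by (simp flip: exp_add)
      finally show "D ^ Suc i * exp (1 - 2 ^ i) \<le> c * (1 / 2) ^ i" by (simp add: exp_diff exp_minus field_simps)
    qed
    also have "\<dots> = c * (\<Sum>i\<in>I. (1 / 2) ^ i)" by (rule sum_distrib_left[symmetric])
    also have "\<dots> \<le> c * (\<Sum>i. (1 / 2) ^ i)"
      using that c by (intro mult_left_mono sum_le_suminf) (auto intro: summable_geometric)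
    also have "\<dots> = c * 2" by (simp add: suminf_geometric)
    finally show ?thesis .
  qed
  then show ?thesis using c by (intro exI[of _ "c * 2"]) auto
qed

text \<open>Made for \<open>m = n / p\<close> with \<open>p\<close> the largest prime factor of
  \<open>n \<le> x\<close>: \<open>p\<close> above \<open>exp (sqrt (ln x))\<close> gives
  \<open>ln (x / m) \<ge> sqrt (ln x)\<close>, and no prime factor of \<open>m\<close> exceeds
  \<open>p \<le> x / m\<close>.\<close>

definition cofactors :: "real \<Rightarrow> nat set" where
  "cofactors x = {m. m \<ge> 1 \<and> real m * exp (sqrt (ln x)) \<le> x \<and> (\<forall>q\<in>prime_factors m. real q \<le> x / real m)}"

lemma finite_cofactors: "x > 1 \<Longrightarrow> finite (cofactors x)"
proof (rule finite_subset[OF _ finite_nat_real_le[of "\<lambda>_. True" x]], rule subsetI)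
  fix m assume "x > 1" "m \<in> cofactors x"
  then have "real m * exp (sqrt (ln x)) \<le> x" "1 \<le> exp (sqrt (ln x))" by (auto simp: cofactors_def)
  moreover have "real m * 1 \<le> real m * exp (sqrt (ln x))" using calculation by (intro mult_left_mono) auto
  ultimately show "m \<in> {n. True \<and> real n \<le> x}" by simp
qed

text \<open>Each squaring between \<open>X\<close> and \<open>x\<close> adds at most
  \<open>4 * v\<close> to the sum of \<open>\<nu> p / p\<close>.\<close>

lemma exp_msum_residues_le:
  assumes R: "valid_residues v R \<nu>" and X: "X > 1" "x \<le> X ^ (2 ^ i)"
  shows "exp (- msum (\<lambda>p. real (\<nu> p)) X Primes) \<le> exp (4 * real v) ^ i * exp (- msum (\<lambda>p. real (\<nu> p)) x Primes)"
proof -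
  have "msum (\<lambda>p. real (\<nu> p)) x Primes = (\<Sum>p\<in>primes_le x. real (\<nu> p) / real p)" by (simp add: msum_def)
  also have "\<dots> \<le> (\<Sum>p\<in>primes_le X \<union> primes_between X x. real (\<nu> p) / real p)"
    by (intro sum_mono2) auto
  also have "\<dots> \<le> (\<Sum>p\<in>primes_le X. real (\<nu> p) / real p) + (\<Sum>p\<in>primes_between X x. real (\<nu> p) / real p)"
    by (subst sum.union_inter[symmetric]) (auto intro!: sum_nonneg)
  also have "(\<Sum>p\<in>primes_between X x. real (\<nu> p) / real p) \<le> (\<Sum>p\<in>primes_between X x. real v * (1 / real p))"
    using R by (intro sum_mono) (auto simp: valid_residues_def intro!: divide_right_mono)
  also have "\<dots> = real v * (\<Sum>p\<in>primes_between X x. 1 / real p)" by (rule sum_distrib_left[symmetric])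
  also have "\<dots> \<le> real v * (4 * real i)"
    using X by (intro mult_left_mono sum_inverse_primes_between) auto
  finally have "msum (\<lambda>p. real (\<nu> p)) x Primes \<le> msum (\<lambda>p. real (\<nu> p)) X Primes + real v * (4 * real i)"
    by (simp add: msum_def)
  then have "exp (- msum (\<lambda>p. real (\<nu> p)) X Primes) \<le> exp (real i * (4 * real v) + - msum (\<lambda>p. real (\<nu> p)) x Primes)"
    by (simp add: mult_ac)
  then show ?thesis by (simp only: exp_add exp_of_nat_mult)
qed

text \<open>The primes \<open>p\<close> with \<open>m p\<close> sifted number about \<open>X / log X\<close>, \<open>X = x / m\<close>, which may exceed the
  expected \<open>X / log x\<close> by a factor \<open>2^i\<close>. But then \<open>m\<close> is a large number all of whose prime factors
  are at most \<open>x^(1/2^i)\<close>, and Rankin's trick saves a factor \<open>exp (2^i)\<close>.\<close>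

lemma sum_cofactors_le:
  fixes A B b \<theta> :: real and v :: nat
  assumes A: "A > 0" and B: "B > 0" and b: "b \<ge> 1" and \<theta>: "0 \<le> \<theta>" "\<theta> < 1"
  shows "\<exists>C>0. \<forall>f E w R \<nu> x j. admissible A B b \<theta> f E w \<and> valid_residues v R \<nu> \<and> x \<ge> 2 \<and>
      1 \<le> 2 * ((1 - \<theta>) / 16) * sqrt (ln x) \<and> real j \<le> b * msum f x E \<longrightarrow>
    (\<Sum>m | m \<in> cofactors x \<and> wcount w m E = j. f m * real (card {p. prime p \<and> m * p \<in> sifted x R})) \<le>
      C * (x / ln x * exp (- msum (\<lambda>p. real (\<nu> p)) x Primes)) * main_size f x E j"
proof -
  define \<delta> where "\<delta> = (1 - \<theta>) / 16"
  have \<delta>: "\<delta> > 0" "\<delta> \<le> 1 / 16" using \<theta> by (auto simp: \<delta>_def)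
  obtain C1 where C1: "C1 > 0" and C1_all: "\<forall>x m R \<nu>. valid_residues v R \<nu> \<and> m > 0 \<and> x / real m \<ge> 2 \<longrightarrow>
     real (card {p. prime p \<and> m * p \<in> sifted x R}) \<le>
     C1 * (x / real m) / ln (x / real m) * exp (- msum (\<lambda>p. real (\<nu> p)) (x / real m) Primes) * prime_weight v m"
    using card_sifted_primes_le[of v] by (elim exE conjE) (rule that)
  obtain C2 where C2: "C2 > 0" and C2_all: "\<forall>f E w x y \<eta> N j. admissible A B b \<theta> f E w \<and> y \<ge> 1 \<and> y \<le> x \<and> \<eta> \<ge> 0 \<and> \<eta> * ln y \<le> 1 \<and> N \<ge> 1 \<and>
      real j \<le> b * msum f x E \<longrightarrow>
    (\<Sum>m | m \<in> smooth_upto N (primes_le y) \<and> wcount w m E = j. pfprod (rankin_term f v ((1 - \<theta>) / 16) \<eta>) m)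
      \<le> C2 * main_size f x E j"
    using rankin_sum_le[OF assms, of v] by (elim exE conjE) (rule that)
  \<comment> \<open>The loss per halving of \<open>ln X\<close>: 2 from \<open>1 / ln X\<close>,
    \<open>exp (4 * v)\<close> from the sum of \<open>\<nu> p / p\<close>.\<close>
  define D where "D = 2 * exp (4 * real v)"
  have D: "D > 0" by (simp add: D_def)
  obtain C3 where C3: "C3 > 0" "\<And>I. finite I \<Longrightarrow> (\<Sum>i\<in>I. D ^ Suc i * exp (1 - 2 ^ i)) \<le> C3"
    using sum_power_mult_exp_two_power_le[OF D] by auto
  have "(\<Sum>m | m \<in> cofactors x \<and> wcount w m E = j. f m * real (card {p. prime p \<and> m * p \<in> sifted x R})) \<le>
      C1 * C3 * C2 * (x / ln x * exp (- msum (\<lambda>p. real (\<nu> p)) x Primes)) * main_size f x E j"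
    if adm: "admissible A B b \<theta> f E w" and R: "valid_residues v R \<nu>" and x: "x \<ge> 2"
      and x1: "1 \<le> 2 * \<delta> * sqrt (ln x)" and j: "real j \<le> b * msum f x E" for f E w R \<nu> x j
  proof -
    define L where "L = ln x"
    have L0: "L > 0" using x by (simp add: L_def)
    have "2 * \<delta> * sqrt L \<le> 1 / 8 * sqrt L" using \<delta> L0 by (intro mult_right_mono) auto
    then have sL: "sqrt L \<ge> 8" using x1 by (simp add: L_def)
    have LL: "sqrt L * sqrt L = L" using L0 by simp
    define G where "G = x / L * exp (- msum (\<lambda>p. real (\<nu> p)) x Primes)"
    have G0: "G \<ge> 0" using x L0 by (simp add: G_def)
    define N where "N = nat \<lfloor>x\<rfloor>"
    have N: "N \<ge> 1" using x by (simp add: N_def le_nat_floor)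
    \<comment> \<open>On scale \<open>i\<close>, \<open>ln X\<close> lies between
      \<open>L / 2^(i + 1)\<close> and \<open>L / 2^i\<close>, so \<open>m\<close> has no prime
      factor above \<open>y i\<close>, which is \<open>x\<close> to the power
      \<open>1 / 2^i\<close>; \<open>\<eta> i = 1 / ln (y i)\<close> is the largest exponent that
      \<open>rankin_sum_le\<close> admits.\<close>
    define y where "y i = exp (L / 2 ^ i)" for i :: nat
    define \<eta> where "\<eta> i = 2 ^ i / L" for i :: nat
    \<comment> \<open>\<open>ln X \<ge> sqrt L\<close> on \<open>cofactors x\<close>, so all scales
      that occur lie in \<open>I\<close>, and
      \<open>\<eta> i \<le> 1 / sqrt L \<le> 2 * \<delta>\<close> there.\<close>
    define I where "I = {i::nat. 2 ^ i \<le> sqrt L}"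
    have finI: "finite I"
    proof (rule finite_subset)
      show "I \<subseteq> {i. True \<and> real i \<le> sqrt L}"
      proof
        fix i assume "i \<in> I"
        then have "2 ^ i \<le> sqrt L" by (simp add: I_def)
        moreover have "real i < 2 ^ i" by (rule of_nat_less_two_power)
        ultimately have "real i \<le> sqrt L" by linarith
        then show "i \<in> {i. True \<and> real i \<le> sqrt L}" by simp
      qed
    qed (rule finite_nat_real_le)
    define S where "S i = smooth_upto N (primes_le (y i))" for i
    define F where "F i m = pfprod (rankin_term f v \<delta> (\<eta> i)) m" for i m
    have F0: "F i m \<ge> 0" for i m unfolding F_def by (intro pfprod_nonneg rankin_term_nonneg[OF adm])
    define c where "c i = D ^ Suc i * exp (1 - 2 ^ i)" for i :: nat
    have c0: "c i \<ge> 0" for i using D by (simp add: c_def)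
    \<comment> \<open>The scale depends on \<open>m\<close>. Majorising by the nonnegative
      contributions of all scales makes it possible to exchange the sums over \<open>m\<close> and
      \<open>i\<close>.\<close>
    have pointwise: "f m * real (card {p. prime p \<and> m * p \<in> sifted x R}) \<le> C1 * G * (\<Sum>i\<in>I. c i * (if m \<in> S i then F i m else 0))"
      if m: "m \<in> cofactors x" for m
    proof -
      have m1: "m \<ge> 1" "real m * exp (sqrt L) \<le> x" "\<And>q. q \<in> prime_factors m \<Longrightarrow> real q \<le> x / real m"
        using m by (auto simp: cofactors_def L_def)
      define X where "X = x / real m"
      have Xge: "X \<ge> exp (sqrt L)" using m1 by (simp add: X_def field_simps)
      have "exp (sqrt L) \<ge> 1 + sqrt L" by (rule exp_ge_add_one_self)
      then have X2: "X \<ge> 2" using Xge sL by linarith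
      have Xx: "X \<le> x" using m1 x by (simp add: X_def divide_le_eq mult_left_le_one_le mult_le_cancel_left1)
      have "real m * 1 \<le> real m * exp (sqrt L)" using L0 by (intro mult_left_mono) auto
      then have mx: "real m \<le> x" using m1(2) by linarith
      have lX: "ln X \<ge> sqrt L" using Xge X2 by (simp add: ln_ge_iff)
      have lX0: "ln X > 0" using X2 by simp
      have lXL: "ln X \<le> L" unfolding L_def using Xx X2 by simp
      obtain i where i: "2 ^ i \<le> L / ln X" "L / ln X < 2 ^ Suc i"
        using ex_power_of_two_ivl[of "L / ln X"] lXL lX0 by auto
      have i1: "2 ^ i * ln X \<le> L" and i2: "L \<le> 2 ^ Suc i * ln X"
        using i lX0 by (simp_all add: field_simps)
      have "L / ln X \<le> L / sqrt L" using lX lX0 L0 sL by (intro divide_left_mono) auto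
      also have "\<dots> = sqrt L" using L0 by (simp add: real_div_sqrt)
      finally have iI: "i \<in> I" using i(1) by (simp add: I_def)
      have lnm: "ln (real m) = L - ln X" using m1 x by (simp add: X_def L_def ln_div)
      have \<eta>0: "\<eta> i \<ge> 0" using L0 by (simp add: \<eta>_def)
      have \<eta>1: "\<eta> i \<le> 2 * \<delta>"
      proof -
        have "\<eta> i \<le> sqrt L / L" using iI L0 by (simp add: \<eta>_def I_def divide_right_mono)
        also have "\<dots> = 1 / sqrt L" using LL L0 by (simp add: field_simps)
        also have "\<dots> \<le> 2 * \<delta>"
        proof -
          have "sqrt L > 0" using sL by linarith
          then show ?thesis using x1 by (simp only: pos_divide_le_eq L_def)
        qed
        finally show ?thesis .
      qed
      have "X \<le> y i"
      proof -
        have "ln X \<le> L / 2 ^ i" using i1 by (simp add: field_simps)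
        then have "exp (ln X) \<le> y i" unfolding y_def by simp
        then show ?thesis using X2 by simp
      qed
      then have mS: "m \<in> S i"
        using m1 Xx unfolding S_def smooth_upto_def N_def
        by (auto simp: X_def in_prime_factors_imp_prime le_nat_floor[OF mx] intro: order_trans)
      have "x \<le> X ^ (2 ^ Suc i)"
      proof -
        have "exp L \<le> exp (real (2 ^ Suc i) * ln X)" using i2 by simp
        then show ?thesis using x X2 by (simp only: exp_of_nat_mult) (simp add: L_def)
      qed
      then have e1: "exp (- msum (\<lambda>p. real (\<nu> p)) X Primes) \<le> exp (4 * real v) ^ Suc i * exp (- msum (\<lambda>p. real (\<nu> p)) x Primes)"
        using X2 by (intro exp_msum_residues_le[OF R]) auto
      have e2: "1 / ln X \<le> 2 ^ Suc i / L" using i2 lX0 L0 by (simp add: field_simps)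
      have "real (card {p. prime p \<and> m * p \<in> sifted x R}) \<le>
         C1 * X / ln X * exp (- msum (\<lambda>p. real (\<nu> p)) X Primes) * prime_weight v m"
        unfolding X_def using R m1 X2 by (intro C1_all[rule_format]) (auto simp: X_def)
      also have "\<dots> = C1 * X * prime_weight v m * (1 / ln X * exp (- msum (\<lambda>p. real (\<nu> p)) X Primes))"
        by simp
      also have "\<dots> \<le> C1 * X * prime_weight v m * (2 ^ Suc i / L * (exp (4 * real v) ^ Suc i * exp (- msum (\<lambda>p. real (\<nu> p)) x Primes)))"
        using e1 e2 C1 X2 L0 prime_weight_ge_1[of v m] by (intro mult_left_mono mult_mono) auto
      also have "\<dots> = C1 * G * D ^ Suc i * (prime_weight v m / real m)"
        by (simp add: G_def D_def X_def power_mult_distrib mult_ac)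
      finally have "f m * real (card {p. prime p \<and> m * p \<in> sifted x R}) \<le> f m * (C1 * G * D ^ Suc i * (prime_weight v m / real m))"
        using adm m1 by (intro mult_left_mono) (auto simp: admissible_def)
      also have "\<dots> = C1 * G * D ^ Suc i * (f m * prime_weight v m / real m)" by simp
      also have "\<dots> \<le> C1 * G * D ^ Suc i * (exp (1 - 2 ^ i) * F i m)"
      proof (intro mult_left_mono)
        \<comment> \<open>Rankin's gain: \<open>ln m = L - ln X\<close> and
          \<open>2^i * ln X \<le> L\<close> give
          \<open>m powr \<eta> i \<ge> exp (2^i - 1)\<close>.\<close>
        have "\<eta> i * ln (real m) = 2 ^ i - 2 ^ i * ln X / L" using L0 by (simp add: lnm \<eta>_def field_simps)
        also have "\<dots> \<ge> 2 ^ i - 1" using i1 L0 by (simp add: field_simps)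
        finally have "exp (2 ^ i - 1) \<le> real m powr \<eta> i" using m1 by (simp add: powr_def)
        then have "1 \<le> exp (1 - 2 ^ i) * real m powr \<eta> i" by (simp add: exp_diff field_simps)
        moreover have fpw: "f m * prime_weight v m / real m \<ge> 0"
          using adm m1 prime_weight_ge_1[of v m] by (auto simp: admissible_def)
        ultimately have "f m * prime_weight v m / real m * 1 \<le> f m * prime_weight v m / real m * (exp (1 - 2 ^ i) * real m powr \<eta> i)"
          by (intro mult_left_mono) auto
        also have "\<dots> = exp (1 - 2 ^ i) * (f m * prime_weight v m / real m * real m powr \<eta> i)" by simp
        also have "\<dots> \<le> exp (1 - 2 ^ i) * F i m"
          unfolding F_def using m1 \<eta>0 \<eta>1 by (intro mult_left_mono pfprod_rankin_term_ge(1)[OF adm]) auto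
        finally show "f m * prime_weight v m / real m \<le> exp (1 - 2 ^ i) * F i m" by simp
      qed (use C1 G0 D in auto)
      also have "\<dots> = C1 * G * (c i * (if m \<in> S i then F i m else 0))" using mS by (simp add: c_def)
      also have "\<dots> \<le> C1 * G * (\<Sum>i\<in>I. c i * (if m \<in> S i then F i m else 0))"
        using iI finI c0 F0 C1 G0 by (intro mult_left_mono member_le_sum) auto
      finally show ?thesis .
    qed
    define Mj where "Mj = {m. m \<in> cofactors x \<and> wcount w m E = j}"
    have finMj: "finite Mj" using finite_cofactors[of x] x by (auto simp: Mj_def intro: finite_subset)
    have "(\<Sum>m\<in>Mj. f m * real (card {p. prime p \<and> m * p \<in> sifted x R})) \<le>
       (\<Sum>m\<in>Mj. C1 * G * (\<Sum>i\<in>I. c i * (if m \<in> S i then F i m else 0)))"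
      using pointwise by (intro sum_mono) (auto simp: Mj_def)
    also have "\<dots> = C1 * G * (\<Sum>i\<in>I. c i * (\<Sum>m\<in>Mj. if m \<in> S i then F i m else 0))"
      by (simp only: sum_distrib_left[symmetric] sum.swap[of _ I])
    also have "\<dots> \<le> C1 * G * (\<Sum>i\<in>I. c i * (C2 * main_size f x E j))"
    proof (intro mult_left_mono sum_mono)
      fix i assume i: "i \<in> I"
      have "(\<Sum>m\<in>Mj. if m \<in> S i then F i m else 0) = (\<Sum>m\<in>Mj \<inter> S i. F i m)"
        using finMj by (simp add: sum.inter_restrict)
      also have "\<dots> \<le> (\<Sum>m | m \<in> S i \<and> wcount w m E = j. F i m)"
        using F0 by (intro sum_mono2) (auto simp: Mj_def S_def)
      also have "\<dots> \<le> C2 * main_size f x E j"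
        unfolding S_def F_def \<delta>_def
      proof (intro C2_all[rule_format] conjI)
        show "1 \<le> y i" using L0 by (simp add: y_def)
        have "L / 2 ^ i \<le> L / 1" using L0 by (intro divide_left_mono) auto
        then have "y i \<le> exp L" unfolding y_def by simp
        then show "y i \<le> x" using x by (simp add: L_def)
        show "0 \<le> \<eta> i" using L0 by (simp add: \<eta>_def)
        show "\<eta> i * ln (y i) \<le> 1" using L0 by (simp add: \<eta>_def y_def)
      qed (use adm N j in auto)
      finally show "(\<Sum>m\<in>Mj. if m \<in> S i then F i m else 0) \<le> C2 * main_size f x E j" .
    qed (use C1 G0 c0 in auto)
    also have "\<dots> = C1 * G * ((\<Sum>i\<in>I. c i) * (C2 * main_size f x E j))" by (simp only: sum_distrib_right)
    also have "\<dots> \<le> C1 * G * (C3 * (C2 * main_size f x E j))"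
    proof (intro mult_left_mono mult_right_mono)
      show "(\<Sum>i\<in>I. c i) \<le> C3" unfolding c_def using finI by (rule C3(2))
      have "msum f x E \<ge> 0"
        unfolding msum_def using adm admissible_prime_power_nonneg[OF adm, of _ 1]
        by (intro sum_nonneg) (auto simp: admissible_def)
      then show "0 \<le> C2 * main_size f x E j" using C2 by (simp add: main_size_def)
    qed (use C1 G0 in auto)
    finally show ?thesis by (simp add: Mj_def G_def L_def mult_ac)
  qed
  then show ?thesis using C1 C2 C3(1) unfolding \<delta>_def by (intro exI[of _ "C1 * C3 * C2"]) auto
qed

section \<open>The trivial bound and the exceptional integers\<close>

lemma msum_nonneg: "admissible A B b \<theta> f E w \<Longrightarrow> Q \<subseteq> Primes \<Longrightarrow> msum f x Q \<ge> 0"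
  unfolding msum_def using admissible_prime_power_nonneg[of A B b \<theta> f E w _ 1] by (intro sum_nonneg) auto

lemma main_size_nonneg: "admissible A B b \<theta> f E w \<Longrightarrow> main_size f x E j \<ge> 0"
  using msum_nonneg[of A B b \<theta> f E w E x] by (simp add: main_size_def admissible_def)

text \<open>The first alternative allows the second to be treated for \<open>n > sqrt x\<close>,
  where Rankin's trick has an effect. The third makes the largest prime factor divide any other
  \<open>n\<close> exactly once.\<close>

definition exceptional :: "real \<Rightarrow> nat \<Rightarrow> bool" where
  "exceptional x n \<longleftrightarrow> real n \<le> sqrt x \<or> (\<forall>q\<in>prime_factors n. real q \<le> exp (sqrt (ln x))) \<or>
     (\<exists>q. prime q \<and> multiplicity q n \<ge> 2 \<and> real (q ^ multiplicity q n) > exp (sqrt (ln x)))"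

text \<open>\<open>f(n) \<le> x * f(n) / n\<close> and a Rankin sum with exponent 0. It serves for
  bounded \<open>x\<close>, where \<open>1 / sqrt (ln x)\<close> exceeds
  \<open>2 * \<delta>\<close>.\<close>

lemma sum_upto_le:
  fixes A B b \<theta> :: real
  assumes "A > 0" "B > 0" "b \<ge> 1" "0 \<le> \<theta>" "\<theta> < 1"
  shows "\<exists>C>0. \<forall>f E w x k. admissible A B b \<theta> f E w \<and> x \<ge> 2 \<and> real k \<le> b * msum f x E \<longrightarrow>
    (\<Sum>n | n \<ge> 1 \<and> real n \<le> x \<and> wcount w n E = k. f n) \<le> C * x * main_size f x E k"
proof -
  define \<delta> where "\<delta> = (1 - \<theta>) / 16"
  have \<delta>: "\<delta> > 0" using assms by (simp add: \<delta>_def)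
  obtain C where C: "C > 0" and C_all: "\<forall>f E w x y \<eta> N j. admissible A B b \<theta> f E w \<and> y \<ge> 1 \<and> y \<le> x \<and> \<eta> \<ge> 0 \<and> \<eta> * ln y \<le> 1 \<and> N \<ge> 1 \<and>
      real j \<le> b * msum f x E \<longrightarrow>
    (\<Sum>m | m \<in> smooth_upto N (primes_le y) \<and> wcount w m E = j. pfprod (rankin_term f 0 ((1 - \<theta>) / 16) \<eta>) m)
      \<le> C * main_size f x E j"
    using rankin_sum_le[OF assms, of 0] by (elim exE conjE) (rule that)
  have "(\<Sum>n | n \<ge> 1 \<and> real n \<le> x \<and> wcount w n E = k. f n) \<le> C * x * main_size f x E k"
    if adm: "admissible A B b \<theta> f E w" and x: "x \<ge> 2" and k: "real k \<le> b * msum f x E" for f E w x k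
  proof -
    define N where "N = nat \<lfloor>x\<rfloor>"
    have N: "N \<ge> 1" "real N \<le> x" using x by (auto simp: N_def le_nat_floor)
    have leN: "n \<le> N \<longleftrightarrow> real n \<le> x" for n using x by (simp add: N_def le_nat_iff le_floor_iff)
    have eq: "{n. n \<ge> 1 \<and> real n \<le> x \<and> wcount w n E = k} = {m. m \<in> smooth_upto N (primes_le x) \<and> wcount w m E = k}"
      unfolding smooth_upto_all[OF N(2)] by (auto simp: leN)
    have "(\<Sum>n | n \<ge> 1 \<and> real n \<le> x \<and> wcount w n E = k. f n) \<le>
       (\<Sum>n | n \<ge> 1 \<and> real n \<le> x \<and> wcount w n E = k. x * pfprod (rankin_term f 0 \<delta> 0) n)"
    proof (rule sum_mono)
      fix n assume n: "n \<in> {n. n \<ge> 1 \<and> real n \<le> x \<and> wcount w n E = k}"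
      have f0: "f n \<ge> 0" using adm n by (simp add: admissible_def)
      have "f n * prime_weight 0 n / real n * real n powr 0 \<le> pfprod (rankin_term f 0 \<delta> 0) n"
        using n \<delta> by (intro pfprod_rankin_term_ge(1)[OF adm]) auto
      then have le: "f n / real n \<le> pfprod (rankin_term f 0 \<delta> 0) n" using n by (simp add: prime_weight_def)
      have "f n = real n * (f n / real n)" using n by simp
      also have "\<dots> \<le> x * pfprod (rankin_term f 0 \<delta> 0) n" using n f0 le by (intro mult_mono) auto
      finally show "f n \<le> x * pfprod (rankin_term f 0 \<delta> 0) n" .
    qed
    also have "\<dots> = x * (\<Sum>m | m \<in> smooth_upto N (primes_le x) \<and> wcount w m E = k. pfprod (rankin_term f 0 \<delta> 0) m)"
      unfolding eq by (rule sum_distrib_left[symmetric])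
    also have "\<dots> \<le> x * (C * main_size f x E k)"
      unfolding \<delta>_def using x adm k N by (intro mult_left_mono C_all[rule_format]) auto
    finally show ?thesis by (simp add: mult_ac)
  qed
  then show ?thesis using C by (intro exI[of _ C]) auto
qed

text \<open>Starting from \<open>f(n) \<le> x * f(n) / n\<close>, every alternative gains a factor
  \<open>s = exp (- 2 * \<delta> * sqrt L)\<close>. For \<open>n \<le> sqrt x\<close> even
  \<open>sqrt x\<close> is gained; a smooth \<open>n > sqrt x\<close> has
  \<open>n powr \<eta> \<ge> exp (sqrt L / 2)\<close> for \<open>\<eta> = 1 / sqrt L\<close>; a
  proper prime power above \<open>exp (sqrt L)\<close> carries the weight \<open>1 / s\<close> or
  more inside \<open>rankin_term\<close>.\<close>

lemma sum_exceptional_le: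
  fixes A B b \<theta> :: real
  assumes "A > 0" "B > 0" "b \<ge> 1" "0 \<le> \<theta>" "\<theta> < 1"
  shows "\<exists>C>0. \<forall>f E w x k. admissible A B b \<theta> f E w \<and> x \<ge> 2 \<and> 1 \<le> 2 * ((1 - \<theta>) / 16) * sqrt (ln x) \<and>
      real k \<le> b * msum f x E \<longrightarrow>
    (\<Sum>n | n \<ge> 1 \<and> real n \<le> x \<and> wcount w n E = k \<and> exceptional x n. f n) \<le>
      C * (x * exp (- (2 * ((1 - \<theta>) / 16) * sqrt (ln x)))) * main_size f x E k"
proof -
  define \<delta> where "\<delta> = (1 - \<theta>) / 16"
  have \<delta>: "\<delta> > 0" "\<delta> \<le> 1 / 16" using assms by (auto simp: \<delta>_def)
  obtain C where C: "C > 0" and C_all: "\<forall>f E w x y \<eta> N j. admissible A B b \<theta> f E w \<and> y \<ge> 1 \<and> y \<le> x \<and> \<eta> \<ge> 0 \<and> \<eta> * ln y \<le> 1 \<and> N \<ge> 1 \<and>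
      real j \<le> b * msum f x E \<longrightarrow>
    (\<Sum>m | m \<in> smooth_upto N (primes_le y) \<and> wcount w m E = j. pfprod (rankin_term f 0 ((1 - \<theta>) / 16) \<eta>) m)
      \<le> C * main_size f x E j"
    using rankin_sum_le[OF assms, of 0] by (elim exE conjE) (rule that)
  have "(\<Sum>n | n \<ge> 1 \<and> real n \<le> x \<and> wcount w n E = k \<and> exceptional x n. f n) \<le>
      2 * C * (x * exp (- (2 * \<delta> * sqrt (ln x)))) * main_size f x E k"
    if adm: "admissible A B b \<theta> f E w" and x: "x \<ge> 2" and x1: "1 \<le> 2 * \<delta> * sqrt (ln x)"
      and k: "real k \<le> b * msum f x E" for f E w x k
  proof -
    define L where "L = ln x"
    have L0: "L > 0" using x by (simp add: L_def)
    have "2 * \<delta> * sqrt L \<le> 1 / 8 * sqrt L" using \<delta> L0 by (intro mult_right_mono) auto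
    then have sL: "sqrt L \<ge> 8" using x1 by (simp add: L_def)
    have LL: "sqrt L * sqrt L = L" using L0 by simp
    have "8 * sqrt L \<le> sqrt L * sqrt L" using sL L0 by (intro mult_right_mono) auto
    then have L8: "8 * sqrt L \<le> L" using LL by simp
    have xL: "x = exp L" using x by (simp add: L_def)
    define s where "s = exp (- (2 * \<delta> * sqrt L))"
    define y where "y = exp (sqrt L)"
    define \<eta> where "\<eta> = 1 / sqrt L"
    have \<eta>: "\<eta> > 0" "\<eta> \<le> 2 * \<delta>" "\<eta> * sqrt L = 1"
    proof -
      have "sqrt L > 0" using sL by linarith
      then show "\<eta> > 0" "\<eta> * sqrt L = 1" by (auto simp: \<eta>_def)
      show "\<eta> \<le> 2 * \<delta>" unfolding \<eta>_def using x1 \<open>sqrt L > 0\<close> by (simp only: pos_divide_le_eq L_def)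
    qed
    define N where "N = nat \<lfloor>x\<rfloor>"
    have N: "N \<ge> 1" "real N \<le> x" using x by (auto simp: N_def le_nat_floor)
    have leN: "n \<le> N \<longleftrightarrow> real n \<le> x" for n using x by (simp add: N_def le_nat_iff le_floor_iff)
    define T where "T = {n. n \<ge> 1 \<and> real n \<le> x \<and> wcount w n E = k}"
    have T: "T = {m. m \<in> smooth_upto N (primes_le x) \<and> wcount w m E = k}"
      unfolding smooth_upto_all[OF N(2)] T_def by (auto simp: leN)
    have finT: "finite T" unfolding T by simp
    define F where "F \<eta> n = pfprod (rankin_term f 0 \<delta> \<eta>) n" for \<eta> n
    have F0: "F \<eta> n \<ge> 0" for \<eta> n unfolding F_def by (intro pfprod_nonneg rankin_term_nonneg[OF adm])
    define S where "S = smooth_upto N (primes_le y)"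
    have pointwise: "f n \<le> x * s * (F 0 n + (if n \<in> S then F \<eta> n else 0))" if n: "n \<in> T" "exceptional x n" for n
    proof -
      have n1: "n \<ge> 1" "real n \<le> x" using n by (auto simp: T_def)
      have f0: "f n \<ge> 0" using adm n1 by (simp add: admissible_def)
      have pw: "prime_weight 0 n = 1" by (simp add: prime_weight_def)
      have fF: "f n / real n \<le> F 0 n"
        using pfprod_rankin_term_ge(1)[OF adm, of n 0 \<delta> 0] n1 \<delta> by (simp add: F_def pw)
      have fx: "f n \<le> x * (f n / real n)"
      proof -
        have "real n * (f n / real n) \<le> x * (f n / real n)" using n1 f0 by (intro mult_right_mono) auto
        then show ?thesis using n1 by simp
      qed
      have s0: "s > 0" by (simp add: s_def)
      have scale: "a \<le> s * b" if "a * (1 / s) \<le> b" for a b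
        using mult_left_mono[OF that, of s] s0 by simp
      have ge1: "x * s * F 0 n \<le> x * s * (F 0 n + (if n \<in> S then F \<eta> n else 0))"
        using F0 x s0 by (intro mult_left_mono) auto
      from n(2) consider "real n \<le> sqrt x" | "sqrt x < real n" "\<forall>q\<in>prime_factors n. real q \<le> y"
        | q where "prime q" "multiplicity q n \<ge> 2" "real (q ^ multiplicity q n) > y"
        unfolding exceptional_def y_def L_def by fastforce
      then show ?thesis
      proof cases
        case 1
        have "f n = real n * (f n / real n)" using n1 by simp
        also have "\<dots> \<le> sqrt x * F 0 n" using 1 fF f0 F0 x by (intro mult_mono) auto
        also have "\<dots> \<le> x * s * F 0 n"
        proof (intro mult_right_mono F0)
          have "2 * \<delta> * sqrt L \<le> 1 / 8 * sqrt L" using \<delta> L0 by (intro mult_right_mono) auto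
          then have "L / 2 \<le> L - 2 * \<delta> * sqrt L" using L8 sL by linarith
          then have "exp (L / 2) \<le> exp L * s" by (simp add: s_def flip: exp_add)
          moreover have "sqrt x = exp (L / 2)" using x by (simp add: L_def ln_sqrt[symmetric])
          ultimately show "sqrt x \<le> x * s" using xL by simp
        qed
        finally show ?thesis using ge1 by linarith
      next
        case 2
        have nS: "n \<in> S"
          using n 2 T by (auto simp: S_def smooth_upto_def in_prime_factors_imp_prime)
        have "f n / real n * real n powr \<eta> \<le> F \<eta> n"
          using pfprod_rankin_term_ge(1)[OF adm, of n \<eta> \<delta> 0] n1 \<eta> by (simp add: F_def pw)
        moreover have "f n / real n * (1 / s) \<le> f n / real n * real n powr \<eta>"
        proof (intro mult_left_mono)
          have "L / 2 = ln (sqrt x)" using x by (simp add: L_def ln_sqrt)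
          also have "\<dots> \<le> ln (real n)" using 2 x n1 by simp
          finally have "\<eta> * (L / 2) \<le> \<eta> * ln (real n)" using \<eta> by (intro mult_left_mono) auto
          moreover have "\<eta> * (L / 2) = sqrt L / 2" using \<eta>(3) LL by (metis mult.assoc mult_1 times_divide_eq_right)
          moreover have "2 * \<delta> * sqrt L \<le> 1 / 8 * sqrt L" using \<delta> L0 by (intro mult_right_mono) auto
          ultimately have "2 * \<delta> * sqrt L \<le> \<eta> * ln (real n)" using sL by linarith
          then have "exp (2 * \<delta> * sqrt L) \<le> real n powr \<eta>" using n1 by (simp add: powr_def)
          then show "1 / s \<le> real n powr \<eta>" by (simp add: s_def exp_minus field_simps)
        qed (use f0 in auto)
        ultimately have "f n / real n * (1 / s) \<le> F \<eta> n" by linarith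
        then have "f n / real n \<le> s * F \<eta> n" by (rule scale)
        then have "f n \<le> x * (s * F \<eta> n)" using fx x mult_left_mono[of "f n / real n" "s * F \<eta> n" x] by linarith
        also have "\<dots> = x * s * F \<eta> n" by simp
        also have "\<dots> \<le> x * s * (F 0 n + (if n \<in> S then F \<eta> n else 0))"
          using nS F0 x s0 by (intro mult_left_mono) auto
        finally show ?thesis .
      next
        case 3
        have "y powr (2 * \<delta>) \<le> real (q ^ multiplicity q n) powr (2 * \<delta>)"
          using 3 \<delta> by (intro powr_mono2) (auto simp: y_def)
        moreover have "y powr (2 * \<delta>) = 1 / s" by (simp add: y_def s_def powr_def exp_minus field_simps)
        ultimately have "f n / real n * (1 / s) \<le> f n / real n * real (q ^ multiplicity q n) powr (2 * \<delta>)"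
          using f0 by (intro mult_left_mono) auto
        also have "\<dots> \<le> F 0 n"
          using pfprod_rankin_term_ge(2)[OF adm, of n 0 \<delta> q 0] n1 \<delta> 3 by (simp add: F_def)
        finally have "f n / real n \<le> s * F 0 n" by (rule scale)
        then have "f n \<le> x * (s * F 0 n)" using fx x mult_left_mono[of "f n / real n" "s * F 0 n" x] by linarith
        then show ?thesis using ge1 by (simp add: mult.assoc)
      qed
    qed
    have xs: "x * s \<ge> 0" using x by (simp add: s_def)
    have "(\<Sum>n | n \<ge> 1 \<and> real n \<le> x \<and> wcount w n E = k \<and> exceptional x n. f n) = (\<Sum>n\<in>{n\<in>T. exceptional x n}. f n)"
      by (intro sum.cong) (auto simp: T_def)
    also have "\<dots> \<le> (\<Sum>n\<in>{n\<in>T. exceptional x n}. x * s * (F 0 n + (if n \<in> S then F \<eta> n else 0)))"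
      using pointwise by (intro sum_mono) auto
    also have "\<dots> \<le> (\<Sum>n\<in>T. x * s * (F 0 n + (if n \<in> S then F \<eta> n else 0)))"
      using finT F0 xs by (intro sum_mono2) (auto intro!: mult_nonneg_nonneg)
    also have "\<dots> = x * s * ((\<Sum>n\<in>T. F 0 n) + (\<Sum>n\<in>T \<inter> S. F \<eta> n))"
      by (simp only: sum_distrib_left[symmetric] sum.distrib sum.inter_restrict[OF finT])
    also have "\<dots> \<le> x * s * (C * main_size f x E k + C * main_size f x E k)"
    proof (intro mult_left_mono add_mono xs)
      show "(\<Sum>n\<in>T. F 0 n) \<le> C * main_size f x E k"
        unfolding T F_def \<delta>_def using x adm k N by (intro C_all[rule_format]) auto
      have "(\<Sum>n\<in>T \<inter> S. F \<eta> n) \<le> (\<Sum>n | n \<in> S \<and> wcount w n E = k. F \<eta> n)"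
        using F0 by (intro sum_mono2) (auto simp: T_def S_def)
      also have "\<dots> \<le> C * main_size f x E k"
        unfolding S_def F_def \<delta>_def
      proof (intro C_all[rule_format] conjI)
        show "1 \<le> y" using L0 by (simp add: y_def)
        have "sqrt L \<le> L" using L8 sL by linarith
        then show "y \<le> x" unfolding y_def xL by simp
        show "\<eta> * ln y \<le> 1" using \<eta>(3) by (simp add: y_def)
      qed (use adm N k \<eta> in auto)
      finally show "(\<Sum>n\<in>T \<inter> S. F \<eta> n) \<le> C * main_size f x E k" .
    qed
    also have "\<dots> = 2 * C * (x * s) * main_size f x E k" by (simp add: algebra_simps)
    finally show ?thesis by (simp only: s_def L_def)
  qed
  then show ?thesis using C unfolding \<delta>_def by (intro exI[of _ "2 * C"]) auto
qed

section \<open>Combining the two contributions\<close>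

lemma not_exceptional_decomposition:
  assumes n: "n \<in> sifted x R" "\<not> exceptional x n" and x: "x \<ge> 2" and w1: "w 1 = 1"
  shows "\<exists>m p. n = m * p \<and> m \<in> cofactors x \<and> prime p \<and> \<not> p dvd m \<and>
    wcount w n E = (if p \<in> E then 1 else 0) + wcount w m E"
proof -
  define y where "y = exp (sqrt (ln x))"
  have n1: "n \<ge> 1" "real n \<le> x" using n by (auto simp: sifted_def)
  obtain q where q: "q \<in> prime_factors n" "real q > y" using n(2) by (auto simp: exceptional_def y_def not_le)
  define p where "p = Max (prime_factors n)"
  have p: "p \<in> prime_factors n" using q by (auto simp: p_def intro!: Max_in)
  have pmax: "r \<le> p" if "r \<in> prime_factors n" for r using that by (simp add: p_def)
  have pp: "prime p" using p by (rule in_prime_factors_imp_prime)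
  have "q \<le> p" using q(1) by (rule pmax)
  then have py: "real p > y" using q(2) by linarith
  define l where "l = multiplicity p n"
  have l1: "l \<ge> 1" using p by (simp add: l_def prime_factors_multiplicity)
  \<comment> \<open>As \<open>p\<close> itself exceeds the cutoff, a repeated \<open>p\<close> would
    make \<open>n\<close> exceptional through its power \<open>p^l\<close>.\<close>
  have "\<not> l \<ge> 2"
  proof
    assume l2: "l \<ge> 2"
    have "real p ^ 1 \<le> real p ^ l" using l1 pp by (intro power_increasing) (auto dest: prime_ge_1_nat)
    then have "real (p ^ l) > y" using py unfolding of_nat_power power_one_right by linarith
    then show False using n(2) pp l2 by (auto simp: exceptional_def y_def l_def)
  qed
  then have l: "l = 1" using l1 by simp
  obtain m where m: "n = p ^ l * m" "\<not> p dvd m"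
    using n1(1) pp not_prime_unit[of p] unfolding l_def by (metis multiplicity_decompose' not_one_le_zero)
  have m0: "m > 0" using m n1 by (intro gr0I) auto
  have nm: "n = m * p" using m l by (simp add: mult.commute)
  have pf: "prime_factors m \<subseteq> prime_factors n"
    using prime_factors_prime_power_mult(3)[OF pp m(2) m0, of l] m(1) by auto
  have px: "real p \<le> x / real m" using n1 m0 by (simp add: nm field_simps)
  have "m \<in> cofactors x"
    unfolding cofactors_def
  proof (intro CollectI conjI ballI)
    have "real m * y \<le> real m * real p" using py by (intro mult_left_mono) auto
    moreover have "real m * real p \<le> x" using n1 by (simp add: nm)
    ultimately show "real m * exp (sqrt (ln x)) \<le> x" unfolding y_def[symmetric] by linarith
    fix r assume "r \<in> prime_factors m"
    then have "r \<le> p" using pf pmax by auto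
    then show "real r \<le> x / real m" using px by linarith
  qed (use m0 in simp)
  moreover have "wcount w n E = (if p \<in> E then 1 else 0) + wcount w m E"
    using wcount_prime_power_mult[OF pp m(2) m0, of w 1 E] w1 by (simp add: nm mult.commute)
  ultimately show ?thesis using nm pp m(2) by blast
qed

text \<open>For \<open>n = m p\<close> the count at \<open>m\<close> is \<open>k - 1\<close> or \<open>k\<close> according as \<open>p \<in> E\<close> or not; the second case
  does not occur for \<open>E = Primes\<close>.\<close>

lemma sum_sifted_le:
  fixes A B b \<theta> :: real and v :: nat
  assumes A: "A > 0" and B: "B > 0" and b: "b \<ge> 1" and \<theta>: "0 \<le> \<theta>" "\<theta> < 1"
  shows "\<exists>C>0. \<forall>f E w R \<nu> x k. admissible A B b \<theta> f E w \<and> valid_residues v R \<nu> \<and> x \<ge> 2 \<and> real k \<le> b * msum f x E \<longrightarrow>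
    (\<Sum>n | n \<in> sifted x R \<and> wcount w n E = k. f n) \<le>
      C * (x / ln x * exp (- msum (\<lambda>p. real (\<nu> p)) x Primes)) *
        (\<Sum>j | j \<le> k \<and> (Suc j = k \<or> j = k \<and> E \<noteq> Primes). main_size f x E j) +
      C * (x * exp (- (2 * ((1 - \<theta>) / 16) * sqrt (ln x)))) * main_size f x E k"
proof -
  define \<delta> where "\<delta> = (1 - \<theta>) / 16"
  obtain C1 where C1: "C1 > 0" and C1_all: "\<forall>f E w x k. admissible A B b \<theta> f E w \<and> x \<ge> 2 \<and> real k \<le> b * msum f x E \<longrightarrow>
    (\<Sum>n | n \<ge> 1 \<and> real n \<le> x \<and> wcount w n E = k. f n) \<le> C1 * x * main_size f x E k"
    using sum_upto_le[OF assms] by (elim exE conjE) (rule that)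
  obtain C2 where C2: "C2 > 0" and C2_all: "\<forall>f E w x k. admissible A B b \<theta> f E w \<and> x \<ge> 2 \<and> 1 \<le> 2 * ((1 - \<theta>) / 16) * sqrt (ln x) \<and>
      real k \<le> b * msum f x E \<longrightarrow>
    (\<Sum>n | n \<ge> 1 \<and> real n \<le> x \<and> wcount w n E = k \<and> exceptional x n. f n) \<le>
      C2 * (x * exp (- (2 * ((1 - \<theta>) / 16) * sqrt (ln x)))) * main_size f x E k"
    using sum_exceptional_le[OF assms] by (elim exE conjE) (rule that)
  obtain C3 where C3: "C3 > 0" and C3_all: "\<forall>f E w R \<nu> x j. admissible A B b \<theta> f E w \<and> valid_residues v R \<nu> \<and> x \<ge> 2 \<and>
      1 \<le> 2 * ((1 - \<theta>) / 16) * sqrt (ln x) \<and> real j \<le> b * msum f x E \<longrightarrow>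
    (\<Sum>m | m \<in> cofactors x \<and> wcount w m E = j. f m * real (card {p. prime p \<and> m * p \<in> sifted x R})) \<le>
      C3 * (x / ln x * exp (- msum (\<lambda>p. real (\<nu> p)) x Primes)) * main_size f x E j"
    using sum_cofactors_le[OF assms, of v] by (elim exE conjE) (rule that)
  define C where "C = C1 * exp 1 + C2 + A * C3"
  have C: "C > 0" using A C1 C2 C3 by (simp add: C_def add_pos_pos)
  have "(\<Sum>n | n \<in> sifted x R \<and> wcount w n E = k. f n) \<le>
      C * (x / ln x * exp (- msum (\<lambda>p. real (\<nu> p)) x Primes)) *
        (\<Sum>j | j \<le> k \<and> (Suc j = k \<or> j = k \<and> E \<noteq> Primes). main_size f x E j) +
      C * (x * exp (- (2 * \<delta> * sqrt (ln x)))) * main_size f x E k"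
    if adm: "admissible A B b \<theta> f E w" and R: "valid_residues v R \<nu>" and x: "x \<ge> 2"
      and k: "real k \<le> b * msum f x E" for f E w R \<nu> x k
  proof -
    define s where "s = exp (- (2 * \<delta> * sqrt (ln x)))"
    define G where "G = x / ln x * exp (- msum (\<lambda>p. real (\<nu> p)) x Primes)"
    define J where "J = {j. j \<le> k \<and> (Suc j = k \<or> j = k \<and> E \<noteq> Primes)}"
    have G0: "G \<ge> 0" using x by (simp add: G_def)
    have E: "E \<subseteq> Primes" and w1: "w 1 = 1" and f0: "\<And>n. n \<ge> 1 \<Longrightarrow> f n \<ge> 0"
      using adm by (auto simp: admissible_def)
    have Phi0: "main_size f x E j \<ge> 0" for j by (rule main_size_nonneg[OF adm])
    have SJ0: "(\<Sum>j\<in>J. main_size f x E j) \<ge> 0" using Phi0 by (intro sum_nonneg)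
    have finU: "finite {n. n \<ge> 1 \<and> real n \<le> x \<and> Pr n}" for Pr :: "nat \<Rightarrow> bool"
      by (rule finite_subset[OF _ finite_nat_real_le[of "\<lambda>_. True" x]]) auto
    have "(\<Sum>n | n \<in> sifted x R \<and> wcount w n E = k. f n) \<le> C * G * (\<Sum>j\<in>J. main_size f x E j) + C * (x * s) * main_size f x E k"
    proof (cases "1 \<le> 2 * \<delta> * sqrt (ln x)")
      case False
      have "(\<Sum>n | n \<in> sifted x R \<and> wcount w n E = k. f n) \<le> (\<Sum>n | n \<ge> 1 \<and> real n \<le> x \<and> wcount w n E = k. f n)"
        using f0 finU by (intro sum_mono2) (auto simp: sifted_def)
      also have "\<dots> \<le> C1 * x * main_size f x E k" using adm x k by (intro C1_all[rule_format]) auto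
      also have "\<dots> \<le> C1 * x * main_size f x E k * (exp 1 * s)"
      proof -
        \<comment> \<open>Here \<open>x\<close> is bounded and \<open>s \<ge> exp (- 1)\<close>, so
          the trivial bound already has the shape of the error term.\<close>
        have "1 \<le> exp 1 * s" using False by (simp add: s_def flip: exp_add)
        moreover have "C1 * x * main_size f x E k \<ge> 0" using C1 x Phi0[of k] by simp
        ultimately show ?thesis using mult_left_mono[of 1 "exp 1 * s" "C1 * x * main_size f x E k"] by simp
      qed
      also have "\<dots> = (C1 * exp 1) * (x * s * main_size f x E k)" by simp
      also have "\<dots> \<le> C * (x * s * main_size f x E k)"
        using A C2 C3 x Phi0[of k] by (intro mult_right_mono) (auto simp: C_def s_def)
      finally show ?thesis using C G0 SJ0 by (simp add: mult.assoc add_increasing)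
    next
      case True
      define Ex where "Ex = {n. n \<ge> 1 \<and> real n \<le> x \<and> wcount w n E = k \<and> exceptional x n}"
      define H where "H m = {p. prime p \<and> m * p \<in> sifted x R \<and> \<not> p dvd m}" for m
      define Q where "Q = {m. m \<in> cofactors x \<and> wcount w m E \<in> J}"
      have finQ: "finite Q" using finite_cofactors[of x] x by (auto simp: Q_def intro: finite_subset)
      have Q1: "m \<ge> 1" if "m \<in> Q" for m using that by (simp add: Q_def cofactors_def)
      have finH': "finite {p. prime p \<and> m * p \<in> sifted x R}" if "m \<ge> 1" for m
      proof (rule finite_subset[OF _ finite_nat_real_le[of "\<lambda>_. True" x]], rule subsetI)
        fix p assume "p \<in> {p. prime p \<and> m * p \<in> sifted x R}"
        then have "real (m * p) \<le> x" by (simp add: sifted_def)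
        moreover have "real p \<le> real (m * p)" using that by (intro of_nat_mono) simp
        ultimately have "real p \<le> x" by linarith
        then show "p \<in> {n. True \<and> real n \<le> x}" by simp
      qed
      have finH: "finite (H m)" if "m \<in> Q" for m
        using finH'[OF Q1[OF that]] by (rule finite_subset[rotated]) (auto simp: H_def)
      have sub: "{n. n \<in> sifted x R \<and> wcount w n E = k} \<subseteq> Ex \<union> (\<lambda>(m, p). m * p) ` (SIGMA m:Q. H m)"
      proof
        fix n assume n: "n \<in> {n. n \<in> sifted x R \<and> wcount w n E = k}"
        show "n \<in> Ex \<union> (\<lambda>(m, p). m * p) ` (SIGMA m:Q. H m)"
        proof (cases "exceptional x n")
          case True
          then show ?thesis using n by (simp add: Ex_def sifted_def)
        next
          case False
          obtain m p where mp: "n = m * p" "m \<in> cofactors x" "prime p" "\<not> p dvd m"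
            "wcount w n E = (if p \<in> E then 1 else 0) + wcount w m E"
            using not_exceptional_decomposition[of n x R w E] n False x w1 by auto
          have "wcount w m E \<in> J" using mp(3,5) n by (auto simp: J_def split: if_splits)
          then have "(m, p) \<in> (SIGMA m:Q. H m)" using mp n by (auto simp: Q_def H_def)
          then show ?thesis using mp(1) by (intro UnI2 image_eqI[of _ _ "(m, p)"]) auto
        qed
      qed
      have pos: "f (m * p) \<ge> 0" if "m \<in> Q" "p \<in> H m" for m p
        using that by (intro f0) (auto simp: H_def sifted_def)
      have "(\<Sum>n | n \<in> sifted x R \<and> wcount w n E = k. f n) \<le> (\<Sum>n\<in>Ex \<union> (\<lambda>(m, p). m * p) ` (SIGMA m:Q. H m). f n)"
      proof (rule sum_mono2[OF _ sub])
        show "finite (Ex \<union> (\<lambda>(m, p). m * p) ` (SIGMA m:Q. H m))"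
          using finQ finH finU by (auto simp: Ex_def)
        fix n assume "n \<in> (Ex \<union> (\<lambda>(m, p). m * p) ` (SIGMA m:Q. H m)) - {n. n \<in> sifted x R \<and> wcount w n E = k}"
        then show "0 \<le> f n" using pos f0 by (auto simp: Ex_def)
      qed
      also have "\<dots> \<le> (\<Sum>n\<in>Ex. f n) + (\<Sum>n\<in>(\<lambda>(m, p). m * p) ` (SIGMA m:Q. H m). f n)"
      proof (subst sum.union_inter[symmetric])
        show "finite Ex" using finU by (simp add: Ex_def)
        show "finite ((\<lambda>(m, p). m * p) ` (SIGMA m:Q. H m))" using finQ finH by auto
        have "0 \<le> (\<Sum>n\<in>Ex \<inter> (\<lambda>(m, p). m * p) ` (SIGMA m:Q. H m). f n)" using f0 by (intro sum_nonneg) (auto simp: Ex_def)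
        then show "(\<Sum>n\<in>Ex \<union> (\<lambda>(m, p). m * p) ` (SIGMA m:Q. H m). f n) \<le>
           (\<Sum>n\<in>Ex \<union> (\<lambda>(m, p). m * p) ` (SIGMA m:Q. H m). f n) + (\<Sum>n\<in>Ex \<inter> (\<lambda>(m, p). m * p) ` (SIGMA m:Q. H m). f n)" by simp
      qed
      also have "(\<Sum>n\<in>Ex. f n) \<le> C2 * (x * s) * main_size f x E k"
        unfolding Ex_def s_def \<delta>_def using adm x k True by (intro C2_all[rule_format]) (auto simp: \<delta>_def)
      \<comment> \<open>Different pairs \<open>(m, p)\<close> may give the same product; as
        \<open>f\<close> is nonnegative there, this only enlarges the right side.\<close>
      also have "(\<Sum>n\<in>(\<lambda>(m, p). m * p) ` (SIGMA m:Q. H m). f n) \<le> (\<Sum>z\<in>(SIGMA m:Q. H m). (f \<circ> (\<lambda>(m, p). m * p)) z)"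
        using finQ finH pos by (intro sum_image_le) auto
      also have "\<dots> = (\<Sum>m\<in>Q. \<Sum>p\<in>H m. f (m * p))"
        using finQ finH by (subst sum.Sigma) (auto simp: case_prod_unfold)
      also have "\<dots> \<le> (\<Sum>m\<in>Q. A * (f m * real (card {p. prime p \<and> m * p \<in> sifted x R})))"
      proof (rule sum_mono)
        fix m assume m: "m \<in> Q"
        have "(\<Sum>p\<in>H m. f (m * p)) \<le> (\<Sum>p\<in>H m. A * f m)"
        proof (rule sum_mono)
          fix p assume p: "p \<in> H m"
          have "prime p" "coprime m p"
            using p prime_imp_coprime[of p m] by (auto simp: H_def coprime_commute)
          moreover have "p \<ge> 1" using p prime_ge_1_nat[of p] by (simp add: H_def)
          ultimately have "f (m * p) = f m * f p" using adm Q1[OF m] by (auto simp: admissible_def)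
          moreover have "f (p ^ 1) \<le> A ^ 1" using adm \<open>prime p\<close> unfolding admissible_def by blast
          ultimately show "f (m * p) \<le> A * f m" using f0[OF Q1[OF m]] mult_left_mono[of "f p" A "f m"] by (simp add: mult.commute)
        qed
        also have "\<dots> = A * f m * real (card (H m))" by simp
        also have "\<dots> \<le> A * f m * real (card {p. prime p \<and> m * p \<in> sifted x R})"
          using A f0[OF Q1[OF m]] finH'[OF Q1[OF m]]
          by (intro mult_left_mono of_nat_mono card_mono) (auto simp: H_def)
        finally show "(\<Sum>p\<in>H m. f (m * p)) \<le> A * (f m * real (card {p. prime p \<and> m * p \<in> sifted x R}))" by simp
      qed
      also have "\<dots> = A * (\<Sum>m\<in>Q. f m * real (card {p. prime p \<and> m * p \<in> sifted x R}))"
        by (rule sum_distrib_left[symmetric])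
      also have "(\<Sum>m\<in>Q. f m * real (card {p. prime p \<and> m * p \<in> sifted x R})) =
          (\<Sum>j\<in>J. \<Sum>m\<in>{m\<in>Q. wcount w m E = j}. f m * real (card {p. prime p \<and> m * p \<in> sifted x R}))"
        using finQ by (intro sum.group[symmetric]) (auto simp: Q_def J_def)
      also have "\<dots> \<le> (\<Sum>j\<in>J. C3 * G * main_size f x E j)"
      proof (rule sum_mono)
        fix j assume j: "j \<in> J"
        have set: "{m\<in>Q. wcount w m E = j} = {m. m \<in> cofactors x \<and> wcount w m E = j}"
          using j by (auto simp: Q_def)
        have "real j \<le> real k" using j by (simp add: J_def)
        then have jb: "real j \<le> b * msum f x E" using k by linarith
        show "(\<Sum>m\<in>{m\<in>Q. wcount w m E = j}. f m * real (card {p. prime p \<and> m * p \<in> sifted x R})) \<le> C3 * G * main_size f x E j"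
          unfolding set G_def
          by (rule C3_all[rule_format]) (intro conjI adm R x jb True[unfolded \<delta>_def])
      qed
      also have "\<dots> = C3 * G * (\<Sum>j\<in>J. main_size f x E j)" by (rule sum_distrib_left[symmetric])
      finally have le: "(\<Sum>n | n \<in> sifted x R \<and> wcount w n E = k. f n) \<le>
          C2 * (x * s) * main_size f x E k + A * (C3 * G * (\<Sum>j\<in>J. main_size f x E j))"
        using A by simp
      have "C2 * ((x * s) * main_size f x E k) \<le> C * ((x * s) * main_size f x E k)"
        using A C1 C3 x Phi0[of k] by (intro mult_right_mono) (auto simp: C_def s_def)
      moreover have "(A * C3) * (G * (\<Sum>j\<in>J. main_size f x E j)) \<le> C * (G * (\<Sum>j\<in>J. main_size f x E j))"
        using C1 C2 G0 SJ0 by (intro mult_right_mono) (auto simp: C_def)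
      ultimately show ?thesis using le by (simp add: mult_ac)
    qed
    then show ?thesis by (simp only: s_def G_def J_def)
  qed
  then show ?thesis using C unfolding \<delta>_def by (intro exI[of _ C]) auto
qed

text \<open>The prime sum is \<open>O(log log x)\<close>, so the second factor is at most a power of
  \<open>ln x\<close>. Used to compare the error term with
  \<open>x / ln x * exp (- M\<nu>)\<close>.\<close>

lemma exp_sqrt_absorbs_primes:
  fixes \<kappa> c :: real assumes "\<kappa> \<ge> 0" "c > 0"
  shows "\<exists>C>0. \<forall>x\<ge>2. exp (- (c * sqrt (ln x))) * (ln x * exp (\<kappa> * (\<Sum>p\<in>primes_le x. 1 / real p))) \<le> C"
proof -
  obtain C A where CA: "C > 0" "A \<ge> 0"
    "\<And>x. x \<ge> 2 \<Longrightarrow> exp (\<kappa> * (\<Sum>p\<in>primes_le x. 1 / real p)) \<le> C * ln x powr A"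
    using exp_sum_inverse_primes_le[OF assms(1)] by blast
  have A1: "A + 1 \<ge> 0" using CA by simp
  obtain C' where C': "C' > 0" "\<And>t. t > 0 \<Longrightarrow> t powr (A + 1) \<le> C' * exp (c * sqrt t)"
    using powr_le_exp_sqrt[OF A1 assms(2)] by auto
  have "exp (- (c * sqrt (ln x))) * (ln x * exp (\<kappa> * (\<Sum>p\<in>primes_le x. 1 / real p))) \<le> C * C'" if x: "x \<ge> 2" for x
  proof -
    define t where "t = ln x"
    have t: "t > 0" using x by (simp add: t_def)
    have "t * exp (\<kappa> * (\<Sum>p\<in>primes_le x. 1 / real p)) \<le> t * (C * t powr A)"
      using CA(3)[OF x] t by (intro mult_left_mono) (auto simp: t_def)
    also have "\<dots> = C * t powr (A + 1)" using t by (simp add: powr_add)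
    also have "\<dots> \<le> C * (C' * exp (c * sqrt t))" using C'(2)[OF t] CA by (intro mult_left_mono) auto
    finally have "exp (- (c * sqrt t)) * (t * exp (\<kappa> * (\<Sum>p\<in>primes_le x. 1 / real p))) \<le>
        exp (- (c * sqrt t)) * (C * (C' * exp (c * sqrt t)))" by (intro mult_left_mono) auto
    also have "\<dots> = C * C' * (exp (- (c * sqrt t)) * exp (c * sqrt t))" by simp
    also have "\<dots> = C * C'" by (simp flip: exp_add)
    finally show ?thesis by (simp add: t_def)
  qed
  then show ?thesis using CA C' by (intro exI[of _ "C * C'"]) auto
qed

text \<open>Consecutive sizes have ratio \<open>M / k\<close>, and \<open>k \<le> b * M\<close> for
  the first bound, \<open>k \<ge> 1\<close> for the second. The first merges the contributions of
  \<open>k - 1\<close> and \<open>k\<close>; the second brings an error term at \<open>k\<close>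
  down to \<open>k - 1\<close>.\<close>

lemma main_size_pred_le:
  assumes adm: "admissible A B b \<theta> f E w" and "b \<ge> 1" "k \<ge> 1" "real k \<le> b * msum f x E"
  shows "main_size f x E (k - 1) \<le> b * main_size f x E k"
    and "main_size f x E k \<le> msum f x E * main_size f x E (k - 1)"
proof -
  define M where "M = msum f x E"
  have E: "E \<subseteq> Primes" using adm by (simp add: admissible_def)
  have M0: "M \<ge> 0" unfolding M_def using adm E by (rule msum_nonneg)
  obtain j where j: "k = Suc j" using assms(3) by (cases k) auto
  have P: "exp (msum f x (Primes - E)) > 0" by simp
  have "M ^ j / fact j \<le> b * (M ^ Suc j / fact (Suc j))"
    using power_div_fact_diff_le[of 1 "Suc j" b M] assms M0 by (simp add: j M_def del: fact_Suc power_Suc)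
  then have "M ^ j / fact j * exp (msum f x (Primes - E)) \<le> b * (M ^ Suc j / fact (Suc j)) * exp (msum f x (Primes - E))"
    by (intro mult_right_mono) auto
  then show "main_size f x E (k - 1) \<le> b * main_size f x E k"
    by (simp add: main_size_def j M_def mult.assoc)
  have "(fact j :: real) \<le> fact (Suc j)" by (intro fact_mono) auto
  then have "M ^ Suc j / fact (Suc j) \<le> M ^ Suc j / fact j"
    using M0 by (intro divide_left_mono) auto
  then have "M ^ Suc j / fact (Suc j) * exp (msum f x (Primes - E)) \<le> M ^ Suc j / fact j * exp (msum f x (Primes - E))"
    by (intro mult_right_mono) auto
  then show "main_size f x E k \<le> msum f x E * main_size f x E (k - 1)"
    by (simp add: main_size_def j M_def mult_ac del: fact_Suc)
qed

text \<open>For \<open>E = Primes\<close> the main contribution comes from \<open>k - 1\<close>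
  alone, while the exceptional integers are estimated at \<open>k\<close>. Lowering that index costs
  a factor \<open>M\<close>, which the saving \<open>exp (- c * sqrt (ln x))\<close> absorbs along
  with \<open>ln x\<close> and the exponential of \<open>M\<nu>\<close>.\<close>

lemma sum_sifted_main:
  fixes A B b \<theta> :: real and v :: nat
  assumes A: "A > 0" and B: "B > 0" and b: "b \<ge> 1" and \<theta>: "0 \<le> \<theta>" "\<theta> < 1"
  shows "\<exists>C>0. \<forall>f E w R \<nu> x k. admissible A B b \<theta> f E w \<and> valid_residues v R \<nu> \<and> x \<ge> 2 \<and> real k \<le> b * msum f x E \<longrightarrow>
    (\<Sum>n | n \<in> sifted x R \<and> wcount w n E = k. f n) \<le>
      C * (x / ln x * exp (- msum (\<lambda>p. real (\<nu> p)) x Primes)) * main_size f x E k \<and>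
    (E = Primes \<and> k \<ge> 1 \<longrightarrow> (\<Sum>n | n \<in> sifted x R \<and> wcount w n E = k. f n) \<le>
      C * (x / ln x * exp (- msum (\<lambda>p. real (\<nu> p)) x Primes)) * main_size f x E (k - 1))"
proof -
  define c where "c = 2 * ((1 - \<theta>) / 16)"
  have c: "c > 0" using \<theta> by (simp add: c_def)
  obtain C1 where C1: "C1 > 0" and C1_all: "\<forall>f E w R \<nu> x k. admissible A B b \<theta> f E w \<and> valid_residues v R \<nu> \<and> x \<ge> 2 \<and> real k \<le> b * msum f x E \<longrightarrow>
    (\<Sum>n | n \<in> sifted x R \<and> wcount w n E = k. f n) \<le>
      C1 * (x / ln x * exp (- msum (\<lambda>p. real (\<nu> p)) x Primes)) *
        (\<Sum>j | j \<le> k \<and> (Suc j = k \<or> j = k \<and> E \<noteq> Primes). main_size f x E j) +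
      C1 * (x * exp (- (2 * ((1 - \<theta>) / 16) * sqrt (ln x)))) * main_size f x E k"
    using sum_sifted_le[OF assms, of v] by (elim exE conjE) (rule that)
  \<comment> \<open>\<open>A\<close> pays for \<open>1 + M \<le> exp (A * T)\<close>, and
    \<open>v\<close> for \<open>exp M\<nu> \<le> exp (v * T)\<close>.\<close>
  define \<kappa> where "\<kappa> = A + real v"
  have \<kappa>: "\<kappa> \<ge> 0" using A by (simp add: \<kappa>_def)
  obtain C2 where C2: "C2 > 0" "\<And>x. x \<ge> 2 \<Longrightarrow> exp (- (c * sqrt (ln x))) * (ln x * exp (\<kappa> * (\<Sum>p\<in>primes_le x. 1 / real p))) \<le> C2"
    using exp_sqrt_absorbs_primes[OF \<kappa> c] by blast
  define C where "C = C1 * (b + 1 + C2)"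
  have C: "C > 0" using C1 C2 b by (simp add: C_def)
  have "(\<Sum>n | n \<in> sifted x R \<and> wcount w n E = k. f n) \<le>
      C * (x / ln x * exp (- msum (\<lambda>p. real (\<nu> p)) x Primes)) * main_size f x E k \<and>
    (E = Primes \<and> k \<ge> 1 \<longrightarrow> (\<Sum>n | n \<in> sifted x R \<and> wcount w n E = k. f n) \<le>
      C * (x / ln x * exp (- msum (\<lambda>p. real (\<nu> p)) x Primes)) * main_size f x E (k - 1))"
    if adm: "admissible A B b \<theta> f E w" and R: "valid_residues v R \<nu>" and x: "x \<ge> 2"
      and k: "real k \<le> b * msum f x E" for f E w R \<nu> x k
  proof -
    define T where "T = (\<Sum>p\<in>primes_le x. 1 / real p)"
    define M\<nu> where "M\<nu> = msum (\<lambda>p. real (\<nu> p)) x Primes"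
    define G where "G = x / ln x * exp (- M\<nu>)"
    define s where "s = exp (- (c * sqrt (ln x)))"
    define \<Sigma> where "\<Sigma> = (\<Sum>n | n \<in> sifted x R \<and> wcount w n E = k. f n)"
    have G0: "G > 0" using x by (simp add: G_def)
    have T0: "T \<ge> 0" by (simp add: T_def sum_nonneg)
    have E: "E \<subseteq> Primes" using adm by (simp add: admissible_def)
    have Phi0: "main_size f x E j \<ge> 0" for j by (rule main_size_nonneg[OF adm])
    have M\<nu>: "M\<nu> \<le> real v * T"
      unfolding M\<nu>_def msum_def T_def sum_distrib_left
      using R by (intro sum_mono2 order_trans[OF sum_mono[of _ _ "\<lambda>p. real v * (1 / real p)"]])
        (auto simp: valid_residues_def intro!: divide_right_mono)
    have M: "msum f x E \<le> A * T"
    proof -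
      have "msum f x E \<le> (\<Sum>p | p \<in> E \<and> real p \<le> x. A * (1 / real p))"
        unfolding msum_def
      proof (rule sum_mono)
        fix p assume "p \<in> {p. p \<in> E \<and> real p \<le> x}"
        then have "prime p" using E by auto
        then have "f (p ^ 1) \<le> A ^ 1" using adm unfolding admissible_def by blast
        then show "f p / real p \<le> A * (1 / real p)" by (simp add: divide_right_mono)
      qed
      also have "\<dots> \<le> (\<Sum>p\<in>primes_le x. A * (1 / real p))" using E A by (intro sum_mono2) auto
      finally show ?thesis by (simp add: T_def sum_distrib_left)
    qed
    have absorb: "x * s * (1 + msum f x E) \<le> C2 * G"
    proof -
      have "(1 + msum f x E) * exp M\<nu> \<le> exp (A * T) * exp (real v * T)"
      proof (intro mult_mono)
        show "1 + msum f x E \<le> exp (A * T)" using M exp_ge_add_one_self[of "A * T"] by linarith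
      qed (use M\<nu> in auto)
      also have "\<dots> = exp (\<kappa> * T)" by (simp add: \<kappa>_def algebra_simps flip: exp_add)
      finally have "s * (ln x * ((1 + msum f x E) * exp M\<nu>)) \<le> s * (ln x * exp (\<kappa> * T))"
        using x by (intro mult_left_mono) (auto simp: s_def)
      also have "\<dots> \<le> C2" using C2(2)[OF x] by (simp add: s_def T_def)
      finally have le: "G * (s * (ln x * ((1 + msum f x E) * exp M\<nu>))) \<le> G * C2"
        using G0 by (intro mult_left_mono) auto
      have "G * ln x = x * exp (- M\<nu>)" using x by (simp add: G_def)
      moreover have "G * (s * (ln x * ((1 + msum f x E) * exp M\<nu>))) = G * ln x * (s * ((1 + msum f x E) * exp M\<nu>))"
        by (simp only: mult_ac)
      ultimately have "G * (s * (ln x * ((1 + msum f x E) * exp M\<nu>))) = x * exp (- M\<nu>) * (s * ((1 + msum f x E) * exp M\<nu>))"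
        by (simp only:)
      also have "\<dots> = x * s * (1 + msum f x E) * (exp (- M\<nu>) * exp M\<nu>)" by (simp only: mult_ac)
      also have "exp (- M\<nu>) * exp M\<nu> = 1" by (simp flip: exp_add)
      finally have "G * (s * (ln x * ((1 + msum f x E) * exp M\<nu>))) = x * s * (1 + msum f x E)"
        by (simp only: mult_1_right)
      then show ?thesis using le by (simp only: mult.commute[of G C2])
    qed
    have Mf0: "msum f x E \<ge> 0" using adm E by (rule msum_nonneg)
    have xs0: "x * s \<ge> 0" using x by (simp add: s_def)
    have xs: "x * s \<le> C2 * G" "x * s * msum f x E \<le> C2 * G"
      using absorb mult_nonneg_nonneg[OF xs0 Mf0] xs0 by (simp_all add: distrib_left)
    define J where "J = {j. j \<le> k \<and> (Suc j = k \<or> j = k \<and> E \<noteq> Primes)}"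
    have base: "\<Sigma> \<le> C1 * G * (\<Sum>j\<in>J. main_size f x E j) + C1 * (x * s) * main_size f x E k"
      unfolding \<Sigma>_def G_def J_def s_def c_def M\<nu>_def using adm R x k by (intro C1_all[rule_format]) auto
    have "(\<Sum>j\<in>J. main_size f x E j) \<le> (b + 1) * main_size f x E k"
    proof (cases "k = 0")
      case True
      have "(\<Sum>j\<in>J. main_size f x E j) \<le> (\<Sum>j\<in>{0}. main_size f x E j)"
        using Phi0 True by (intro sum_mono2) (auto simp: J_def)
      also have "\<dots> \<le> (b + 1) * main_size f x E k" using True b mult_right_mono[of 1 "b + 1" "main_size f x E 0"] Phi0[of 0] by simp
      finally show ?thesis .
    next
      case False
      have "(\<Sum>j\<in>J. main_size f x E j) \<le> (\<Sum>j\<in>{k - 1, k}. main_size f x E j)"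
        using Phi0 False by (intro sum_mono2) (auto simp: J_def)
      also have "\<dots> = main_size f x E (k - 1) + main_size f x E k" using False by (subst sum.insert) auto
      also have "\<dots> \<le> b * main_size f x E k + main_size f x E k"
        using main_size_pred_le(1)[OF adm b _ k] False by simp
      finally show ?thesis by (simp add: algebra_simps)
    qed
    then have "C1 * G * (\<Sum>j\<in>J. main_size f x E j) \<le> C1 * G * ((b + 1) * main_size f x E k)"
      using C1 G0 by (intro mult_left_mono) auto
    moreover have "C1 * (x * s) * main_size f x E k \<le> C1 * (C2 * G) * main_size f x E k"
      using C1 xs(1) Phi0 by (intro mult_right_mono mult_left_mono) auto
    ultimately have 1: "\<Sigma> \<le> C * G * main_size f x E k" using base by (simp add: C_def algebra_simps)
    have 2: "\<Sigma> \<le> C * G * main_size f x E (k - 1)" if "E = Primes" "k \<ge> 1"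
    proof -
      have "J = {k - 1}" using that by (auto simp: J_def)
      then have "C1 * G * (\<Sum>j\<in>J. main_size f x E j) = C1 * G * main_size f x E (k - 1)" by simp
      moreover have "C1 * (x * s) * main_size f x E k \<le> C1 * (C2 * G) * main_size f x E (k - 1)"
      proof -
        have "(x * s) * main_size f x E k \<le> (x * s) * (msum f x E * main_size f x E (k - 1))"
          using main_size_pred_le(2)[OF adm b that(2) k] xs0 by (intro mult_left_mono)
        also have "\<dots> = (x * s * msum f x E) * main_size f x E (k - 1)" by simp
        also have "\<dots> \<le> (C2 * G) * main_size f x E (k - 1)" using xs(2) Phi0 by (intro mult_right_mono)
        finally have "C1 * ((x * s) * main_size f x E k) \<le> C1 * ((C2 * G) * main_size f x E (k - 1))"
          using C1 by (intro mult_left_mono) auto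
        then show ?thesis by (simp add: mult.assoc)
      qed
      moreover have "C1 * b * (G * main_size f x E (k - 1)) \<ge> 0" using C1 b G0 Phi0 by simp
      moreover have "C * G * main_size f x E (k - 1) = C1 * b * (G * main_size f x E (k - 1)) +
          C1 * G * main_size f x E (k - 1) + C1 * (C2 * G) * main_size f x E (k - 1)"
        by (simp add: C_def algebra_simps)
      ultimately show ?thesis using base by linarith
    qed
    show ?thesis using 1 2 by (simp add: \<Sigma>_def G_def M\<nu>_def)
  qed
  then show ?thesis using C by (intro exI[of _ C]) auto
qed

section \<open>Specialisation to \<open>omega\<close> and \<open>Omega\<close>, and the
  theorem\<close>

lemma omega_eq_wcount:
  assumes "n > 0" "E \<subseteq> Primes"
  shows "omega n E = wcount (\<lambda>l. of_bool (l \<ge> 1)) n E"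
proof -
  have "{p \<in> E. p dvd n} = prime_factors n \<inter> E" using assms by (auto simp: in_prime_factors_iff)
  moreover have "wcount (\<lambda>l. of_bool (l \<ge> 1)) n E = (\<Sum>p\<in>prime_factors n \<inter> E. 1)"
    unfolding wcount_def by (intro sum.cong) (auto simp: prime_factors_multiplicity)
  ultimately show ?thesis by (simp add: omega_def)
qed

lemma Omega_eq_wcount:
  assumes "n > 0" "E \<subseteq> Primes"
  shows "Omega n E = wcount id n E"
proof -
  have "p ^ l dvd n \<longleftrightarrow> l \<le> multiplicity p n" if "prime p" for p l
    using that assms by (intro power_dvd_iff_le_multiplicity) (auto simp: prime_gt_1_nat)
  then have "{(p, l). p \<in> E \<and> l \<ge> 1 \<and> p ^ l dvd n} = (SIGMA p:prime_factors n \<inter> E. {1..multiplicity p n})"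
    using assms(2) by (auto simp: prime_factors_multiplicity)
  then show ?thesis by (simp add: Omega_def wcount_def)
qed

lemma mult_class_prime_power_le:
  assumes "f \<in> mult_class A1 A2" "prime p"
  shows "f (p ^ l) \<le> A1 ^ l" and "\<epsilon> > 0 \<Longrightarrow> f (p ^ l) \<le> A2 \<epsilon> * real (p ^ l) powr \<epsilon>"
proof -
  have pl: "p ^ l \<ge> 1" using assms(2) by (simp add: Suc_le_eq prime_gt_0_nat)
  have "Omega (p ^ l) Primes = l"
    using assms(2) by (subst Omega_Primes_eq_size) (simp_all add: prime_gt_0_nat prime_factorization_prime_power)
  then show "f (p ^ l) \<le> A1 ^ l" using assms(1) pl unfolding mult_class_def by (metis (no_types, lifting) mem_Collect_eq)
  show "f (p ^ l) \<le> A2 \<epsilon> * real (p ^ l) powr \<epsilon>" if "\<epsilon> > 0"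
  proof -
    have "\<forall>n\<ge>1. f n \<le> A2 \<epsilon> * real n powr \<epsilon>" using assms(1) that by (simp add: mult_class_def)
    then show ?thesis using pl by blast
  qed
qed

lemma mult_class_admissible:
  assumes f: "f \<in> mult_class A1 A2" and \<theta>: "\<theta> < 1" and "E \<subseteq> Primes" "w 1 = 1" "\<And>l. w l \<le> l"
    and "\<And>p l. p \<in> E \<Longrightarrow> b ^ w l \<le> b * real p powr (\<theta> * real l)"
  shows "admissible A1 (A2 ((1 - \<theta>) / 16)) b \<theta> f E w"
  unfolding admissible_def
proof (intro conjI allI impI ballI)
  fix p l :: nat assume p: "prime p"
  show "f (p ^ l) \<le> A1 ^ l" using f p by (rule mult_class_prime_power_le)
  show "f (p ^ l) \<le> A2 ((1 - \<theta>) / 16) * real (p ^ l) powr ((1 - \<theta>) / 16)"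
    using \<theta> by (intro mult_class_prime_power_le(2)[OF f p]) simp
qed (use assms in \<open>auto simp: mult_class_def\<close>)

text \<open>Since \<open>(M + K)^k \<le> M^k exp (K \<beta>)\<close> for \<open>k \<le> \<beta> M\<close>, both terms \<open>O(1)\<close> of the theorem can be chosen
  as \<open>0\<close>.\<close>

definition count_bound ::
  "(nat \<Rightarrow> nat set \<Rightarrow> nat) \<Rightarrow> real \<Rightarrow> real \<Rightarrow> real \<Rightarrow> (nat \<Rightarrow> real) \<Rightarrow> (nat \<Rightarrow> int set) \<Rightarrow> (nat \<Rightarrow> nat) \<Rightarrow> nat set \<Rightarrow> bool" where
  "count_bound g C \<beta> x f R \<nu> E \<longleftrightarrow>
    (\<forall>k::nat. real k \<le> \<beta> * msum f x E \<longrightarrow>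
      \<bar>\<Sum>n | n \<in> sifted x R \<and> g n E = k. f n\<bar>
        \<le> C * (x * (msum f x E + 0) ^ k / (fact k * ln x)
                * exp (msum f x (Primes - E) - msum (\<lambda>p. real (\<nu> p)) x Primes))) \<and>
    (E = Primes \<longrightarrow>
      (\<forall>k::nat. 1 \<le> k \<and> real k \<le> \<beta> * msum f x Primes \<longrightarrow>
        \<bar>\<Sum>n | n \<in> sifted x R \<and> g n Primes = k. f n\<bar>
          \<le> C * (x * (msum f x Primes + 0) ^ (k - 1) / (fact (k - 1) * ln x)
                  * exp (- msum (\<lambda>p. real (\<nu> p)) x Primes))))"

text \<open>The estimates above work with a ratio \<open>b \<ge> 1\<close>, whereas
  \<open>\<beta>\<close> may be smaller; the applications take
  \<open>b = max \<beta> 1\<close>.\<close>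

lemma count_bound_of_admissible:
  fixes A B b \<theta> :: real and v :: nat
  assumes "A > 0" "B > 0" "b \<ge> 1" "0 \<le> \<theta>" "\<theta> < 1"
  shows "\<exists>C>0. \<forall>f E w g \<beta> R \<nu> x. admissible A B b \<theta> f E w \<and> (\<forall>n>0. g n E = wcount w n E) \<and> \<beta> \<le> b \<and>
    valid_residues v R \<nu> \<and> x \<ge> 2 \<longrightarrow> count_bound g C \<beta> x f R \<nu> E"
proof -
  obtain C where C: "C > 0" and C_all: "\<forall>f E w R \<nu> x k. admissible A B b \<theta> f E w \<and> valid_residues v R \<nu> \<and> x \<ge> 2 \<and> real k \<le> b * msum f x E \<longrightarrow>
    (\<Sum>n | n \<in> sifted x R \<and> wcount w n E = k. f n) \<le>
      C * (x / ln x * exp (- msum (\<lambda>p. real (\<nu> p)) x Primes)) * main_size f x E k \<and>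
    (E = Primes \<and> k \<ge> 1 \<longrightarrow> (\<Sum>n | n \<in> sifted x R \<and> wcount w n E = k. f n) \<le>
      C * (x / ln x * exp (- msum (\<lambda>p. real (\<nu> p)) x Primes)) * main_size f x E (k - 1))"
    using sum_sifted_main[OF assms, of v] by (elim exE conjE) (rule that)
  have "count_bound g C \<beta> x f R \<nu> E"
    if adm: "admissible A B b \<theta> f E w" and g: "\<forall>n>0. g n E = wcount w n E" and \<beta>: "\<beta> \<le> b"
      and R: "valid_residues v R \<nu>" and x: "x \<ge> 2" for f E w g \<beta> R \<nu> x
  proof -
    have E: "E \<subseteq> Primes" using adm by (simp add: admissible_def)
    have M0: "msum f x E \<ge> 0" using adm E by (rule msum_nonneg)
    have eq: "{n. n \<in> sifted x R \<and> g n E = k} = {n. n \<in> sifted x R \<and> wcount w n E = k}" for k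
      using g by (auto simp: sifted_def)
    have abs: "\<bar>\<Sum>n | n \<in> sifted x R \<and> g n E = k. f n\<bar> = (\<Sum>n | n \<in> sifted x R \<and> wcount w n E = k. f n)" for k
      unfolding eq using adm by (intro abs_of_nonneg sum_nonneg) (auto simp: sifted_def admissible_def)
    have kb: "real k \<le> b * msum f x E" if "real k \<le> \<beta> * msum f x E" for k
      using that mult_right_mono[OF \<beta> M0] by linarith
    have 1: "\<bar>\<Sum>n | n \<in> sifted x R \<and> g n E = k. f n\<bar>
        \<le> C * (x * (msum f x E + 0) ^ k / (fact k * ln x)
                * exp (msum f x (Primes - E) - msum (\<lambda>p. real (\<nu> p)) x Primes))"
      if "real k \<le> \<beta> * msum f x E" for k
    proof -
      have "\<bar>\<Sum>n | n \<in> sifted x R \<and> g n E = k. f n\<bar> \<le>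
          C * (x / ln x * exp (- msum (\<lambda>p. real (\<nu> p)) x Primes)) * main_size f x E k"
        unfolding abs by (rule C_all[rule_format, THEN conjunct1]) (intro conjI adm R x kb that)
      also have "\<dots> = C * (x * (msum f x E + 0) ^ k / (fact k * ln x)
                * exp (msum f x (Primes - E) - msum (\<lambda>p. real (\<nu> p)) x Primes))"
        by (simp add: main_size_def exp_diff exp_minus field_simps)
      finally show ?thesis .
    qed
    have 2: "\<bar>\<Sum>n | n \<in> sifted x R \<and> g n Primes = k. f n\<bar>
          \<le> C * (x * (msum f x Primes + 0) ^ (k - 1) / (fact (k - 1) * ln x)
                  * exp (- msum (\<lambda>p. real (\<nu> p)) x Primes))"
      if EP: "E = Primes" and k: "1 \<le> k" "real k \<le> \<beta> * msum f x Primes" for k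
    proof -
      have "\<bar>\<Sum>n | n \<in> sifted x R \<and> g n E = k. f n\<bar> \<le>
          C * (x / ln x * exp (- msum (\<lambda>p. real (\<nu> p)) x Primes)) * main_size f x E (k - 1)"
        unfolding abs
        by (rule C_all[rule_format, THEN conjunct2, rule_format])
           (use adm R x kb[of k] k EP in \<open>auto\<close>)
      also have "\<dots> = C * (x * (msum f x Primes + 0) ^ (k - 1) / (fact (k - 1) * ln x)
                  * exp (- msum (\<lambda>p. real (\<nu> p)) x Primes))"
        by (simp add: main_size_def EP msum_def field_simps)
      finally show ?thesis by (simp only: EP)
    qed
    show ?thesis unfolding count_bound_def using 1 2 by blast
  qed
  then show ?thesis using C by (intro exI[of _ C]) auto
qed

text \<open>Here \<open>w l \<le> 1\<close>, so \<open>b ^ w l \<le> b\<close> and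
  \<open>\<theta> = 0\<close> is admissible; hence no \<open>p0\<close> enters the constant.\<close>

lemma count_bound_omega:
  fixes A1 :: real and A2 :: "real \<Rightarrow> real" and v :: nat
  assumes "A1 > 0" "\<forall>\<epsilon>>0. A2 \<epsilon> > 0"
  shows "\<exists>C. C > 0 \<and> (\<forall>x f R \<nu> E. x \<ge> 2 \<and> f \<in> mult_class A1 A2 \<and> valid_residues v R \<nu> \<and> E \<subseteq> Primes \<longrightarrow>
    count_bound omega C \<beta> x f R \<nu> E)"
proof -
  define b where "b = max \<beta> 1"
  define w where "w l = (of_bool (l \<ge> 1) :: nat)" for l :: nat
  obtain C where C: "C > 0" and C_all: "\<forall>f E w g \<beta> R \<nu> x. admissible A1 (A2 ((1 - 0) / 16)) b 0 f E w \<and> (\<forall>n>0. g n E = wcount w n E) \<and> \<beta> \<le> b \<and>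
    valid_residues v R \<nu> \<and> x \<ge> 2 \<longrightarrow> count_bound g C \<beta> x f R \<nu> E"
    using count_bound_of_admissible[of A1 "A2 ((1 - 0) / 16)" b 0 v] assms
    by (auto simp: b_def)
  have "count_bound omega C \<beta> x f R \<nu> E"
    if "x \<ge> 2" "f \<in> mult_class A1 A2" "valid_residues v R \<nu>" "E \<subseteq> Primes" for x f R \<nu> E
  proof (rule C_all[rule_format], intro conjI)
    show "admissible A1 (A2 ((1 - 0) / 16)) b 0 f E w"
      using that by (intro mult_class_admissible) (auto simp: w_def b_def dest!: subsetD prime_gt_0_nat)
    show "\<forall>n>0. omega n E = wcount w n E"
      using omega_eq_wcount[OF _ that(4)] by (simp add: w_def[abs_def])
  qed (use that in \<open>auto simp: b_def\<close>)
  then show ?thesis using C by blast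
qed

text \<open>\<open>\<theta>\<close> solves \<open>p0 powr \<theta> = b\<close> for
  \<open>b = max \<beta> 1\<close>, and \<open>\<theta> < 1\<close> because \<open>b < p0\<close>.
  Every \<open>p\<close> in \<open>E\<close> is at least \<open>p0\<close>, so
  \<open>b ^ l \<le> p powr (\<theta> * l)\<close>.\<close>

lemma count_bound_Omega:
  fixes A1 :: real and A2 :: "real \<Rightarrow> real" and v :: nat
  assumes "A1 > 0" "\<forall>\<epsilon>>0. A2 \<epsilon> > 0"
  shows "\<exists>C. C > 0 \<and> (\<forall>x f R \<nu> E. prime p0 \<and> \<beta> < real p0 \<and> (\<forall>p\<in>E. p0 \<le> p) \<and>
    x \<ge> 2 \<and> f \<in> mult_class A1 A2 \<and> valid_residues v R \<nu> \<and> E \<subseteq> Primes \<longrightarrow>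
    count_bound Omega C \<beta> x f R \<nu> E)"
proof (cases "prime p0 \<and> \<beta> < real p0")
  case False
  \<comment> \<open>A default constant for parameters where the claim is vacuous: the theorem asks
    for a positive constant at every pair of parameters.\<close>
  then show ?thesis by (intro exI[of _ 1]) auto
next
  case True
  then have p0: "real p0 \<ge> 2" using prime_ge_2_nat[of p0] by simp
  define b where "b = max \<beta> 1"
  have b: "b \<ge> 1" "b < real p0" using True p0 by (auto simp: b_def)
  define \<theta> where "\<theta> = ln b / ln (real p0)"
  have \<theta>: "0 \<le> \<theta>" "\<theta> < 1" using b p0 by (auto simp: \<theta>_def)
  have bp: "b = real p0 powr \<theta>" using b p0 by (simp add: \<theta>_def powr_def)
  obtain C where C: "C > 0" and C_all: "\<forall>f E w g \<beta> R \<nu> x. admissible A1 (A2 ((1 - \<theta>) / 16)) b \<theta> f E w \<and> (\<forall>n>0. g n E = wcount w n E) \<and> \<beta> \<le> b \<and>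
    valid_residues v R \<nu> \<and> x \<ge> 2 \<longrightarrow> count_bound g C \<beta> x f R \<nu> E"
  proof -
    have "A2 ((1 - \<theta>) / 16) > 0" using assms(2) \<theta> by simp
    from count_bound_of_admissible[OF assms(1) this b(1) \<theta>, of v] show ?thesis
      by (elim exE conjE) (rule that)
  qed
  have "count_bound Omega C \<beta> x f R \<nu> E"
    if "\<forall>p\<in>E. p0 \<le> p" "x \<ge> 2" "f \<in> mult_class A1 A2" "valid_residues v R \<nu>" "E \<subseteq> Primes" for x f R \<nu> E
  proof (rule C_all[rule_format], intro conjI)
    show "admissible A1 (A2 ((1 - \<theta>) / 16)) b \<theta> f E id"
    proof (intro mult_class_admissible)
      fix p l assume p: "p \<in> E"
      have "b \<le> real p powr \<theta>" unfolding bp using that(1) p p0 \<theta> by (intro powr_mono2) auto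
      then have "b ^ l \<le> (real p powr \<theta>) ^ l" using b by (intro power_mono) auto
      also have "\<dots> = (real p powr \<theta>) powr real l"
        using that(1) p p0 by (intro powr_realpow[symmetric]) force
      also have "\<dots> = real p powr (\<theta> * real l)" by (rule powr_powr)
      finally have le: "b ^ l \<le> real p powr (\<theta> * real l)" .
      also have "\<dots> \<le> b * real p powr (\<theta> * real l)"
        using b mult_right_mono[of 1 b "real p powr (\<theta> * real l)"] by simp
      finally show "b ^ id l \<le> b * real p powr (\<theta> * real l)" by simp
    qed (use that \<theta> in auto)
    show "\<forall>n>0. Omega n E = wcount id n E"
      using Omega_eq_wcount[OF _ that(5)] by simp
  qed (use that in \<open>auto simp: b_def\<close>)
  then show ?thesis using C by blast
qed

text \<open>The permitted dependence of the constants is expressed by the order of quantifiers: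
  \<open>K1\<close> and \<open>K2\<close> are fixed after \<open>A1\<close>, \<open>A2\<close>,
  \<open>v\<close>, and the implied constants are functions of \<open>\<beta>\<close>, for
  \<open>Omega\<close> of \<open>\<beta>\<close> and \<open>p0\<close>, chosen before all other
  data.\<close>

theorem theorem1p1:
  fixes A1 :: real and A2 :: "real \<Rightarrow> real" and v :: nat
  assumes "A1 > 0" and "\<forall>\<epsilon>>0. A2 \<epsilon> > 0"
  shows "\<exists>(K1::real) \<ge> 0. \<exists>(K2::real) \<ge> 0.
    \<exists>(C1_omega :: real \<Rightarrow> real) (C2_omega :: real \<Rightarrow> real)
     (C1_Omega :: real \<Rightarrow> nat \<Rightarrow> real) (C2_Omega :: real \<Rightarrow> nat \<Rightarrow> real).
      (\<forall>\<beta>. C1_omega \<beta> > 0 \<and> C2_omega \<beta> > 0) \<and>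
      (\<forall>\<beta> p0. C1_Omega \<beta> p0 > 0 \<and> C2_Omega \<beta> p0 > 0) \<and>
      (\<forall>(x::real) (p0::nat) (\<alpha>1::real) (\<alpha>2::real) (f :: nat \<Rightarrow> real) (R :: nat \<Rightarrow> int set)
        (\<nu> :: nat \<Rightarrow> nat) (E :: nat set) (g :: nat \<Rightarrow> nat set \<Rightarrow> nat) (\<beta>::real) (C1::real) (C2::real).
        x \<ge> 2 \<and> prime p0 \<and> \<alpha>1 > 0 \<and> 0 < \<alpha>2 \<and> \<alpha>2 < real p0 \<and>
        f \<in> mult_class A1 A2 \<and>
        (\<forall>p. prime p \<longrightarrow> R p \<subseteq> Units (residue_ring (int p)) \<and> card (R p) = \<nu> p \<and> \<nu> p \<le> v) \<and>
        E \<subseteq> Primes \<and> (\<forall>p\<in>E. p0 \<le> p) \<and>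
        (g = omega \<and> \<beta> = \<alpha>1 \<and> C1 = C1_omega \<beta> \<and> C2 = C2_omega \<beta> \<or>
         g = Omega \<and> \<beta> = \<alpha>2 \<and> C1 = C1_Omega \<beta> p0 \<and> C2 = C2_Omega \<beta> p0)
        \<longrightarrow>
        (\<forall>k::nat. real k \<le> \<beta> * msum f x E \<longrightarrow>
          \<bar>\<Sum>n | n \<in> sifted x R \<and> g n E = k. f n\<bar>
            \<le> C1 * (x * (msum f x E + K1) ^ k / (fact k * ln x)
                    * exp (msum f x (Primes - E) - msum (\<lambda>p. real (\<nu> p)) x Primes))) \<and>
        (E = Primes \<longrightarrow>
          (\<forall>k::nat. 1 \<le> k \<and> real k \<le> \<beta> * msum f x Primes \<longrightarrow>
            \<bar>\<Sum>n | n \<in> sifted x R \<and> g n Primes = k. f n\<bar>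
              \<le> C2 * (x * (msum f x Primes + K2) ^ (k - 1) / (fact (k - 1) * ln x)
                      * exp (- msum (\<lambda>p. real (\<nu> p)) x Primes)))))"
proof -
  have "\<forall>\<beta>. \<exists>C. C > 0 \<and> (\<forall>x f R \<nu> E. x \<ge> 2 \<and> f \<in> mult_class A1 A2 \<and> valid_residues v R \<nu> \<and> E \<subseteq> Primes \<longrightarrow>
      count_bound omega C \<beta> x f R \<nu> E)"
    using count_bound_omega[OF assms] by (rule allI)
  then obtain C\<omega> where C\<omega>: "\<forall>\<beta>. C\<omega> \<beta> > 0 \<and> (\<forall>x f R \<nu> E. x \<ge> 2 \<and> f \<in> mult_class A1 A2 \<and> valid_residues v R \<nu> \<and> E \<subseteq> Primes \<longrightarrow>
      count_bound omega (C\<omega> \<beta>) \<beta> x f R \<nu> E)"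
    by (rule choice[THEN exE])
  \<comment> \<open>\<open>z\<close> packs \<open>\<beta>\<close> and \<open>p0\<close> into a pair,
    so that one application of \<open>choice\<close> yields the function of both.\<close>
  have "\<forall>z. \<exists>C. C > 0 \<and> (\<forall>x f R \<nu> E. prime (snd z) \<and> fst z < real (snd z) \<and> (\<forall>p\<in>E. snd z \<le> p) \<and>
      x \<ge> 2 \<and> f \<in> mult_class A1 A2 \<and> valid_residues v R \<nu> \<and> E \<subseteq> Primes \<longrightarrow>
      count_bound Omega C (fst z) x f R \<nu> E)"
    by (rule allI) (rule count_bound_Omega[OF assms])
  then obtain C\<Omega> where C\<Omega>: "\<forall>z. C\<Omega> z > 0 \<and> (\<forall>x f R \<nu> E. prime (snd z) \<and> fst z < real (snd z) \<and> (\<forall>p\<in>E. snd z \<le> p) \<and>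
      x \<ge> 2 \<and> f \<in> mult_class A1 A2 \<and> valid_residues v R \<nu> \<and> E \<subseteq> Primes \<longrightarrow>
      count_bound Omega (C\<Omega> z) (fst z) x f R \<nu> E)"
    by (rule choice[THEN exE])
  have bound: "count_bound g C \<beta> x f R \<nu> E"
    if "x \<ge> 2 \<and> prime p0 \<and> \<alpha>1 > 0 \<and> 0 < \<alpha>2 \<and> \<alpha>2 < real p0 \<and> f \<in> mult_class A1 A2 \<and>
      (\<forall>p. prime p \<longrightarrow> R p \<subseteq> Units (residue_ring (int p)) \<and> card (R p) = \<nu> p \<and> \<nu> p \<le> v) \<and>
      E \<subseteq> Primes \<and> (\<forall>p\<in>E. p0 \<le> p) \<and>
      (g = omega \<and> \<beta> = \<alpha>1 \<and> C = C\<omega> \<beta> \<and> C' = C\<omega> \<beta> \<or>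
       g = Omega \<and> \<beta> = \<alpha>2 \<and> C = C\<Omega> (\<beta>, p0) \<and> C' = C\<Omega> (\<beta>, p0))"
    for x p0 \<alpha>1 \<alpha>2 f R \<nu> E g \<beta> C C'
  proof -
    have R: "valid_residues v R \<nu>" using that by (simp add: valid_residues_def)
    show ?thesis
    proof (cases "g = omega \<and> C = C\<omega> \<beta>")
      case True
      then show ?thesis using C\<omega> R that by simp
    next
      case False
      then have "g = Omega" "\<beta> = \<alpha>2" "C = C\<Omega> (\<beta>, p0)" using that by blast+
      then show ?thesis using C\<Omega>[THEN spec, of "(\<beta>, p0)"] R that by simp
    qed
  qed
  show ?thesis
    apply (rule exI[of _ 0], rule conjI, simp, rule exI[of _ 0], rule conjI, simp)
    apply (rule exI[of _ C\<omega>], rule exI[of _ C\<omega>])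
    apply (rule exI[of _ "\<lambda>\<beta> p0. C\<Omega> (\<beta>, p0)"], rule exI[of _ "\<lambda>\<beta> p0. C\<Omega> (\<beta>, p0)"])
    apply (intro conjI allI impI)
    subgoal using C\<omega> by blast
    subgoal using C\<omega> by blast
    subgoal using C\<Omega> by blast
    subgoal using C\<Omega> by blast
    subgoal premises prems for x p0 \<alpha>1 \<alpha>2 f R \<nu> E g \<beta> C1 C2 k
      using bound[OF prems(1)] prems(2) unfolding count_bound_def by blast
    subgoal premises prems for x p0 \<alpha>1 \<alpha>2 f R \<nu> E g \<beta> C1 C2 k
    proof -
      have "C1 = C2" using prems(1) by blast
      then show ?thesis using bound[OF prems(1)] prems(2,3) unfolding count_bound_def by blast
    qed
    done
qed

end
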